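(* Suppose Assumptions (A), (B'), (D'), (D''), (E), (F) and (G) (stated in the context) hold. If $d^5\log d=o(n)$ and $s_2=o(\sqrt n/(\sqrt d\,\kappa_n\gamma_n))$, then $$\sqrt n\,\boldsymbol A_n(\tilde{\boldsymbol\beta}-\boldsymbol\beta^\star)\to N(0,\sigma^2\boldsymbol G_X)\quad\text{in distribution.}$$
   Context: Notation: $a_n\ll b_n$ (equivalently $b_n\gg a_n$) means $a_n=o(b_n)$; all limits are as $n\to\infty$; $\|\cdot\|_F$ is the Frobenius norm and $\|\cdot\|_{F,d}=d^{-1/2}\|\cdot\|_F$. Model: $d=d_n\to\infty$ with $d\ll n$. For each $n$ the data satisfy $Y_i=\mu_i^\star+\boldsymbol X_i^T\boldsymbol\beta^\star+\epsilon_i$, $1\le i\le n$, where $\boldsymbol\beta^\star\in\mathbb R^d$ and $\boldsymbol\mu^\star\in\mathbb R^n$ are deterministic (and may vary with $n$). The $\boldsymbol X_i$ are i.i.d. copies of a random vector $\boldsymbol X_0=(X_{01},\dots,X_{0d})^T\in\mathbb R^d$ with mean zero and positive definite covariance matrix $\boldsymbol\Sigma_X$; they are independent of the $\epsilon_i$, which are i.i.d. copies of a random variable $\epsilon_0$ with mean zero and variance $\sigma^2>0$. $\boldsymbol X$ is the $n\times d$ matrix with rows $\boldsymbol X_i^T$ and $\boldsymbol Y=(Y_1,\dots,Y_n)^T$. Assumption (A): there are positive sequences $\kappa_n\ll\sqrt n$, $\gamma_n\ll\sqrt n$ with $P(\max_{1\le i\le n}\|\boldsymbol X_i\|_2>\kappa_n)\to0$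 and $P(\max_{1\le i\le n}|\epsilon_i|>\gamma_n)\to0$. Incidental parameters: with $s=s_1+s_2$ and $s_1+s_2=o(n)$: $|\mu_i^\star|\gg\max\{\kappa_n,\gamma_n\}$ for $1\le i\le s_1$; $0<|\mu_i^\star|\le\gamma_n$ for $s_1+1\le i\le s$; $\mu_i^\star=0$ for $s+1\le i\le n$. Let $\mu^\star=\min_{1\le i\le s_1}|\mu_i^\star|$. Assumption (B'): the regularization parameter $\lambda=\lambda_n>0$ satisfies $\sqrt d\,\kappa_n\ll\lambda$, $\alpha\gamma_n\le\lambda$ for a constant $\alpha>2$, and $\lambda\ll\mu^\star$. Assumption (D'): the smallest eigenvalue $\lambda_{\min}(\boldsymbol\Sigma_X)$ is bounded away from zero. Assumption (D''): $\|\boldsymbol\Sigma_X\|_{F,d}$ is bounded. Assumption (E): $\kappa_X=d^{-1}\sum_{j=1}^d(E[X_{0j}^4])^{1/2}$ is bounded. $\boldsymbol A_n$ is a (deterministic) $q\times d$ matrix with $q$ a fixed integer, $\boldsymbol G_n=\boldsymbol A_n\boldsymbol A_n^T$ and $\boldsymbol G_{X,n}=\boldsymbol A_n\boldsymbol\Sigma_X^{-1}\boldsymbol A_n^T$. Assumption (F): $\|\boldsymbol A_n\|_F$ and the largest eigenvalue $\lambda_{\max}(\boldsymbol G_n)$ are bounded, and $\boldsymbol G_{X,n}$ converges to a $q\times q$ symmetric matrix $\boldsymbol G_X$ with respect to $\|\cdot\|_F$. Let $\sigma_{X,\max}^2=\max_{j\le d}\mathrm{Var}[X_{0j}]$, $\sigma_{X,\min}^2=\min_{j\le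 d}\mathrm{Var}[X_{0j}]$, $\gamma_{X,\max}=\max_{j\le d}E|X_{0j}|^3$. Assumption (G): $\sigma_{X,\max}>0$; $\sigma_{X,\max}$ and $\gamma_{X,\max}$ are bounded from above and $\sigma_{X,\min}$ is bounded away from zero. Two-step estimator: first let $(\hat{\boldsymbol\mu},\hat{\boldsymbol\beta})$ be a minimizer over $\mathbb R^n\times\mathbb R^d$ of $\|\boldsymbol Y-\boldsymbol\mu-\boldsymbol X\boldsymbol\beta\|_2^2+2\lambda\sum_{i=1}^n|\mu_i|$ and put $\hat I_0=\{1\le i\le n:\hat\mu_i=0\}$. Then $\tilde{\boldsymbol\beta}=(\boldsymbol X_{\hat I_0}^T\boldsymbol X_{\hat I_0})^{-1}\boldsymbol X_{\hat I_0}^T\boldsymbol Y_{\hat I_0}$, where $\boldsymbol X_{\hat I_0}$ is the matrix with rows $\boldsymbol X_i^T$, $i\in\hat I_0$, and $\boldsymbol Y_{\hat I_0}$ is the vector of the corresponding $Y_i$. *)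

theory Defs
  imports
    "HOL-Probability.Probability"
    "HOL-Library.Landau_Symbols"
    "Jordan_Normal_Form.Gauss_Jordan_Elimination"
    "Jordan_Normal_Form.Spectral_Radius"
    "Jordan_Normal_Form.DL_Submatrix"
begin

text \<open>
  The dimension \<open>d\<close> grows with \<open>n\<close>, so vectors and matrices carry their dimensions as
  numbers: they are those of \<open>Jordan_Normal_Form\<close>, and all indices start at 0.
\<close>

hide_const (open) Finite_Cartesian_Product.vec Finite_Cartesian_Product.vec_nth
  Finite_Cartesian_Product.row Finite_Cartesian_Product.column
no_notation Finite_Cartesian_Product.vec_nth (infixl "$" 90)
no_notation Inner_Product.real_inner_class.inner (infixl "\<bullet>" 70)

section \<open>Vectors and matrices\<close>

definition vec_norm2 :: "real vec \<Rightarrow> real" where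
  "vec_norm2 v = L2_set (\<lambda>i. v $ i) {..<dim_vec v}"

definition frob_norm :: "real mat \<Rightarrow> real" where
  "frob_norm A = L2_set (\<lambda>ij. A $$ ij) ({..<dim_row A} \<times> {..<dim_col A})"

definition frob_norm_scaled :: "nat \<Rightarrow> real mat \<Rightarrow> real" where
  "frob_norm_scaled d A = frob_norm A / sqrt (real d)"

definition pos_def_mat :: "nat \<Rightarrow> real mat \<Rightarrow> bool" where
  "pos_def_mat d A \<longleftrightarrow> A \<in> carrier_mat d d \<and> transpose_mat A = A \<and>
     (\<forall>v\<in>carrier_vec d. v \<noteq> 0\<^sub>v d \<longrightarrow> v \<bullet> (A *\<^sub>v v) > 0)"

text \<open>Only used for symmetric matrices, all of whose eigenvalues are real.\<close>

definition lambda_min :: "real mat \<Rightarrow> real" where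
  "lambda_min A = Min (spectrum A)"

definition lambda_max :: "real mat \<Rightarrow> real" where
  "lambda_max A = Max (spectrum A)"

text \<open>Only meaningful for invertible matrices.\<close>

definition inv_mat :: "real mat \<Rightarrow> real mat" where
  "inv_mat A = the (mat_inverse A)"

definition sub_vec :: "'a vec \<Rightarrow> nat set \<Rightarrow> 'a vec" where
  "sub_vec v I = vec (card {i. i < dim_vec v \<and> i \<in> I}) (\<lambda>k. v $ pick I k)"

section \<open>Random vectors, weak convergence and the normal law\<close>

text \<open>
  The measurable space \<open>\<real>\<^sup>k\<close> is the product of \<open>k\<close> copies of the Borel line;
  its points are the functions on \<open>{..<k}\<close> (with the value \<open>undefined\<close> elsewhere).
\<close>

abbreviation RV :: "nat \<Rightarrow> (nat \<Rightarrow> real) measure" where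
  "RV k \<equiv> PiM {..<k} (\<lambda>_. borel)"

definition coords :: "nat \<Rightarrow> real vec \<Rightarrow> nat \<Rightarrow> real" where
  "coords k v = (\<lambda>j\<in>{..<k}. v $ j)"

definition random_vec :: "'a measure \<Rightarrow> nat \<Rightarrow> ('a \<Rightarrow> real vec) \<Rightarrow> bool" where
  "random_vec M k V \<longleftrightarrow> (\<forall>\<omega>\<in>space M. V \<omega> \<in> carrier_vec k) \<and>
     (\<lambda>\<omega>. coords k (V \<omega>)) \<in> measurable M (RV k)"

definition vec_law :: "'a measure \<Rightarrow> nat \<Rightarrow> ('a \<Rightarrow> real vec) \<Rightarrow> (nat \<Rightarrow> real) measure" where
  "vec_law M k V = distr M (RV k) (\<lambda>\<omega>. coords k (V \<omega>))"

definition weak_conv_vec ::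
  "nat \<Rightarrow> (nat \<Rightarrow> (nat \<Rightarrow> real) measure) \<Rightarrow> (nat \<Rightarrow> real) measure \<Rightarrow> bool" where
  "weak_conv_vec k N_seq N \<longleftrightarrow>
     (\<forall>f. continuous_map (product_topology (\<lambda>_. euclideanreal) {..<k}) euclideanreal f \<and>
          bounded (f ` topspace (product_topology (\<lambda>_. euclideanreal) {..<k})) \<longrightarrow>
          (\<lambda>n. \<integral>x. f x \<partial>N_seq n) \<longlonglongrightarrow> (\<integral>x. f x \<partial>N))"

text \<open>
  \<open>N\<close> is the (possibly degenerate) normal law on \<open>\<real>\<^sup>k\<close> with mean \<open>m\<close> and covariance \<open>S\<close>:
  the law of \<open>m + L Z\<close>, where \<open>L L\<^sup>T = S\<close> and \<open>Z\<close> has independent standard normal coordinates.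
\<close>

definition normal_law ::
  "nat \<Rightarrow> real vec \<Rightarrow> real mat \<Rightarrow> (nat \<Rightarrow> real) measure \<Rightarrow> bool" where
  "normal_law k m S N \<longleftrightarrow> (\<exists>L\<in>carrier_mat k k. L * transpose_mat L = S \<and>
     N = distr (PiM {..<k} (\<lambda>_. density lborel (\<lambda>x. ennreal (std_normal_density x)))) (RV k)
           (\<lambda>z. coords k (m + L *\<^sub>v vec k z)))"

section \<open>Moments of a law on \<open>\<real>\<^sup>d\<close>\<close>

definition cov_mat :: "nat \<Rightarrow> (nat \<Rightarrow> real) measure \<Rightarrow> real mat" where
  "cov_mat d P = mat d d (\<lambda>(j, k). \<integral>x. (x j - (\<integral>y. y j \<partial>P)) * (x k - (\<integral>y. y k \<partial>P)) \<partial>P)"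

definition kappa_X :: "nat \<Rightarrow> (nat \<Rightarrow> real) measure \<Rightarrow> real" where
  "kappa_X d P = (\<Sum>j<d. sqrt (\<integral>x. x j ^ 4 \<partial>P)) / real d"

definition sigma_X_max :: "nat \<Rightarrow> (nat \<Rightarrow> real) measure \<Rightarrow> real" where
  "sigma_X_max d P = sqrt (Max ((\<lambda>j. cov_mat d P $$ (j, j)) ` {..<d}))"

definition sigma_X_min :: "nat \<Rightarrow> (nat \<Rightarrow> real) measure \<Rightarrow> real" where
  "sigma_X_min d P = sqrt (Min ((\<lambda>j. cov_mat d P $$ (j, j)) ` {..<d}))"

definition gamma_X_max :: "nat \<Rightarrow> (nat \<Rightarrow> real) measure \<Rightarrow> real" where
  "gamma_X_max d P = Max ((\<lambda>j. \<integral>x. \<bar>x j\<bar> ^ 3 \<partial>P) ` {..<d})"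

section \<open>The model for a fixed sample size\<close>

definition design_law :: "nat \<Rightarrow> (nat \<Rightarrow> real) measure \<Rightarrow> bool" where
  "design_law d P \<longleftrightarrow> prob_space P \<and> sets P = sets (RV d) \<and>
     (\<forall>j<d. integrable P (\<lambda>x. (x j)\<^sup>2) \<and> (\<integral>x. x j \<partial>P) = 0) \<and>
     pos_def_mat d (cov_mat d P)"

definition noise_law :: "real \<Rightarrow> real measure \<Rightarrow> bool" where
  "noise_law \<sigma> Q \<longleftrightarrow> prob_space Q \<and> sets Q = sets borel \<and>
     integrable Q (\<lambda>x. x\<^sup>2) \<and> (\<integral>x. x \<partial>Q) = 0 \<and> (\<integral>x. x\<^sup>2 \<partial>Q) = \<sigma>\<^sup>2"

text \<open>
  The \<open>X i\<close>, \<open>i < n\<close>, are i.i.d. with law \<open>P\<close>, the \<open>\<epsilon> i\<close> are i.i.d. with law \<open>Q\<close>,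
  and the two families are independent of each other.
\<close>

definition data_model ::
  "'a measure \<Rightarrow> nat \<Rightarrow> nat \<Rightarrow> (nat \<Rightarrow> real) measure \<Rightarrow> real measure
    \<Rightarrow> (nat \<Rightarrow> 'a \<Rightarrow> real vec) \<Rightarrow> (nat \<Rightarrow> 'a \<Rightarrow> real) \<Rightarrow> bool" where
  "data_model M n d P Q X \<epsilon> \<longleftrightarrow> prob_space M \<and>
     (\<forall>i<n. random_vec M d (X i) \<and> vec_law M d (X i) = P) \<and>
     (\<forall>i<n. \<epsilon> i \<in> borel_measurable M \<and> distr M borel (\<epsilon> i) = Q) \<and>
     prob_space.indep_vars M (\<lambda>_. RV d) (\<lambda>i \<omega>. coords d (X i \<omega>)) {..<n} \<and>
     prob_space.indep_vars M (\<lambda>_. borel) \<epsilon> {..<n} \<and>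
     prob_space.indep_set M
       (sets (vimage_algebra (space M) (\<lambda>\<omega>. \<lambda>i\<in>{..<n}. coords d (X i \<omega>)) (PiM {..<n} (\<lambda>_. RV d))))
       (sets (vimage_algebra (space M) (\<lambda>\<omega>. \<lambda>i\<in>{..<n}. \<epsilon> i \<omega>) (PiM {..<n} (\<lambda>_. borel))))"

definition design_mat ::
  "nat \<Rightarrow> nat \<Rightarrow> (nat \<Rightarrow> 'a \<Rightarrow> real vec) \<Rightarrow> 'a \<Rightarrow> real mat" where
  "design_mat n d X \<omega> = mat n d (\<lambda>(i, j). X i \<omega> $ j)"

definition response ::
  "nat \<Rightarrow> real vec \<Rightarrow> real vec \<Rightarrow> (nat \<Rightarrow> 'a \<Rightarrow> real vec) \<Rightarrow> (nat \<Rightarrow> 'a \<Rightarrow> real) \<Rightarrow> 'a \<Rightarrow> real vec" where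
  "response n \<mu> \<beta> X \<epsilon> \<omega> = vec n (\<lambda>i. \<mu> $ i + X i \<omega> \<bullet> \<beta> + \<epsilon> i \<omega>)"

section \<open>The two-step estimator\<close>

definition penalized_loss ::
  "real \<Rightarrow> real mat \<Rightarrow> real vec \<Rightarrow> real vec \<times> real vec \<Rightarrow> real" where
  "penalized_loss lam X Y = (\<lambda>(\<mu>, \<beta>).
     (vec_norm2 (Y - \<mu> - X *\<^sub>v \<beta>))\<^sup>2 + 2 * lam * (\<Sum>i<dim_vec Y. \<bar>\<mu> $ i\<bar>))"

definition penalized_minimizer ::
  "nat \<Rightarrow> nat \<Rightarrow> real \<Rightarrow> real mat \<Rightarrow> real vec \<Rightarrow> real vec \<Rightarrow> real vec \<Rightarrow> bool" where
  "penalized_minimizer n d lam X Y \<mu> \<beta> \<longleftrightarrow>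
     is_arg_min (penalized_loss lam X Y) (\<lambda>p. p \<in> carrier_vec n \<times> carrier_vec d) (\<mu>, \<beta>)"

definition zero_set :: "real vec \<Rightarrow> nat set" where
  "zero_set \<mu> = {i. i < dim_vec \<mu> \<and> \<mu> $ i = 0}"

text \<open>
  Where the Gram matrix of the selected rows is singular, the least squares formula is
  undefined and the value of the estimator is left unspecified.
\<close>

definition ols_on :: "nat set \<Rightarrow> real mat \<Rightarrow> real vec \<Rightarrow> real vec \<Rightarrow> bool" where
  "ols_on I X Y b \<longleftrightarrow>
     (let X\<^sub>I = submatrix X I UNIV; Y\<^sub>I = sub_vec Y I; Gram = transpose_mat X\<^sub>I * X\<^sub>I in
      invertible_mat Gram \<longrightarrow> b = inv_mat Gram *\<^sub>v (transpose_mat X\<^sub>I *\<^sub>v Y\<^sub>I))"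

section \<open>Asymptotic order\<close>

definition bounded_away_from_zero :: "(nat \<Rightarrow> real) \<Rightarrow> bool" where
  "bounded_away_from_zero f \<longleftrightarrow> (\<exists>c>0. \<forall>n\<ge>1. c \<le> f n)"

definition mu_star :: "nat \<Rightarrow> real vec \<Rightarrow> real" where
  "mu_star s \<mu> = Min ((\<lambda>i. \<bar>\<mu> $ i\<bar>) ` {..<s})"

text \<open>
  \<open>a n\<close> is of smaller order than \<open>mu_star (s n) (\<mu> n)\<close>. The minimum of an empty set is
  read as infinity, so there is no condition at those \<open>n\<close> with \<open>s n = 0\<close>.
\<close>

definition negligible_to_mu_star :: "(nat \<Rightarrow> real) \<Rightarrow> (nat \<Rightarrow> nat) \<Rightarrow> (nat \<Rightarrow> real vec) \<Rightarrow> bool" where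
  "negligible_to_mu_star a s \<mu> \<longleftrightarrow>
     (\<forall>c>0. \<forall>\<^sub>F n in sequentially. s n > 0 \<longrightarrow> \<bar>a n\<bar> \<le> c * mu_star (s n) (\<mu> n))"

end

theory Submission
  imports Defs
begin

text \<open>
  By convexity the first step acts like a Huber regression. With high probability every row with
  index at least \<open>s1\<close> stays in the quadratic regime of the Huber loss on a ball that is larger
  than the stochastic error, so the minimizer lies in that ball, and then the optimality conditions
  identify the selected rows exactly as \<open>{s1..<n}\<close>. On that event the normal equations, compared
  with the population covariance, turn \<open>sqrt n * A (beta_tilde - \<beta>)\<close> into a sum of independent
  terms with rows \<open>A \<Sigma>\<^sub>X\<inverse>\<close> up to an error of order \<open>sqrt (d^5 / n) + 1 / sqrt d\<close>.
  Characteristic functions of linear combinations of this sum converge by a Lindeberg-type bound.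
  They determine weak convergence in \<open>\<real>\<^sup>q\<close>: trigonometric sums are dense on boxes by
  Stone-Weierstrass, and composing such a sum with a polynomial that approximates a clamp keeps it
  bounded off the box, where tightness takes over.
\<close>

section \<open>Weak convergence from trigonometric integrals\<close>

text \<open>Exact selection matters because it makes the index set of the second step deterministic:
  sums over \<open>{s1..<n}\<close> stay sums of independent terms, although the rows were chosen
  from the same data. Apart from the assumed bounds on the maxima, the stochastic control is
  Chebyshev's inequality, with Frobenius norms in place of operator norms because their second
  moments can be computed; the main input is E|X|^4 = O(d^2). The thresholds for the noise sum and
  the Gram error lie a factor sqrt d above the standard deviations, so that they fail with
  probability O(1/d), which vanishes as d grows. This slack fixes the rate: the second-step error is
  of order d / sqrt n, the relative Gram error of order sqrt (d^3 / n), and sqrt n times their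
  product is sqrt (d^5 / n). The term 1 / sqrt d is the bias of the \<open>s2\<close> small shifts,
  which stay in the sample because they cannot be told from noise. No moment of the estimator is
  available, not even its value where the Gram matrix is singular, so both convergence and tightness
  are transferred from the linear statistic through the good event.\<close>

inductive trig_fun :: "nat \<Rightarrow> ((nat \<Rightarrow> real) \<Rightarrow> real) \<Rightarrow> bool" for q where
  trig_cos: "trig_fun q (\<lambda>x. c * cos ((\<Sum>r<q. t r * x r) + a))"
| trig_add: "trig_fun q f \<Longrightarrow> trig_fun q g \<Longrightarrow> trig_fun q (\<lambda>x. f x + g x)"

lemma trig_fun_const: "trig_fun q (\<lambda>_. c)"
  using trig_cos[of q c "\<lambda>_. 0" 0] by simp

text \<open>Product-to-sum formula. The free phase in the generator covers sines and constants as
  well, so sums of shifted cosines form an algebra.\<close>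

lemma trig_fun_mult:
  assumes "trig_fun q f" "trig_fun q g"
  shows "trig_fun q (\<lambda>x. f x * g x)"
  using assms
proof (induction rule: trig_fun.induct)
  case (trig_cos c t a)
  show ?case using trig_cos.prems
  proof (induction rule: trig_fun.induct)
    case (trig_cos c' t' a')
    have "(\<lambda>x. c * cos ((\<Sum>r<q. t r * x r) + a) * (c' * cos ((\<Sum>r<q. t' r * x r) + a'))) =
      (\<lambda>x. c * c' / 2 * cos ((\<Sum>r<q. (t r - t' r) * x r) + (a - a')) +
           c * c' / 2 * cos ((\<Sum>r<q. (t r + t' r) * x r) + (a + a')))"
      (is "?L = ?R")
    proof
      fix x
      have "(\<Sum>r<q. (t r - t' r) * x r) + (a - a') =
          ((\<Sum>r<q. t r * x r) + a) - ((\<Sum>r<q. t' r * x r) + a')"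
        by (simp add: left_diff_distrib sum_subtractf)
      moreover have "(\<Sum>r<q. (t r + t' r) * x r) + (a + a') =
          ((\<Sum>r<q. t r * x r) + a) + ((\<Sum>r<q. t' r * x r) + a')"
        by (simp add: distrib_right sum.distrib)
      ultimately show "?L x = ?R x"
        by (simp only: cos_diff cos_add) (simp add: field_simps)
    qed
    then show ?case by (simp only:) (intro trig_fun.intros)
  next
    case (trig_add f g)
    then show ?case by (simp add: distrib_left trig_fun.trig_add)
  qed
next
  case (trig_add f g)
  then show ?case by (simp add: distrib_right trig_fun.trig_add)
qed

lemma trig_fun_continuous: "trig_fun q f \<Longrightarrow> continuous_on A f"
proof (induction rule: trig_fun.induct)
  case (trig_cos c t a)
  have "continuous_on A (\<lambda>x :: nat \<Rightarrow> real. x r)" for r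
    by (rule continuous_on_product_then_coordinatewise) (rule continuous_on_id)
  then show ?case by (intro continuous_intros)
qed (intro continuous_intros)

lemma trig_fun_bounded: "trig_fun q f \<Longrightarrow> \<exists>B>0. \<forall>x. \<bar>f x\<bar> \<le> B"
proof (induction rule: trig_fun.induct)
  case (trig_cos c t a)
  have "\<bar>c * cos ((\<Sum>r<q. t r * x r) + a)\<bar> \<le> \<bar>c\<bar> + 1" for x
    using mult_left_mono[OF abs_cos_le_one, of "\<bar>c\<bar>" "(\<Sum>r<q. t r * x r) + a"] by (simp add: abs_mult)
  then show ?case by (intro exI[of _ "\<bar>c\<bar> + 1"]) auto
next
  case (trig_add f g)
  then obtain B C where "B > 0" "\<forall>x. \<bar>f x\<bar> \<le> B" "C > 0" "\<forall>x. \<bar>g x\<bar> \<le> C" by blast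
  then have "B + C > 0 \<and> (\<forall>x. \<bar>f x + g x\<bar> \<le> B + C)"
    by (metis abs_triangle_ineq add_mono add_pos_pos order_trans)
  then show ?case by blast
qed

lemma trig_fun_cong: "trig_fun q f \<Longrightarrow> (\<And>r. r < q \<Longrightarrow> x r = y r) \<Longrightarrow> f x = f y"
  by (induction rule: trig_fun.induct) auto

lemma trig_fun_measurable: "trig_fun q f \<Longrightarrow> f \<in> borel_measurable (RV q)"
  by (induction rule: trig_fun.induct) auto

text \<open>Closure under polynomials is what allows the later cut-off: a clamp is not
  trigonometric, but a polynomial close to it may be applied.\<close>

lemma trig_fun_polynomial:
  assumes "real_polynomial_function p" "trig_fun q f"
  shows "trig_fun q (\<lambda>x. p (f x))"
  using assms
proof (induction rule: real_polynomial_function.induct)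
  case (linear p)
  then obtain c where "p = (\<lambda>x. x * c)" by (metis real_bounded_linear)
  then show ?case using trig_fun_mult[OF linear(2) trig_fun_const[of q c]] by simp
qed (auto intro: trig_fun_const trig_fun_mult trig_add)

lemma trig_fun_integral_tendsto:
  assumes "trig_fun q f"
    and N_seq: "\<forall>\<^sub>F n in sequentially. prob_space (N_seq n) \<and> sets (N_seq n) = sets (RV q)"
    and N: "prob_space N" "sets N = sets (RV q)"
    and conv: "\<And>t a. (\<lambda>n. \<integral>x. cos ((\<Sum>r<q. t r * x r) + a) \<partial>N_seq n) \<longlonglongrightarrow>
                 (\<integral>x. cos ((\<Sum>r<q. t r * x r) + a) \<partial>N)"
  shows "(\<lambda>n. \<integral>x. f x \<partial>N_seq n) \<longlonglongrightarrow> (\<integral>x. f x \<partial>N)"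
proof -
  have int: "integrable L h" if "trig_fun q h" "prob_space L" "sets L = sets (RV q)" for h and L :: "(nat \<Rightarrow> real) measure"
  proof -
    interpret prob_space L by fact
    obtain B where "\<forall>x. \<bar>h x\<bar> \<le> B" using trig_fun_bounded[OF \<open>trig_fun q h\<close>] by blast
    then show ?thesis using trig_fun_measurable[OF that(1)]
      by (intro integrable_const_bound[of _ B]) (auto simp: measurable_cong_sets[OF that(3) refl])
  qed
  show ?thesis using assms(1)
  proof (induction rule: trig_fun.induct)
    case (trig_cos c t a)
    then show ?case by (simp add: tendsto_mult_left[OF conv])
  next
    case (trig_add f g)
    have "(\<lambda>n. (\<integral>x. f x \<partial>N_seq n) + (\<integral>x. g x \<partial>N_seq n)) \<longlonglongrightarrow> (\<integral>x. f x \<partial>N) + (\<integral>x. g x \<partial>N)"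
      using trig_add by (intro tendsto_add)
    moreover have "\<forall>\<^sub>F n in sequentially. (\<integral>x. f x \<partial>N_seq n) + (\<integral>x. g x \<partial>N_seq n) = (\<integral>x. f x + g x \<partial>N_seq n)"
      using N_seq by eventually_elim (simp add: Bochner_Integration.integral_add int trig_add)
    ultimately show ?case
      by (simp add: Bochner_Integration.integral_add int trig_add N filterlim_cong)
  qed
qed

text \<open>Points are functions on all of nat. Fixing the coordinates from \<open>q\<close> on to 0
  makes the box a Tychonoff product of compact factors, hence compact in the topology of the type
  that Stone-Weierstrass refers to.\<close>

lemma compact_box: "compact {x :: nat \<Rightarrow> real. (\<forall>r<q. \<bar>x r\<bar> \<le> K) \<and> (\<forall>r\<ge>q. x r = 0)}"
proof -
  have "{x :: nat \<Rightarrow> real. (\<forall>r<q. \<bar>x r\<bar> \<le> K) \<and> (\<forall>r\<ge>q. x r = 0)} =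
      PiE UNIV (\<lambda>r. if r < q then {-K..K} else {0})"
  proof (rule Set.set_eqI, rule iffI)
    fix x assume "x \<in> PiE UNIV (\<lambda>r. if r < q then {-K..K} else {0})"
    then have *: "x r \<in> (if r < q then {-K..K} else {0})" for r by (rule PiE_mem) simp
    have "\<bar>x r\<bar> \<le> K" if "r < q" for r using *[of r] that by (simp add: abs_le_iff)
    moreover have "x r = 0" if "r \<ge> q" for r using *[of r] that by simp
    ultimately show "x \<in> {x. (\<forall>r<q. \<bar>x r\<bar> \<le> K) \<and> (\<forall>r\<ge>q. x r = 0)}" by simp
  next
    fix x :: "nat \<Rightarrow> real" assume *: "x \<in> {x. (\<forall>r<q. \<bar>x r\<bar> \<le> K) \<and> (\<forall>r\<ge>q. x r = 0)}"
    have "x r \<in> (if r < q then {-K..K} else {0})" for r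
      using * by (cases "r < q") (auto simp: abs_le_iff)
    then show "x \<in> PiE UNIV (\<lambda>r. if r < q then {-K..K} else {0})" by (simp add: PiE_UNIV_domain)
  qed
  moreover have "compactin (product_topology (\<lambda>_. euclideanreal) UNIV) (PiE (UNIV :: nat set) (\<lambda>r. if r < q then {-K..K} else {0}))"
    by (subst compactin_PiE) auto
  ultimately show ?thesis by (simp add: euclidean_product_topology)
qed

lemma trig_fun_dense_on_box:
  assumes "continuous_on {x. (\<forall>r<q. \<bar>x r\<bar> \<le> K) \<and> (\<forall>r\<ge>q. x r = 0)} F" "e > 0" "K > 0"
  obtains g where "trig_fun q g" "\<And>x. (\<forall>r<q. \<bar>x r\<bar> \<le> K) \<and> (\<forall>r\<ge>q. x r = 0) \<Longrightarrow> \<bar>F x - g x\<bar> < e"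
proof -
  let ?S = "{x. (\<forall>r<q. \<bar>x r\<bar> \<le> K) \<and> (\<forall>r\<ge>q. x r = 0)}"
  interpret function_ring_on "Collect (trig_fun q)" ?S
  proof
    show "compact ?S" by (rule compact_box)
    fix x y :: "nat \<Rightarrow> real" assume xy: "x \<in> ?S" "y \<in> ?S" "x \<noteq> y"
    then obtain r where r: "r < q" "x r \<noteq> y r"
    proof -
      obtain r where "x r \<noteq> y r" using xy(3) by blast
      moreover have "r < q" using calculation xy(1,2) by (metis (mono_tags, lifting) mem_Collect_eq not_le_imp_less)
      ultimately show ?thesis using that by blast
    qed
    \<comment> \<open>The phase -pi/2 turns the cosine into sin (z r / K). The frequency 1 / K keeps
      the argument in [-1, 1] on the box, where the sine is injective, so the differing coordinate
      is separated.\<close>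
    define h where "h = (\<lambda>x. 1 * cos ((\<Sum>k<q. (if k = r then 1 / K else 0) * x k) + (- pi / 2)))"
    have h: "h z = sin (z r / K)" for z
      using r(1) by (simp add: h_def if_distrib[of "\<lambda>c. c * _"] cos_diff cong: if_cong)
    have b: "\<bar>z r / K\<bar> \<le> pi / 2" if "z \<in> ?S" for z
    proof -
      have "\<bar>z r / K\<bar> \<le> 1" using that r(1) \<open>K > 0\<close> by (simp add: abs_div)
      then show ?thesis using pi_gt3 by linarith
    qed
    have "\<bar>x r / K\<bar> \<le> pi / 2" "\<bar>y r / K\<bar> \<le> pi / 2"
      using b xy by blast+
    then have "- (pi / 2) \<le> x r / K" "x r / K \<le> pi / 2" "- (pi / 2) \<le> y r / K" "y r / K \<le> pi / 2"
      by linarith+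
    then have "sin (x r / K) \<noteq> sin (y r / K)"
      using sin_inj_pi[of "x r / K" "y r / K"] r(2) \<open>K > 0\<close> by auto
    then have "h x \<noteq> h y" by (simp add: h)
    moreover have "trig_fun q h" unfolding h_def by (rule trig_cos)
    ultimately show "\<exists>f\<in>Collect (trig_fun q). f x \<noteq> f y" by blast
  qed (auto intro: trig_fun_const trig_fun_mult trig_add trig_fun_continuous)
  show ?thesis using Stone_Weierstrass_basic[OF assms(1,2)] that by auto
qed

lemma weak_conv_vecI:
  assumes N_seq: "\<forall>\<^sub>F n in sequentially. prob_space (N_seq n) \<and> sets (N_seq n) = sets (RV q)"
    and N: "prob_space N" "sets N = sets (RV q)"
    and conv: "\<And>t a. (\<lambda>n. \<integral>x. cos ((\<Sum>r<q. t r * x r) + a) \<partial>N_seq n) \<longlonglongrightarrow>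
                 (\<integral>x. cos ((\<Sum>r<q. t r * x r) + a) \<partial>N)"
    and tight: "\<And>e. e > 0 \<Longrightarrow> \<exists>K. \<forall>\<^sub>F n in sequentially.
                 measure (N_seq n) {x \<in> space (RV q). \<exists>r<q. \<bar>x r\<bar> > K} \<le> e"
    and tight_N: "\<And>e. e > 0 \<Longrightarrow> \<exists>K. measure N {x \<in> space (RV q). \<exists>r<q. \<bar>x r\<bar> > K} \<le> e"
  shows "weak_conv_vec q N_seq N"
  unfolding weak_conv_vec_def
proof (intro allI impI, elim conjE)
  fix f :: "(nat \<Rightarrow> real) \<Rightarrow> real"
  assume cont: "continuous_map (product_topology (\<lambda>_. euclideanreal) {..<q}) euclideanreal f"
    and bdd: "bounded (f ` topspace (product_topology (\<lambda>_. euclideanreal) {..<q}))"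
  \<comment> \<open>\<open>f\<close> is meaningful on functions that are undefined from
    \<open>q\<close> on, while the box consists of functions that vanish there. \<open>F\<close>
    extends \<open>f\<close> to the whole type, and \<open>ext0\<close> passes from the first
    encoding to the second.\<close>
  define F where "F x = f (restrict x {..<q})" for x
  define ext0 where "ext0 x = (\<lambda>r. if r < q then x r else (0::real))" for x :: "nat \<Rightarrow> real"
  have F_cont: "continuous_on UNIV F"
  proof -
    have "continuous_map (product_topology (\<lambda>_. euclideanreal) UNIV) (product_topology (\<lambda>_. euclideanreal) {..<q})
        (\<lambda>x. restrict x {..<q})"
      by (auto simp: continuous_map_componentwise intro!: continuous_map_product_projection)
    from continuous_map_compose[OF this cont] show ?thesis
      by (simp add: euclidean_product_topology F_def[abs_def] o_def)
  qed
  obtain B where B: "B > 0" "\<And>x. \<bar>F x\<bar> \<le> B"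
  proof -
    obtain B where "B > 0" "\<forall>y\<in>f ` topspace (product_topology (\<lambda>_. euclideanreal) {..<q}). norm y \<le> B"
      using bdd bounded_pos by blast
    then have "\<bar>F x\<bar> \<le> B" for x by (auto simp: F_def)
    with \<open>B > 0\<close> show ?thesis by (rule that)
  qed
  have ext0: "F (ext0 x) = f x" if "x \<in> space (RV q)" for x
  proof -
    have "restrict (ext0 x) {..<q} = x"
      using that by (auto simp: space_PiM ext0_def PiE_def extensional_def fun_eq_iff)
    then show ?thesis by (simp add: F_def)
  qed
  have f_meas: "f \<in> borel_measurable (RV q)"
  proof -
    have "ext0 \<in> measurable (RV q) (PiM UNIV (\<lambda>_. borel))"
      unfolding ext0_def
    proof (rule measurable_PiM_single')
      show "(\<lambda>x. if r < q then x r else 0) \<in> borel_measurable (RV q)" for r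
        by (cases "r < q") auto
    qed auto
    then have "ext0 \<in> measurable (RV q) borel"
      by (simp add: measurable_cong_sets[OF refl sets_PiM_equal_borel])
    from measurable_compose[OF this borel_measurable_continuous_onI[OF F_cont]]
    show ?thesis by (subst measurable_cong[where g = "\<lambda>x. F (ext0 x)"]) (simp_all add: ext0)
  qed
  have f_bound: "\<bar>f x\<bar> \<le> B" if "x \<in> space (RV q)" for x using B(2)[of "ext0 x"] ext0[OF that] by simp
  show "(\<lambda>n. \<integral>x. f x \<partial>N_seq n) \<longlonglongrightarrow> (\<integral>x. f x \<partial>N)"
  proof (rule LIMSEQ_I, simp only: eventually_sequentially[symmetric] real_norm_def)
    fix e0 :: real assume "e0 > 0"
    \<comment> \<open>Budget: each of the two laws costs (2 + 2B + 1) e, the convergence of the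
      trigonometric integral costs e. The final +2 in the denominator, instead of +1, makes the
      total strictly smaller than \<open>e0\<close>; the cap at 1 allows e^2 \<le> e.\<close>
    define e where "e = min 1 (e0 / (2 * (2 + 2 * B + 1) + 2))"
    have e: "e > 0" "e \<le> 1" "2 * ((2 + 2 * B + 1) * e) + e < e0"
    proof -
      show "e > 0" "e \<le> 1" using \<open>e0 > 0\<close> \<open>B > 0\<close> by (auto simp: e_def)
      have "2 * (2 + 2 * B + 1) + 2 > 0" using \<open>B > 0\<close> by simp
      moreover have "e \<le> e0 / (2 * (2 + 2 * B + 1) + 2)" by (simp add: e_def)
      ultimately have "e * (2 * (2 + 2 * B + 1) + 2) \<le> e0" by (simp add: pos_le_divide_eq)
      then show "2 * ((2 + 2 * B + 1) * e) + e < e0" using \<open>e > 0\<close> by (simp add: algebra_simps)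
    qed
    obtain K1 where K1: "\<forall>\<^sub>F n in sequentially. measure (N_seq n) {x \<in> space (RV q). \<exists>r<q. \<bar>x r\<bar> > K1} \<le> e"
      using tight[OF e(1)] by blast
    obtain K2 where K2: "measure N {x \<in> space (RV q). \<exists>r<q. \<bar>x r\<bar> > K2} \<le> e"
      using tight_N[OF e(1)] by blast
    define K where "K = max 1 (max K1 K2)"
    let ?S = "{x. (\<forall>r<q. \<bar>x r\<bar> \<le> K) \<and> (\<forall>r\<ge>q. x r = 0)}"
    have "K > 0" by (simp add: K_def)
    obtain g where g: "trig_fun q g" "\<And>x. x \<in> ?S \<Longrightarrow> \<bar>F x - g x\<bar> < e"
      using trig_fun_dense_on_box[OF continuous_on_subset[OF F_cont subset_UNIV] e(1) \<open>K > 0\<close>, of q] by auto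
    obtain C where C: "C > 0" "\<And>x. \<bar>g x\<bar> \<le> C" using trig_fun_bounded[OF g(1)] by blast
    \<comment> \<open>Off the box \<open>g\<close> is only bounded by \<open>C\<close>, which
      depends on \<open>e\<close> and could spoil the tail estimate. Clamping to [-B, B] restores a
      bound that does not blow up, and a polynomial close to the clamp on [-C, C] keeps the result
      trigonometric.\<close>
    let ?clamp = "\<lambda>y. max (-B) (min B y)"
    obtain p where p: "real_polynomial_function p" "\<And>y. y \<in> {-C..C} \<Longrightarrow> \<bar>?clamp y - p y\<bar> < e"
    proof (rule Stone_Weierstrass_real_polynomial_function[of "{-C..C}" ?clamp e])
      show "continuous_on {-C..C} ?clamp" by (intro continuous_intros)
    qed (use e(1) that in auto)
    define h where "h x = p (g x)" for x
    have h_trig: "trig_fun q h" unfolding h_def[abs_def] by (rule trig_fun_polynomial[OF p(1) g(1)])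
    have clamp_h: "\<bar>?clamp (g x) - h x\<bar> < e" for x
      using C(2)[of x] unfolding h_def by (intro p) (auto simp: abs_le_iff)
    have h_bound: "\<bar>h x\<bar> \<le> B + e" for x
      using clamp_h[of x] \<open>B > 0\<close> by (auto simp: abs_if max_def min_def split: if_splits)
    have close_int: "\<bar>(\<integral>x. f x \<partial>L) - (\<integral>x. h x \<partial>L)\<bar> \<le> (2 + 2 * B + 1) * e"
      if L: "prob_space L" "sets L = sets (RV q)"
        and m: "measure L {x \<in> space (RV q). \<exists>r<q. \<bar>x r\<bar> > K'} \<le> e" and "K' \<le> K"
      for L :: "(nat \<Rightarrow> real) measure" and K'
    proof -
      interpret L: prob_space L by fact
      note [measurable_cong] = L(2)
      have sp: "space L = space (RV q)" using sets_eq_imp_space_eq[OF L(2)] .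
      have [measurable]: "f \<in> borel_measurable (RV q)" "h \<in> borel_measurable (RV q)"
        by (fact f_meas) (rule trig_fun_measurable[OF h_trig])
      let ?O = "{x \<in> space (RV q). \<exists>r<q. \<bar>x r\<bar> > K'}"
      have O: "?O \<in> sets L" by measurable
      have f_int: "integrable L f"
        by (rule L.integrable_const_bound[of _ B]) (auto simp: f_bound sp)
      have h_int: "integrable L h"
        by (rule L.integrable_const_bound[of _ "B + e"]) (auto simp: h_bound)
      \<comment> \<open>The clamp is 1-Lipschitz and fixes the value of \<open>f\<close>, so on the
        box it does not increase the error \<open>e\<close> of \<open>g\<close>; the polynomial adds
        another \<open>e\<close>. Off the box only the bounds B and B + e remain.\<close>
      have pt: "\<bar>f x - h x\<bar> \<le> 2 * e + (2 * B + e) * indicator ?O x" if x: "x \<in> space L" for x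
      proof (cases "x \<in> ?O")
        case True
        then show ?thesis using f_bound[of x] h_bound[of x] e(1) by simp
      next
        case False
        have "\<bar>x r\<bar> \<le> K'" if "r < q" for r
        proof (rule ccontr)
          assume "\<not> \<bar>x r\<bar> \<le> K'"
          then show False using False x that by (auto simp: sp)
        qed
        then have "ext0 x \<in> ?S" using \<open>K' \<le> K\<close> by (force simp: ext0_def)
        then have "\<bar>F (ext0 x) - g (ext0 x)\<bar> < e" by (rule g(2))
        then have "\<bar>f x - g (ext0 x)\<bar> < e" using ext0[of x] x by (simp add: sp)
        moreover have "g (ext0 x) = g x" by (rule trig_fun_cong[OF g(1)]) (simp add: ext0_def)
        moreover note clamp_h[of x] f_bound[of x] x
        ultimately show ?thesis using False
          by (auto simp: sp abs_if max_def min_def split: if_splits)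
      qed
      have "\<bar>(\<integral>x. f x \<partial>L) - (\<integral>x. h x \<partial>L)\<bar> = \<bar>\<integral>x. f x - h x \<partial>L\<bar>"
        by (simp add: f_int h_int)
      also have "\<dots> \<le> (\<integral>x. \<bar>f x - h x\<bar> \<partial>L)" by (rule integral_abs_bound)
      also have "\<dots> \<le> (\<integral>x. 2 * e + (2 * B + e) * indicator ?O x \<partial>L)"
        using O by (intro integral_mono pt) (auto simp: f_int h_int L.emeasure_eq_measure)
      also have "\<dots> = 2 * e + (2 * B + e) * measure L ?O"
        using O by (simp add: L.emeasure_eq_measure L.prob_space)
      also have "\<dots> \<le> 2 * e + (2 * B + e) * e"
        using m e(1) \<open>B > 0\<close> by (intro add_left_mono mult_left_mono) auto
      also have "\<dots> \<le> (2 + 2 * B + 1) * e"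
        using e(1,2) \<open>B > 0\<close> by (simp add: algebra_simps mult_left_le)
      finally show ?thesis .
    qed
    have "\<forall>\<^sub>F n in sequentially. \<bar>(\<integral>x. h x \<partial>N_seq n) - (\<integral>x. h x \<partial>N)\<bar> < e"
      using trig_fun_integral_tendsto[OF h_trig N_seq N conv] e(1)
      by (auto simp: tendsto_iff dist_real_def)
    then show "\<forall>\<^sub>F n in sequentially. \<bar>(\<integral>x. f x \<partial>N_seq n) - (\<integral>x. f x \<partial>N)\<bar> < e0"
      using N_seq K1
    proof eventually_elim
      case (elim n)
      have "\<bar>(\<integral>x. f x \<partial>N_seq n) - (\<integral>x. h x \<partial>N_seq n)\<bar> \<le> (2 + 2 * B + 1) * e"
        using elim by (intro close_int[of _ K1]) (auto simp: K_def)
      moreover have "\<bar>(\<integral>x. f x \<partial>N) - (\<integral>x. h x \<partial>N)\<bar> \<le> (2 + 2 * B + 1) * e"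
        using N K2 by (intro close_int[of _ K2]) (auto simp: K_def)
      ultimately show ?case using elim(1) e(3) by linarith
    qed
  qed
qed

section \<open>Exact selection in the penalized step\<close>

text \<open>Vectors are plain functions read below \<open>d\<close>. The analysis then carries no
  carrier conditions, and \<open>vec\<close> and \<open>mat\<close> enter only through translation
  lemmas.\<close>

definition ip :: "nat \<Rightarrow> (nat \<Rightarrow> real) \<Rightarrow> (nat \<Rightarrow> real) \<Rightarrow> real" where
  "ip d u v = (\<Sum>j<d. u j * v j)"

abbreviation nrm :: "nat \<Rightarrow> (nat \<Rightarrow> real) \<Rightarrow> real" where
  "nrm d v \<equiv> L2_set v {..<d}"

lemma ip_self: "ip d v v = (nrm d v)\<^sup>2"
  by (simp add: ip_def L2_set_def sum_nonneg power2_eq_square)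

lemma ip_commute: "ip d u v = ip d v u"
  by (simp add: ip_def mult.commute)

lemma ip_scale_right: "ip d u (\<lambda>j. c * v j) = c * ip d u v"
  by (simp add: ip_def sum_distrib_left mult.left_commute)

lemma nrm_scale: "c \<ge> 0 \<Longrightarrow> nrm d (\<lambda>j. c * v j) = c * nrm d v"
  using L2_set_right_distrib[of c v "{..<d}"] by simp

lemma abs_sum_mult_le_L2_set: "\<bar>\<Sum>i\<in>A. f i * g i\<bar> \<le> L2_set f A * L2_set g A"
  by (rule order_trans[OF sum_abs]) (simp add: abs_mult L2_set_mult_ineq)

lemma abs_ip_le: "\<bar>ip d u v\<bar> \<le> nrm d u * nrm d v"
  unfolding ip_def by (rule abs_sum_mult_le_L2_set)

text \<open>Cauchy-Schwarz over index pairs. The Frobenius norm of \<open>E\<close> stands in for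
  its operator norm: it is larger, but its square is a sum of squared entries, whose expectations
  are computable.\<close>

lemma bilinear_le_L2_set:
  "\<bar>\<Sum>j<d. \<Sum>k<e. u j * E j k * v k\<bar> \<le>
    nrm d u * L2_set (\<lambda>(j, k). E j k) ({..<d} \<times> {..<e}) * nrm e v"
proof -
  have "(\<Sum>j<d. \<Sum>k<e. u j * E j k * v k) =
      (\<Sum>p\<in>{..<d}\<times>{..<e}. (case p of (j, k) \<Rightarrow> E j k) * (case p of (j, k) \<Rightarrow> u j * v k))"
    by (simp add: sum.cartesian_product mult_ac split_def)
  also have "\<bar>\<dots>\<bar> \<le> L2_set (\<lambda>(j, k). E j k) ({..<d} \<times> {..<e}) * L2_set (\<lambda>(j, k). u j * v k) ({..<d} \<times> {..<e})"
    by (rule abs_sum_mult_le_L2_set)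
  also have "L2_set (\<lambda>(j, k). u j * v k) ({..<d} \<times> {..<e}) = nrm d u * nrm e v"
    by (simp add: L2_set_def split_def power_mult_distrib real_sqrt_mult[symmetric]
        sum_product sum.cartesian_product)
  finally show ?thesis by (simp add: mult_ac)
qed

text \<open>The soft-thresholded residuals with \<open>b = 0\<close> are the comparison point. Convexity pulls a
  minimizer with large \<open>b\<close> back to the sphere of radius \<open>R\<close>, where the rows \<open>i \<ge> s\<close> are
  still in the quadratic regime of the Huber loss, so that coercivity gives a contradiction.\<close>

lemma penalized_minimizer_support:
  fixes x :: "nat \<Rightarrow> nat \<Rightarrow> real" and z m b :: "nat \<Rightarrow> real" and lam \<theta> K c w R :: real
    and n d s :: nat
  defines "L \<equiv> \<lambda>m b. \<Sum>i<n. (z i - m i - ip d (x i) b)\<^sup>2 + 2 * lam * \<bar>m i\<bar>"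
  assumes sn: "s \<le> n" and lam: "lam > 0" and \<theta>: "\<theta> > 0" and K: "K > 0"
    and R: "R = \<theta> * lam / (2 * K)"
    and min: "\<And>m' b'. L m b \<le> L m' b'"
    and small: "\<And>i. s \<le> i \<Longrightarrow> i < n \<Longrightarrow> \<bar>z i\<bar> \<le> (1 - \<theta>) * lam"
    and big: "\<And>i. i < s \<Longrightarrow> \<bar>z i\<bar> > (1 + \<theta>) * lam"
    and rows: "\<And>i. i < n \<Longrightarrow> nrm d (x i) \<le> K"
    and coercive: "\<And>v. c * (nrm d v)\<^sup>2 \<le> (\<Sum>i\<in>{s..<n}. (ip d (x i) v)\<^sup>2)"
    and linear: "\<And>v. (\<Sum>i\<in>{s..<n}. z i * ip d (x i) v) + lam * (\<Sum>i<s. sgn (z i) * ip d (x i) v) \<le> w * nrm d v"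
    and w: "2 * w < c * R"
  shows "nrm d b \<le> R" and "{i. i < n \<and> m i = 0} = {s..<n}"
proof -
  have "R > 0" using R \<theta> lam K by simp
  have split: "(\<Sum>i<n. f i) = (\<Sum>i<s. f i) + (\<Sum>i\<in>{s..<n}. f i)" for f :: "nat \<Rightarrow> real"
    using sum.atLeastLessThan_concat[of 0 s n f] sn by (simp add: lessThan_atLeast0)
  \<comment> \<open>\<open>R\<close> is defined by K * R = \<theta> * lam / 2: inside the ball a row
    shifts its residual by at most half of the margin in \<open>small\<close> and
    \<open>big\<close>, so no residual crosses the threshold \<open>lam\<close>.\<close>
  have row_small: "\<bar>ip d (x i) v\<bar> \<le> \<theta> * lam / 2" if "i < n" "nrm d v \<le> R" for i v
  proof -
    have "\<bar>ip d (x i) v\<bar> \<le> K * R"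
      using abs_ip_le[of d "x i" v] mult_mono[OF rows[OF that(1)] that(2)] K by simp
    then show ?thesis using R K by simp
  qed
  \<comment> \<open>For b = 0 the loss separates over i, and its minimizer is the soft threshold of
    \<open>z i\<close> at level \<open>lam\<close>, written out for the two cases that
    \<open>small\<close> and \<open>big\<close> allow.\<close>
  define m0 where "m0 i = (if s \<le> i then 0 else z i - lam * sgn (z i))" for i
  have L0: "L m0 (\<lambda>_. 0) = (\<Sum>i<s. 2 * lam * \<bar>z i\<bar> - lam\<^sup>2) + (\<Sum>i\<in>{s..<n}. (z i)\<^sup>2)"
  proof -
    have "(lam * sgn (z i))\<^sup>2 + 2 * lam * \<bar>z i - lam * sgn (z i)\<bar> = 2 * lam * \<bar>z i\<bar> - lam\<^sup>2"
      if "i < s" for i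
    proof -
      have "\<bar>z i\<bar> > lam" using big[OF that] mult_pos_pos[OF \<theta> lam] by (simp add: algebra_simps)
      then show ?thesis using lam by (auto simp: sgn_real_def abs_if power2_eq_square algebra_simps)
    qed
    then show ?thesis unfolding L_def split by (simp add: m0_def ip_def)
  qed
  have lower: "L m0 (\<lambda>_. 0) + c * (nrm d b')\<^sup>2 - 2 * w * nrm d b' \<le> L m' b'" if "nrm d b' \<le> R" for m' b'
  proof -
    \<comment> \<open>The linear branch of the Huber function is a lower bound at every residual r,
      by nonnegativity of the square of |r| - |m'| - lam; bounding |r| below by the tangent at
      \<open>z i\<close> makes it linear in b'.\<close>
    have 1: "2 * lam * \<bar>z i\<bar> - lam\<^sup>2 - 2 * lam * (sgn (z i) * ip d (x i) b')
        \<le> (z i - m' i - ip d (x i) b')\<^sup>2 + 2 * lam * \<bar>m' i\<bar>" for i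
    proof -
      let ?r = "z i - ip d (x i) b'"
      have "(\<bar>?r\<bar> - \<bar>m' i\<bar> - lam)\<^sup>2 \<ge> 0" by simp
      moreover have "(\<bar>?r\<bar> - \<bar>m' i\<bar>)\<^sup>2 \<le> (?r - m' i)\<^sup>2"
        using abs_triangle_ineq3[of ?r "m' i"] by (simp only: abs_le_square_iff)
      moreover have "\<bar>z i\<bar> - sgn (z i) * ip d (x i) b' \<le> \<bar>?r\<bar>"
        by (auto simp: sgn_real_def)
      then have "2 * lam * (\<bar>z i\<bar> - sgn (z i) * ip d (x i) b') \<le> 2 * lam * \<bar>?r\<bar>"
        using lam by simp
      ultimately show ?thesis by (simp add: power2_eq_square algebra_simps)
    qed
    \<comment> \<open>While |r| \<le> lam the penalty outweighs the cross term 2 r m', so the loss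
      is at least r^2: the quadratic branch, which supplies the curvature.\<close>
    have 2: "(z i)\<^sup>2 - 2 * (z i * ip d (x i) b') + (ip d (x i) b')\<^sup>2
        \<le> (z i - m' i - ip d (x i) b')\<^sup>2 + 2 * lam * \<bar>m' i\<bar>" if "i \<in> {s..<n}" for i
    proof -
      let ?r = "z i - ip d (x i) b'"
      have "\<bar>?r\<bar> \<le> lam"
        using row_small[of i b'] small[of i] that \<open>nrm d b' \<le> R\<close> mult_pos_pos[OF \<theta> lam]
        by (auto simp: algebra_simps abs_if split: if_splits)
      then have "?r * m' i \<le> lam * \<bar>m' i\<bar>"
        by (metis abs_ge_self abs_mult abs_ge_zero mult_right_mono order_trans)
      moreover have "(z i - m' i - ip d (x i) b')\<^sup>2 =
          (z i)\<^sup>2 - 2 * (z i * ip d (x i) b') + (ip d (x i) b')\<^sup>2 - 2 * (?r * m' i) + (m' i)\<^sup>2"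
        by (simp add: power2_eq_square algebra_simps)
      moreover have "(m' i)\<^sup>2 \<ge> 0" by simp
      ultimately show ?thesis by linarith
    qed
    have "(\<Sum>i<s. 2 * lam * \<bar>z i\<bar> - lam\<^sup>2 - 2 * lam * (sgn (z i) * ip d (x i) b')) +
        (\<Sum>i\<in>{s..<n}. (z i)\<^sup>2 - 2 * (z i * ip d (x i) b') + (ip d (x i) b')\<^sup>2) \<le> L m' b'"
      unfolding L_def split by (intro add_mono sum_mono 1 2)
    moreover define T where "T = (\<Sum>i\<in>{s..<n}. z i * ip d (x i) b') + lam * (\<Sum>i<s. sgn (z i) * ip d (x i) b')"
    moreover define S where "S = (\<Sum>i\<in>{s..<n}. (ip d (x i) b')\<^sup>2)"
    moreover have "(\<Sum>i<s. 2 * lam * \<bar>z i\<bar> - lam\<^sup>2 - 2 * lam * (sgn (z i) * ip d (x i) b')) +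
        (\<Sum>i\<in>{s..<n}. (z i)\<^sup>2 - 2 * (z i * ip d (x i) b') + (ip d (x i) b')\<^sup>2) =
        L m0 (\<lambda>_. 0) - 2 * T + S"
      unfolding L0 T_def S_def by (simp add: sum.distrib sum_subtractf sum_distrib_left algebra_simps)
    ultimately have "L m0 (\<lambda>_. 0) - 2 * T + S \<le> L m' b'" by simp
    moreover have "c * (nrm d b')\<^sup>2 \<le> S" "2 * T \<le> 2 * w * nrm d b'"
      using linear[of b'] coercive[of b'] by (simp_all add: T_def S_def)
    ultimately show ?thesis by linarith
  qed
  show bR: "nrm d b \<le> R"
  proof (rule ccontr)
    assume "\<not> nrm d b \<le> R"
    define \<tau> where "\<tau> = R / nrm d b"
    have \<tau>: "0 < \<tau>" "\<tau> < 1" using \<open>R > 0\<close> \<open>\<not> nrm d b \<le> R\<close> by (auto simp: \<tau>_def)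
    have n\<tau>: "nrm d (\<lambda>j. \<tau> * b j) = R"
      using \<tau> \<open>\<not> nrm d b \<le> R\<close> \<open>R > 0\<close> by (simp add: nrm_scale) (simp add: \<tau>_def)
    let ?m = "\<lambda>i. (1 - \<tau>) * m0 i + \<tau> * m i"
    have "L ?m (\<lambda>j. \<tau> * b j) \<le> (\<Sum>i<n. (1 - \<tau>) * ((z i - m0 i - ip d (x i) (\<lambda>_. 0))\<^sup>2 + 2 * lam * \<bar>m0 i\<bar>)
        + \<tau> * ((z i - m i - ip d (x i) b)\<^sup>2 + 2 * lam * \<bar>m i\<bar>))"
      unfolding L_def
    proof (rule sum_mono)
      fix i
      let ?a = "z i - m0 i" and ?e = "z i - m i - ip d (x i) b"
      have eq: "z i - ?m i - ip d (x i) (\<lambda>j. \<tau> * b j) = (1 - \<tau>) * ?a + \<tau> * ?e"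
        by (simp add: ip_scale_right algebra_simps)
      have "(1 - \<tau>) * ?a\<^sup>2 + \<tau> * ?e\<^sup>2 - ((1 - \<tau>) * ?a + \<tau> * ?e)\<^sup>2 = \<tau> * (1 - \<tau>) * (?a - ?e)\<^sup>2"
        by (simp add: power2_eq_square algebra_simps)
      moreover have "\<dots> \<ge> 0" using \<tau> by simp
      moreover have "\<bar>?m i\<bar> \<le> (1 - \<tau>) * \<bar>m0 i\<bar> + \<tau> * \<bar>m i\<bar>"
        using abs_triangle_ineq[of "(1 - \<tau>) * m0 i" "\<tau> * m i"] \<tau> by (simp add: abs_mult)
      then have "2 * lam * \<bar>?m i\<bar> \<le> 2 * lam * ((1 - \<tau>) * \<bar>m0 i\<bar> + \<tau> * \<bar>m i\<bar>)"
        using lam by (intro mult_left_mono) auto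
      ultimately show "(z i - ?m i - ip d (x i) (\<lambda>j. \<tau> * b j))\<^sup>2 + 2 * lam * \<bar>?m i\<bar>
        \<le> (1 - \<tau>) * ((z i - m0 i - ip d (x i) (\<lambda>_. 0))\<^sup>2 + 2 * lam * \<bar>m0 i\<bar>)
        + \<tau> * ((z i - m i - ip d (x i) b)\<^sup>2 + 2 * lam * \<bar>m i\<bar>)"
        unfolding eq by (simp add: ip_def algebra_simps)
    qed
    also have "\<dots> = (1 - \<tau>) * L m0 (\<lambda>_. 0) + \<tau> * L m b"
      unfolding L_def by (subst sum.distrib) (simp only: sum_distrib_left)
    also have "\<dots> \<le> L m0 (\<lambda>_. 0)"
      using mult_left_mono[OF min[of m0 "\<lambda>_. 0"], of \<tau>] \<tau> by (simp add: algebra_simps)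
    finally have "c * R\<^sup>2 - 2 * w * R \<le> 0" using lower[of "\<lambda>j. \<tau> * b j" ?m] n\<tau> by simp
    then have "R * (c * R - 2 * w) \<le> 0" by (simp add: power2_eq_square algebra_simps)
    then show False using w \<open>R > 0\<close> by (simp add: mult_le_0_iff)
  qed
  show "{i. i < n \<and> m i = 0} = {s..<n}"
  proof (rule Set.set_eqI)
    fix i
    \<comment> \<open>Changing one coordinate of \<open>m\<close> leaves the other summands alone,
      so \<open>m i\<close> solves a scalar problem whose solution vanishes exactly when the
      residual is at most \<open>lam\<close> in absolute value.\<close>
    have coord: "(z i - m i - ip d (x i) b)\<^sup>2 + 2 * lam * \<bar>m i\<bar> \<le> (z i - y - ip d (x i) b)\<^sup>2 + 2 * lam * \<bar>y\<bar>"
      if "i < n" for y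
    proof -
      have "L m b \<le> L (m(i := y)) b" by (rule min)
      then show ?thesis unfolding L_def using that
        by (simp add: sum.remove[of "{..<n}" i])
    qed
    let ?r = "z i - ip d (x i) b"
    show "i \<in> {i. i < n \<and> m i = 0} \<longleftrightarrow> i \<in> {s..<n}"
    proof (cases "i < n \<and> s \<le> i")
      case True
      have lt: "\<bar>?r\<bar> < lam"
        using row_small[of i b] small[of i] True bR mult_pos_pos[OF \<theta> lam]
        by (auto simp: algebra_simps abs_if split: if_splits)
      have "(m i)\<^sup>2 + 2 * lam * \<bar>m i\<bar> \<le> 2 * (?r * m i)"
        using coord[of 0] True by (simp add: power2_eq_square algebra_simps)
      also have "?r * m i \<le> \<bar>?r\<bar> * \<bar>m i\<bar>" by (metis abs_ge_self abs_mult)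
      finally have "2 * ((lam - \<bar>?r\<bar>) * \<bar>m i\<bar>) \<le> - (m i)\<^sup>2" by (simp add: algebra_simps)
      then have "(lam - \<bar>?r\<bar>) * \<bar>m i\<bar> \<le> 0" by (smt (verit) zero_le_power2)
      then have "m i = 0" using lt by (auto simp: mult_le_0_iff)
      then show ?thesis using True by simp
    next
      case False
      have "m i \<noteq> 0" if "i < n"
      proof
        assume "m i = 0"
        have "i < s" using False that by simp
        have gt: "\<bar>?r\<bar> > lam"
          using row_small[of i b] big[OF \<open>i < s\<close>] that bR mult_pos_pos[OF \<theta> lam]
          by (auto simp: algebra_simps abs_if split: if_splits)
        \<comment> \<open>The test value is the soft threshold of the residual. Its loss is 2 lam
          |r| - lam^2, against r^2 for the value 0, and the difference is (|r| - lam)^2 > 0.\<close>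
        have "?r\<^sup>2 \<le> (lam * sgn ?r)\<^sup>2 + 2 * lam * \<bar>?r - lam * sgn ?r\<bar>"
          using coord[OF that, of "?r - lam * sgn ?r"] \<open>m i = 0\<close> by (simp add: algebra_simps)
        moreover have "(lam * sgn ?r)\<^sup>2 + 2 * lam * \<bar>?r - lam * sgn ?r\<bar> = 2 * lam * \<bar>?r\<bar> - lam\<^sup>2"
          using gt lam by (auto simp: sgn_real_def abs_if power2_eq_square algebra_simps)
        ultimately have "(\<bar>?r\<bar> - lam)\<^sup>2 \<le> 0" by (simp add: power2_eq_square algebra_simps)
        then show False using gt by simp
      qed
      then show ?thesis using False by auto
    qed
  qed
qed

section \<open>Quadratic forms\<close>

definition bil :: "nat \<Rightarrow> (nat \<Rightarrow> nat \<Rightarrow> real) \<Rightarrow> (nat \<Rightarrow> real) \<Rightarrow> (nat \<Rightarrow> real) \<Rightarrow> real" where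
  "bil d S u w = (\<Sum>j<d. \<Sum>k<d. u j * S j k * w k)"

lemma bil_ip: "bil d S u w = ip d u (\<lambda>j. ip d (S j) w)"
  by (simp add: bil_def ip_def sum_distrib_left mult_ac)

lemma bil_sym:
  assumes "\<And>j k. j < d \<Longrightarrow> k < d \<Longrightarrow> S j k = S k j"
  shows "bil d S u w = bil d S w u"
proof -
  have "bil d S u w = (\<Sum>k<d. \<Sum>j<d. u j * S j k * w k)"
    unfolding bil_def by (rule sum.swap)
  also have "\<dots> = bil d S w u"
    unfolding bil_def by (intro sum.cong refl) (simp add: assms mult_ac)
  finally show ?thesis .
qed

lemma bil_add_scaled:
  assumes "\<And>j k. j < d \<Longrightarrow> k < d \<Longrightarrow> S j k = S k j"
  shows "bil d S (\<lambda>j. v j + t * w j) (\<lambda>j. v j + t * w j) =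
    bil d S v v + 2 * t * bil d S w v + t\<^sup>2 * bil d S w w"
proof -
  have "bil d S (\<lambda>j. v j + t * w j) (\<lambda>j. v j + t * w j) =
      bil d S v v + t * bil d S v w + t * bil d S w v + t\<^sup>2 * bil d S w w"
    unfolding bil_def by (simp add: sum.distrib sum_distrib_left algebra_simps power2_eq_square)
  then show ?thesis using bil_sym[where S = S and u = v and w = w and d = d, OF assms] by simp
qed

text \<open>Perturbing the isotropic vector \<open>v\<close> along g = S v gives the polynomial 2 t
  G + t^2 a in t, which is never negative but has slope 2 G at 0; hence G = |S v|^2 = 0.\<close>

lemma psd_kernel:
  assumes sym: "\<And>j k. j < d \<Longrightarrow> k < d \<Longrightarrow> S j k = S k j"
    and psd: "\<And>w. 0 \<le> bil d S w w" and "bil d S v v = 0" and "j < d"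
  shows "ip d (S j) v = 0"
proof -
  define g where "g = (\<lambda>j. ip d (S j) v)"
  define a where "a = bil d S g g"
  define G where "G = (nrm d g)\<^sup>2"
  have "a \<ge> 0" "G \<ge> 0" unfolding a_def G_def by (simp_all add: psd)
  have "bil d S g v = G" by (simp add: bil_ip g_def G_def ip_self)
  then have "0 \<le> 2 * t * G + t\<^sup>2 * a" for t
    using psd[of "\<lambda>j. v j + t * g j"] bil_add_scaled[where S = S and v = v and t = t and w = g and d = d, OF sym] assms(3) by (simp add: a_def)
  \<comment> \<open>The minimizing t would be -G / a. Adding 1 to the denominator covers a = 0 and
    still gives a negative value unless G = 0.\<close>
  from this[of "- G / (a + 1)"] have "0 \<le> - 2 * G\<^sup>2 / (a + 1) + G\<^sup>2 * a / (a + 1)\<^sup>2"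
    by (simp add: power2_eq_square)
  also have "\<dots> = - G\<^sup>2 * (a + 2) / (a + 1)\<^sup>2"
    using \<open>a \<ge> 0\<close> by (simp add: divide_simps) (simp add: power2_eq_square algebra_simps)
  finally have "G\<^sup>2 * (a + 2) \<le> 0"
    using \<open>a \<ge> 0\<close> pos_le_divide_eq[of "(a + 1)\<^sup>2" 0 "- G\<^sup>2 * (a + 2)"] by simp
  then have "G = 0" using \<open>a \<ge> 0\<close> by (simp add: mult_le_0_iff)
  then have "\<forall>j<d. g j = 0" by (simp add: G_def L2_set_eq_0_iff)
  then show ?thesis using \<open>j < d\<close> by (simp add: g_def)
qed

lemma bil_ident: "bil d (\<lambda>j k. if j = k then c else 0) v w = c * ip d v w"
proof -
  have "(\<Sum>k<d. v j * (if j = k then c else 0) * w k) = c * (v j * w j)" if "j < d" for j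
  proof -
    have "(\<Sum>k<d. v j * (if j = k then c else 0) * w k) = (\<Sum>k<d. if j = k then c * (v j * w k) else 0)"
      by (intro sum.cong) auto
    then show ?thesis using that by simp
  qed
  then show ?thesis unfolding bil_def ip_def sum_distrib_left by (intro sum.cong) auto
qed

lemma bil_diff: "bil d (\<lambda>j k. S j k - T j k) v w = bil d S v w - bil d T v w"
  by (simp add: bil_def sum_subtractf algebra_simps)

lemma bil_cong: "(\<And>j. j < d \<Longrightarrow> v j = v' j) \<Longrightarrow> (\<And>j. j < d \<Longrightarrow> w j = w' j) \<Longrightarrow> bil d S v w = bil d S v' w'"
  by (simp add: bil_def)

lemma bil_scale: "bil d S (\<lambda>j. c * v j) (\<lambda>j. c * v j) = c\<^sup>2 * bil d S v v"
  by (simp add: bil_def sum_distrib_left power2_eq_square mult_ac)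

lemma compact_unit_sphere: "compact {x :: nat \<Rightarrow> real. nrm d x = 1 \<and> (\<forall>j\<ge>d. x j = 0)}"
proof -
  have coord: "continuous_on A (\<lambda>x :: nat \<Rightarrow> real. x r)" for r A
    by (rule continuous_on_product_then_coordinatewise) (rule continuous_on_id)
  have "continuous_on UNIV (\<lambda>x :: nat \<Rightarrow> real. nrm d x)"
    unfolding L2_set_def by (intro continuous_intros coord)
  then have "closed {x :: nat \<Rightarrow> real. nrm d x = 1}"
    by (intro closed_Collect_eq continuous_on_const)
  then have "compact ({x :: nat \<Rightarrow> real. (\<forall>r<d. \<bar>x r\<bar> \<le> 1) \<and> (\<forall>r\<ge>d. x r = 0)} \<inter> {x. nrm d x = 1})"
    by (intro compact_Int_closed compact_box)
  moreover have "{x :: nat \<Rightarrow> real. (\<forall>r<d. \<bar>x r\<bar> \<le> 1) \<and> (\<forall>r\<ge>d. x r = 0)} \<inter> {x. nrm d x = 1} =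
      {x. nrm d x = 1 \<and> (\<forall>j\<ge>d. x j = 0)}"
  proof -
    have "\<bar>x r\<bar> \<le> 1" if "nrm d x = 1" "r < d" for x r
      using member_le_L2_set[of "{..<d}" r "\<lambda>i. \<bar>x i\<bar>"] that by (simp add: L2_set_def)
    then show ?thesis by auto
  qed
  ultimately show ?thesis by simp
qed

text \<open>A minimizer on the sphere exists by compactness. Subtracting the minimum from the
  diagonal leaves a semidefinite form with \<open>v\<close> isotropic, and \<open>psd_kernel\<close>
  then makes \<open>v\<close> an eigenvector, without any derivative.\<close>

lemma rayleigh_min:
  assumes sym: "\<And>j k. j < d \<Longrightarrow> k < d \<Longrightarrow> S j k = S k j" and "d \<ge> 1"
  shows "\<exists>m v. nrm d v = 1 \<and> (\<forall>j<d. ip d (S j) v = m * v j) \<and>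
    (\<forall>w. m * (nrm d w)\<^sup>2 \<le> bil d S w w)"
proof -
  let ?C = "{x :: nat \<Rightarrow> real. nrm d x = 1 \<and> (\<forall>j\<ge>d. x j = 0)}"
  have coord: "continuous_on A (\<lambda>x :: nat \<Rightarrow> real. x r)" for r A
    by (rule continuous_on_product_then_coordinatewise) (rule continuous_on_id)
  have "(\<lambda>j. if j = 0 then 1 else 0) \<in> ?C"
    using \<open>d \<ge> 1\<close> by (auto simp: L2_set_def if_distrib[of "\<lambda>x. x\<^sup>2"] cong: if_cong)
  then have ne: "?C \<noteq> {}" by blast
  have "continuous_on ?C (\<lambda>x. bil d S x x)"
    unfolding bil_def by (intro continuous_intros coord)
  from continuous_attains_inf[OF compact_unit_sphere ne this]
  obtain v where v: "v \<in> ?C" "\<And>w. w \<in> ?C \<Longrightarrow> bil d S v v \<le> bil d S w w" by blast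
  define m where "m = bil d S v v"
  have min: "m * (nrm d w)\<^sup>2 \<le> bil d S w w" for w
  proof (cases "nrm d w = 0")
    case True
    then have "\<forall>j<d. w j = 0" by (simp add: L2_set_eq_0_iff)
    then show ?thesis using True by (simp add: bil_def)
  next
    case False
    define w' where "w' = (\<lambda>j. if j < d then (1 / nrm d w) * w j else 0)"
    have "nrm d w' = nrm d (\<lambda>j. (1 / nrm d w) * w j)" by (rule L2_set_cong) (auto simp: w'_def)
    also have "\<dots> = 1" using False by (subst nrm_scale) auto
    finally have "w' \<in> ?C" by (simp add: w'_def)
    have "bil d S w' w' = bil d S (\<lambda>j. (1 / nrm d w) * w j) (\<lambda>j. (1 / nrm d w) * w j)"
      by (rule bil_cong) (auto simp: w'_def)
    also have "\<dots> = bil d S w w / (nrm d w)\<^sup>2" by (subst bil_scale) (simp add: power_divide)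
    finally have "m \<le> bil d S w w / (nrm d w)\<^sup>2" using v(2)[OF \<open>w' \<in> ?C\<close>] by (simp add: m_def)
    then show ?thesis using False by (simp add: pos_le_divide_eq)
  qed
  let ?T = "\<lambda>j k. S j k - (if j = k then m else 0)"
  have T: "bil d ?T w w = bil d S w w - m * (nrm d w)\<^sup>2" for w
    by (simp add: bil_diff bil_ident ip_self)
  have ker: "ip d (?T j) v = 0" if "j < d" for j
  proof (rule psd_kernel)
    show "?T j k = ?T k j" if "j < d" "k < d" for j k using sym[OF that] by auto
    show "0 \<le> bil d ?T w w" for w using min[of w] by (simp add: T)
    show "bil d ?T v v = 0" using v(1) by (simp add: T m_def)
  qed fact
  have "ip d (S j) v = m * v j" if "j < d" for j
  proof -
    have "ip d (?T j) v = ip d (S j) v - (\<Sum>k<d. if j = k then m * v k else 0)"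
      by (simp add: ip_def left_diff_distrib sum_subtractf if_distrib[of "\<lambda>c. c * _"] cong: if_cong)
    then show ?thesis using ker[OF that] that by simp
  qed
  with v(1) min show ?thesis by blast
qed

text \<open>Provides the root that \<open>normal_law\<close> asks for, also when the limiting
  covariance is singular. The last index is eliminated by a Schur complement; a zero pivot forces
  its whole column to vanish, by \<open>psd_kernel\<close>.\<close>

lemma psd_cholesky:
  assumes "\<And>i j. i < q \<Longrightarrow> j < q \<Longrightarrow> S i j = S j i" "\<And>v. 0 \<le> bil q S v v"
  shows "\<exists>L. \<forall>i<q. \<forall>j<q. S i j = (\<Sum>l<q. L i l * L j l)"
  using assms
proof (induction q arbitrary: S)
  case (Suc q)
  define a where "a = S q q"
  \<comment> \<open>For a = 0 division by zero makes the correction 0, so \<open>T\<close> is then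
    the leading block itself and one definition serves both cases.\<close>
  define T where "T i j = S i j - S i q * S j q / a" for i j
  note sym = Suc.prems(1) and psd = Suc.prems(2)
  have expand: "bil (Suc q) S (v(q := y)) (v(q := y)) =
      bil q S v v + 2 * y * (\<Sum>i<q. v i * S i q) + y\<^sup>2 * a" for v y
  proof -
    have "(\<Sum>k<q. y * S q k * v k) = y * (\<Sum>i<q. v i * S i q)"
      unfolding sum_distrib_left using sym[of q] by (intro sum.cong) auto
    then show ?thesis
      by (simp add: bil_def sum.distrib sum_distrib_left a_def power2_eq_square algebra_simps)
  qed
  have "a \<ge> 0" using psd[of "(\<lambda>_. 0)(q := 1)"] unfolding expand by (simp add: bil_def)
  have "\<exists>L. \<forall>i<q. \<forall>j<q. T i j = (\<Sum>l<q. L i l * L j l)"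
  proof (rule Suc.IH)
    show "T i j = T j i" if "i < q" "j < q" for i j
      using sym[of i j] that by (simp add: T_def mult.commute)
    show "0 \<le> bil q T v v" for v
    proof -
      let ?b = "\<Sum>i<q. v i * S i q"
      have "bil q T v v = bil q S v v - (\<Sum>i<q. \<Sum>j<q. v i * (S i q * S j q / a) * v j)"
        by (simp add: bil_def T_def sum_subtractf algebra_simps)
      also have "(\<Sum>i<q. \<Sum>j<q. v i * (S i q * S j q / a) * v j) = ?b\<^sup>2 / a"
        by (simp add: power2_eq_square sum_product sum_divide_distrib mult_ac)
      finally have "bil q T v v = bil q S v v - ?b\<^sup>2 / a" .
      \<comment> \<open>For a > 0 the value -b / a minimizes the form over the last coordinate, and
        the minimum is the Schur complement at \<open>v\<close>.\<close>
      moreover have "0 \<le> bil q S v v - ?b\<^sup>2 / a"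
        using psd[of "v(q := - ?b / a)"] unfolding expand
        by (cases "a = 0") (simp_all add: power2_eq_square field_simps)
      ultimately show ?thesis by simp
    qed
  qed
  then obtain L where L: "\<And>i j. i < q \<Longrightarrow> j < q \<Longrightarrow> T i j = (\<Sum>l<q. L i l * L j l)" by blast
  have zero: "S i q = 0" if "a = 0" "i < q" for i
  proof -
    have "ip (Suc q) (S q) ((\<lambda>_. 0)(i := 1)) = 0 "
    proof -
      have "ip (Suc q) (S i) ((\<lambda>_. 0)(q := 1)) = 0"
        using sym psd by (rule psd_kernel) (use expand[of "\<lambda>_. 0" 1] that in \<open>simp_all add: bil_def\<close>)
      then have "S i q = 0" using that by (simp add: ip_def)
      then show ?thesis using sym[of i q] that by (simp add: ip_def if_distrib cong: if_cong)
    qed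
    then show ?thesis using that sym[of i q] by (simp add: ip_def if_distrib cong: if_cong)
  qed
  \<comment> \<open>Block form: the factor of the Schur complement, bordered by the scaled pivot
    column on the right and the row (0, ..., 0, sqrt a) below.\<close>
  define L' where "L' i l = (if i < q then (if l < q then L i l else S i q / sqrt a) else (if l < q then 0 else sqrt a))" for i l
  have "S i j = (\<Sum>l<Suc q. L' i l * L' j l)" if "i < Suc q" "j < Suc q" for i j
  proof (cases "i < q"; cases "j < q")
    assume "i < q" "j < q"
    then have "(\<Sum>l<Suc q. L' i l * L' j l) = T i j + S i q * S j q / (sqrt a * sqrt a)"
      by (simp add: L L'_def)
    then show ?thesis using \<open>a \<ge> 0\<close> by (simp add: T_def)
  next
    assume "i < q" "\<not> j < q"
    then show ?thesis using that zero[of i] \<open>a \<ge> 0\<close> by (auto simp: L'_def less_Suc_eq)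
  next
    assume "\<not> i < q" "j < q"
    then show ?thesis using that zero[of j] \<open>a \<ge> 0\<close> sym[of i j] by (auto simp: L'_def less_Suc_eq)
  next
    assume "\<not> i < q" "\<not> j < q"
    then show ?thesis using that \<open>a \<ge> 0\<close> by (auto simp: L'_def less_Suc_eq a_def)
  qed
  then show ?case by blast
qed simp

section \<open>Matrices\<close>

lemma vec_norm2_nrm: "vec_norm2 v = nrm (dim_vec v) (\<lambda>j. v $ j)"
  by (simp add: vec_norm2_def)

lemma scalar_prod_ip: "w \<in> carrier_vec d \<Longrightarrow> v \<bullet> w = ip d (\<lambda>j. v $ j) (\<lambda>j. w $ j)"
  by (simp add: scalar_prod_def ip_def lessThan_atLeast0)

lemma mult_mat_vec_ip:
  assumes "S \<in> carrier_mat n d" "v \<in> carrier_vec d" "i < n"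
  shows "(S *\<^sub>v v) $ i = ip d (\<lambda>j. S $$ (i, j)) (\<lambda>j. v $ j)"
  using assms by (simp add: scalar_prod_ip[of v d]) (simp add: ip_def)

text \<open>The Rayleigh minimum is attained at an eigenvector, so it belongs to the finite
  spectrum, whose minimum cannot exceed it.\<close>

lemma lambda_min_le_bil:
  assumes S: "S \<in> carrier_mat d d" "transpose_mat S = S" and d: "d \<ge> 1"
  shows "lambda_min S * (nrm d w)\<^sup>2 \<le> bil d (\<lambda>j k. S $$ (j, k)) w w"
proof -
  have sym: "S $$ (j, k) = S $$ (k, j)" if "j < d" "k < d" for j k
    using arg_cong[OF S(2), of "\<lambda>A. A $$ (j, k)"] S(1) that by simp
  obtain m v where v: "nrm d v = 1" "\<And>j. j < d \<Longrightarrow> ip d (\<lambda>k. S $$ (j, k)) v = m * v j"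
    and m: "\<And>w. m * (nrm d w)\<^sup>2 \<le> bil d (\<lambda>j k. S $$ (j, k)) w w"
    using rayleigh_min[of d "\<lambda>j k. S $$ (j, k)"] sym d by meson
  have "eigenvector S (vec d v) m"
    unfolding eigenvector_def
  proof (intro conjI)
    show "vec d v \<in> carrier_vec (dim_row S)" using S by simp
    show "vec d v \<noteq> 0\<^sub>v (dim_row S)"
    proof
      assume eq: "vec d v = 0\<^sub>v (dim_row S)"
      have "v j = 0" if "j < d" for j
        using arg_cong[OF eq, of "\<lambda>x. x $ j"] that S by simp
      then show False using v(1) by (simp add: L2_set_def)
    qed
    show "S *\<^sub>v vec d v = m \<cdot>\<^sub>v vec d v"
    proof (rule eq_vecI)
      fix i assume "i < dim_vec (m \<cdot>\<^sub>v vec d v)"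
      then have "i < d" by simp
      then have "(S *\<^sub>v vec d v) $ i = ip d (\<lambda>k. S $$ (i, k)) (\<lambda>j. vec d v $ j)"
        using S by (intro mult_mat_vec_ip) auto
      also have "\<dots> = ip d (\<lambda>k. S $$ (i, k)) v" by (simp add: ip_def)
      finally show "(S *\<^sub>v vec d v) $ i = (m \<cdot>\<^sub>v vec d v) $ i" using v(2) \<open>i < d\<close> by simp
    qed (use S in simp)
  qed
  then have "m \<in> spectrum S" by (auto simp: spectrum_def eigenvalue_def)
  then have "lambda_min S \<le> m"
    unfolding lambda_min_def using card_finite_spectrum(1)[OF S(1)] by simp
  then show ?thesis using m[of w] mult_right_mono[of "lambda_min S" m "(nrm d w)\<^sup>2"] by simp
qed

text \<open>\<open>mat_inverse\<close> returns an option; a trivial kernel means a nonzero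
  determinant, which rules out \<open>None\<close>.\<close>

lemma inv_mat_of_trivial_kernel:
  assumes S: "S \<in> carrier_mat d d"
    and ker: "\<And>v. v \<in> carrier_vec d \<Longrightarrow> S *\<^sub>v v = 0\<^sub>v d \<Longrightarrow> v = 0\<^sub>v d"
  shows "inv_mat S \<in> carrier_mat d d" "S * inv_mat S = 1\<^sub>m d" "inv_mat S * S = 1\<^sub>m d" "invertible_mat S"
proof -
  have "det S \<noteq> 0" using det_0_iff_vec_prod_zero_field[OF S] ker by blast
  then have "S \<in> Units (ring_mat TYPE(real) d d)" by (rule det_non_zero_imp_unit[OF S])
  then obtain B where "mat_inverse S = Some B"
    using mat_inverse(1)[OF S] by (metis not_None_eq)
  from mat_inverse(2)[OF S this] \<open>mat_inverse S = Some B\<close>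
  show *: "inv_mat S \<in> carrier_mat d d" "S * inv_mat S = 1\<^sub>m d" "inv_mat S * S = 1\<^sub>m d"
    by (auto simp: inv_mat_def)
  then show "invertible_mat S"
    using S by (auto simp: invertible_mat_def inverts_mat_def intro!: exI[of _ "inv_mat S"])
qed

lemma inv_mat_pos_def:
  assumes "pos_def_mat d S"
  shows "inv_mat S \<in> carrier_mat d d" "S * inv_mat S = 1\<^sub>m d" "inv_mat S * S = 1\<^sub>m d"
proof -
  have S: "S \<in> carrier_mat d d" using assms by (simp add: pos_def_mat_def)
  have ker: "v = 0\<^sub>v d" if "v \<in> carrier_vec d" "S *\<^sub>v v = 0\<^sub>v d" for v
    using assms that unfolding pos_def_mat_def by (metis less_irrefl scalar_prod_right_zero)
  show "inv_mat S \<in> carrier_mat d d" "S * inv_mat S = 1\<^sub>m d" "inv_mat S * S = 1\<^sub>m d"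
    using inv_mat_of_trivial_kernel[OF S ker] by auto
qed

lemma pick_atLeastLessThan: "k < n - s \<Longrightarrow> pick {s..<n} k = s + k"
proof (induction k)
  case 0
  then show ?case by (auto intro!: Least_equality)
next
  case (Suc k)
  then have "pick {s..<n} k = s + k" by simp
  then show ?case using Suc.prems by (auto intro!: Least_equality)
qed

text \<open>\<open>ols_on\<close> asserts something only where the Gram matrix is invertible.
  Coercivity makes its kernel trivial, so the closed formula applies, and multiplying by the Gram
  matrix gives the normal equations; from here on no inverse Gram matrix occurs.\<close>

lemma normal_equations_of_ols_on:
  assumes X: "X \<in> carrier_mat n d" and Y: "Y \<in> carrier_vec n" and b: "b \<in> carrier_vec d" and "s \<le> n"
    and ols: "ols_on {s..<n} X Y b" and "c > 0"
    and coercive: "\<And>v. c * (nrm d v)\<^sup>2 \<le> (\<Sum>i\<in>{s..<n}. (ip d (\<lambda>j. X $$ (i, j)) v)\<^sup>2)"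
    and "j < d"
  shows "(\<Sum>i\<in>{s..<n}. X $$ (i, j) * (Y $ i - ip d (\<lambda>j. X $$ (i, j)) (\<lambda>j. b $ j))) = 0"
proof -
  define XI where "XI = submatrix X {s..<n} UNIV"
  define YI where "YI = sub_vec Y {s..<n}"
  have card: "card {i. i < n \<and> i \<in> {s..<n}} = n - s"
  proof -
    have "{i. i < n \<and> i \<in> {s..<n}} = {s..<n}" by auto
    then show ?thesis by simp
  qed
  have XI: "XI \<in> carrier_mat (n - s) d" and XI_el: "\<And>i k. i < n - s \<Longrightarrow> k < d \<Longrightarrow> XI $$ (i, k) = X $$ (s + i, k)"
    using X card by (auto simp: XI_def submatrix_def pick_atLeastLessThan pick_UNIV)
  have YI: "YI \<in> carrier_vec (n - s)" and YI_el: "\<And>i. i < n - s \<Longrightarrow> YI $ i = Y $ (s + i)"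
    using Y card by (auto simp: YI_def sub_vec_def pick_atLeastLessThan)
  define Gram where "Gram = transpose_mat XI * XI"
  have G: "Gram \<in> carrier_mat d d" using XI by (simp add: Gram_def)
  have G_mult: "Gram *\<^sub>v v = transpose_mat XI *\<^sub>v (XI *\<^sub>v v)" if "v \<in> carrier_vec d" for v
    unfolding Gram_def using XI that by (intro assoc_mult_mat_vec) auto
  have shift: "(\<Sum>i\<in>{s..<n}. f i) = (\<Sum>i<n - s. f (s + i))" for f :: "nat \<Rightarrow> real"
    by (simp add: sum.atLeastLessThan_shift_0[of f s n] lessThan_atLeast0)
  have XIv: "(XI *\<^sub>v v) $ i = ip d (\<lambda>j. X $$ (s + i, j)) (\<lambda>j. v $ j)" if "v \<in> carrier_vec d" "i < n - s" for v i
    using mult_mat_vec_ip[OF XI that] XI_el[OF that(2)] by (simp add: ip_def)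
  have ker: "v = 0\<^sub>v d" if v: "v \<in> carrier_vec d" and "Gram *\<^sub>v v = 0\<^sub>v d" for v
  proof -
    have "(XI *\<^sub>v v) \<bullet> (XI *\<^sub>v v) = v \<bullet> (transpose_mat XI *\<^sub>v (XI *\<^sub>v v))"
      using transpose_vec_mult_scalar[OF XI v, of "XI *\<^sub>v v"] XI v
        comm_scalar_prod[of v d "transpose_mat XI *\<^sub>v (XI *\<^sub>v v)"] by simp
    then have "(XI *\<^sub>v v) \<bullet> (XI *\<^sub>v v) = 0" using that by (simp add: G_mult)
    moreover have "(XI *\<^sub>v v) \<bullet> (XI *\<^sub>v v) = (\<Sum>i<n - s. ((XI *\<^sub>v v) $ i)\<^sup>2)"
      using XI by (simp add: scalar_prod_def power2_eq_square lessThan_atLeast0)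
    ultimately have "c * (nrm d (\<lambda>j. v $ j))\<^sup>2 \<le> 0"
      using coercive[of "\<lambda>j. v $ j"] by (simp add: shift XIv v)
    then have "nrm d (\<lambda>j. v $ j) = 0" using \<open>c > 0\<close> by (simp add: mult_le_0_iff)
    then have "\<forall>j<d. v $ j = 0" by (simp add: L2_set_eq_0_iff)
    then show ?thesis using v by (intro eq_vecI) auto
  qed
  have inv: "inv_mat Gram \<in> carrier_mat d d" "Gram * inv_mat Gram = 1\<^sub>m d" "invertible_mat Gram"
    using inv_mat_of_trivial_kernel[OF G] ker by blast+
  have "b = inv_mat Gram *\<^sub>v (transpose_mat XI *\<^sub>v YI)"
    using ols inv(3) by (simp add: ols_on_def Let_def Gram_def XI_def YI_def)
  then have "Gram *\<^sub>v b = (Gram * inv_mat Gram) *\<^sub>v (transpose_mat XI *\<^sub>v YI)"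
    using G inv(1) XI YI by (simp add: assoc_mult_mat_vec[of _ d d _ d])
  also have "\<dots> = transpose_mat XI *\<^sub>v YI" unfolding inv(2) using XI YI by simp
  finally have eq: "transpose_mat XI *\<^sub>v (XI *\<^sub>v b) = transpose_mat XI *\<^sub>v YI" by (simp add: G_mult b)
  have tr: "(transpose_mat XI *\<^sub>v w) $ j = (\<Sum>i<n - s. X $$ (s + i, j) * w $ i)" if "w \<in> carrier_vec (n - s)" for w
    using mult_mat_vec_ip[of "transpose_mat XI" d "n - s" w j] XI that \<open>j < d\<close> by (simp add: ip_def XI_el)
  have "(\<Sum>i<n - s. X $$ (s + i, j) * (XI *\<^sub>v b) $ i) = (\<Sum>i<n - s. X $$ (s + i, j) * YI $ i)"
    unfolding tr[OF YI, symmetric] tr[OF mult_mat_vec_carrier[OF XI b], symmetric] eq ..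
  then have "(\<Sum>i<n - s. X $$ (s + i, j) * ip d (\<lambda>j. X $$ (s + i, j)) (\<lambda>j. b $ j)) = (\<Sum>i<n - s. X $$ (s + i, j) * Y $ (s + i))"
    by (simp add: XIv b YI_el)
  then show ?thesis unfolding shift by (simp add: right_diff_distrib sum_subtractf)
qed

text \<open>Recentering at \<open>\<beta>\<close>: in the variable b - \<beta> the response becomes
  z = \<mu> + \<epsilon> without a regression part, the form in which
  \<open>penalized_minimizer_support\<close> is stated.\<close>

lemma penalized_loss_sum:
  assumes "\<mu> \<in> carrier_vec n" "\<beta> \<in> carrier_vec d" "\<And>i. i < n \<Longrightarrow> X i \<omega> \<in> carrier_vec d"
    and "m \<in> carrier_vec n" "b \<in> carrier_vec d"
  shows "penalized_loss lam (design_mat n d X \<omega>) (response n \<mu> \<beta> X \<epsilon> \<omega>) (m, b) =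
    (\<Sum>i<n. ((\<mu> $ i + \<epsilon> i \<omega>) - m $ i - ip d (\<lambda>j. X i \<omega> $ j) (\<lambda>j. b $ j - \<beta> $ j))\<^sup>2 + 2 * lam * \<bar>m $ i\<bar>)"
proof -
  let ?D = "design_mat n d X \<omega>" and ?Y = "response n \<mu> \<beta> X \<epsilon> \<omega>"
  have D: "?D \<in> carrier_mat n d" by (simp add: design_mat_def)
  have "(?Y - m - ?D *\<^sub>v b) $ i = (\<mu> $ i + \<epsilon> i \<omega>) - m $ i - ip d (\<lambda>j. X i \<omega> $ j) (\<lambda>j. b $ j - \<beta> $ j)" if "i < n" for i
  proof -
    have "(?D *\<^sub>v b) $ i = ip d (\<lambda>j. X i \<omega> $ j) (\<lambda>j. b $ j)"
      using mult_mat_vec_ip[OF D assms(5) that] that by (simp add: design_mat_def ip_def)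
    then have "(?Y - m - ?D *\<^sub>v b) $ i = ?Y $ i - m $ i - ip d (\<lambda>j. X i \<omega> $ j) (\<lambda>j. b $ j)"
      using assms(4) that D by (simp add: response_def)
    then show ?thesis using that scalar_prod_ip[OF assms(2), of "X i \<omega>"]
      by (simp add: response_def ip_def right_diff_distrib sum_subtractf)
  qed
  then have "(vec_norm2 (?Y - m - ?D *\<^sub>v b))\<^sup>2 =
      (\<Sum>i<n. ((\<mu> $ i + \<epsilon> i \<omega>) - m $ i - ip d (\<lambda>j. X i \<omega> $ j) (\<lambda>j. b $ j - \<beta> $ j))\<^sup>2)"
    using D by (simp add: vec_norm2_def L2_set_def sum_nonneg)
  then show ?thesis
    by (simp add: penalized_loss_def response_def sum.distrib sum_distrib_left)
qed

lemma L2_set_row_le_frob_norm: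
  assumes "A \<in> carrier_mat q d" "r < q"
  shows "nrm d (\<lambda>k. A $$ (r, k)) \<le> frob_norm A"
proof -
  have "(\<Sum>k<d. (A $$ (r, k))\<^sup>2) \<le> (\<Sum>i<q. \<Sum>k<d. (A $$ (i, k))\<^sup>2)"
    using assms by (intro member_le_sum) (auto intro: sum_nonneg)
  then show ?thesis using assms
    by (simp add: frob_norm_def L2_set_def sum.cartesian_product split_def)
qed

lemma abs_entry_le_frob_norm:
  assumes "A \<in> carrier_mat q d" "r < q" "k < d"
  shows "\<bar>A $$ (r, k)\<bar> \<le> frob_norm A"
proof -
  have "\<bar>A $$ (r, k)\<bar> \<le> nrm d (\<lambda>k. \<bar>A $$ (r, k)\<bar>)"
    using assms by (intro member_le_L2_set) auto
  also have "\<dots> = nrm d (\<lambda>k. A $$ (r, k))" by (simp add: L2_set_def)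
  finally show ?thesis using L2_set_row_le_frob_norm[OF assms(1,2)] by simp
qed

text \<open>Row r of \<open>B\<close> solves S u = a, where a is row r of \<open>A\<close>, so forms
  of \<open>S\<close> in these rows reduce to inner products with rows of \<open>A\<close>.
  Coercivity then gives c |u|^2 \<le> |u| |a|, a bound without a factor growing in d.\<close>

lemma mult_inv_mat_rows:
  assumes A: "A \<in> carrier_mat q d" and S: "pos_def_mat d S" and c: "c > 0"
    and coercive: "\<And>w. c * (nrm d w)\<^sup>2 \<le> bil d (\<lambda>j k. S $$ (j, k)) w w"
  defines "B \<equiv> A * inv_mat S"
  shows "\<And>r k. r < q \<Longrightarrow> k < d \<Longrightarrow> ip d (\<lambda>j. S $$ (k, j)) (\<lambda>j. B $$ (r, j)) = A $$ (r, k)"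
    and "\<And>r r'. r < q \<Longrightarrow> r' < q \<Longrightarrow>
      bil d (\<lambda>j k. S $$ (j, k)) (\<lambda>j. B $$ (r, j)) (\<lambda>j. B $$ (r', j)) = (A * inv_mat S * transpose_mat A) $$ (r, r')"
    and "\<And>r. r < q \<Longrightarrow> nrm d (\<lambda>j. B $$ (r, j)) \<le> frob_norm A / c"
proof -
  note inv = inv_mat_pos_def[OF S]
  have Sc: "S \<in> carrier_mat d d" and St: "transpose_mat S = S" using S by (auto simp: pos_def_mat_def)
  have sym: "S $$ (j, k) = S $$ (k, j)" if "j < d" "k < d" for j k
    using arg_cong[OF St, of "\<lambda>A. A $$ (j, k)"] Sc that by simp
  have B: "B \<in> carrier_mat q d" using A inv(1) by (simp add: B_def)
  have BS: "B * S = A" unfolding B_def using A Sc inv by (simp add: assoc_mult_mat[of _ q d _ d _ d])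
  show 1: "ip d (\<lambda>j. S $$ (k, j)) (\<lambda>j. B $$ (r, j)) = A $$ (r, k)" if "r < q" "k < d" for r k
  proof -
    have "A $$ (r, k) = (\<Sum>j<d. B $$ (r, j) * S $$ (j, k))"
      using BS B Sc that by (auto simp: scalar_prod_def lessThan_atLeast0)
    also have "\<dots> = ip d (\<lambda>j. S $$ (k, j)) (\<lambda>j. B $$ (r, j))"
      unfolding ip_def using that sym[of k] by (intro sum.cong) (auto simp: mult.commute)
    finally show ?thesis by simp
  qed
  have 2: "bil d (\<lambda>j k. S $$ (j, k)) v (\<lambda>j. B $$ (r', j)) = ip d v (\<lambda>k. A $$ (r', k))" if "r' < q" for v r'
    unfolding bil_ip using 1[OF that] by (simp add: ip_def)
  show "bil d (\<lambda>j k. S $$ (j, k)) (\<lambda>j. B $$ (r, j)) (\<lambda>j. B $$ (r', j)) = (A * inv_mat S * transpose_mat A) $$ (r, r')"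
    if "r < q" "r' < q" for r r'
    unfolding 2[OF that(2)] B_def[symmetric] using A B that by (simp add: ip_def scalar_prod_def lessThan_atLeast0)
  show "nrm d (\<lambda>j. B $$ (r, j)) \<le> frob_norm A / c" if "r < q" for r
  proof -
    let ?u = "\<lambda>j. B $$ (r, j)"
    have "c * (nrm d ?u)\<^sup>2 \<le> ip d ?u (\<lambda>k. A $$ (r, k))" using coercive[of ?u] 2[OF that] by simp
    also have "\<dots> \<le> nrm d ?u * nrm d (\<lambda>k. A $$ (r, k))" using abs_ip_le[of d ?u "\<lambda>k. A $$ (r, k)"] by simp
    also have "\<dots> \<le> nrm d ?u * frob_norm A" using L2_set_row_le_frob_norm[OF A that] by (intro mult_left_mono) auto
    finally have "nrm d ?u * (c * nrm d ?u) \<le> nrm d ?u * frob_norm A" by (simp add: power2_eq_square mult_ac)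
    moreover have "0 \<le> frob_norm A" by (simp add: frob_norm_def)
    ultimately have "c * nrm d ?u \<le> frob_norm A"
      by (cases "nrm d ?u = 0") (auto simp: less_le)
    then show ?thesis using c by (simp add: pos_le_divide_eq mult.commute)
  qed
qed

section \<open>Independence and moments\<close>

text \<open>Cauchy-Schwarz read off from 0 \<le> E (s X - t Y)^2 with s^2 = E Y^2 and t^2 = E X^2; a
  vanishing second moment is treated apart.\<close>

lemma (in prob_space) expectation_mult_le_sqrt:
  fixes X Y :: "'a \<Rightarrow> real"
  assumes [measurable]: "X \<in> borel_measurable M" "Y \<in> borel_measurable M"
    and X2: "integrable M (\<lambda>\<omega>. (X \<omega>)\<^sup>2)" and Y2: "integrable M (\<lambda>\<omega>. (Y \<omega>)\<^sup>2)"
  shows "integrable M (\<lambda>\<omega>. X \<omega> * Y \<omega>)"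
    and "expectation (\<lambda>\<omega>. X \<omega> * Y \<omega>) \<le> sqrt (expectation (\<lambda>\<omega>. (X \<omega>)\<^sup>2)) * sqrt (expectation (\<lambda>\<omega>. (Y \<omega>)\<^sup>2))"
proof -
  show XY: "integrable M (\<lambda>\<omega>. X \<omega> * Y \<omega>)"
  proof (rule Bochner_Integration.integrable_bound[OF Bochner_Integration.integrable_add[OF X2 Y2]])
    show "AE \<omega> in M. norm (X \<omega> * Y \<omega>) \<le> norm ((X \<omega>)\<^sup>2 + (Y \<omega>)\<^sup>2)"
    proof (rule AE_I2)
      fix \<omega>
      have "0 \<le> (\<bar>X \<omega>\<bar> - \<bar>Y \<omega>\<bar>)\<^sup>2" "0 \<le> (X \<omega>)\<^sup>2" "0 \<le> (Y \<omega>)\<^sup>2" by simp_all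
      then have "2 * (\<bar>X \<omega>\<bar> * \<bar>Y \<omega>\<bar>) \<le> (X \<omega>)\<^sup>2 + (Y \<omega>)\<^sup>2" by (simp add: power2_diff)
      moreover have "0 \<le> \<bar>X \<omega>\<bar> * \<bar>Y \<omega>\<bar>" by simp
      ultimately have "\<bar>X \<omega>\<bar> * \<bar>Y \<omega>\<bar> \<le> (X \<omega>)\<^sup>2 + (Y \<omega>)\<^sup>2" by linarith
      then show "norm (X \<omega> * Y \<omega>) \<le> norm ((X \<omega>)\<^sup>2 + (Y \<omega>)\<^sup>2)" by (simp add: abs_mult)
    qed
  qed measurable
  let ?a = "expectation (\<lambda>\<omega>. (X \<omega>)\<^sup>2)" and ?b = "expectation (\<lambda>\<omega>. (Y \<omega>)\<^sup>2)"
    and ?c = "expectation (\<lambda>\<omega>. X \<omega> * Y \<omega>)"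
  have quad: "2 * s * t * ?c \<le> s\<^sup>2 * ?a + t\<^sup>2 * ?b" for s t
  proof -
    have "0 \<le> expectation (\<lambda>\<omega>. (s * X \<omega> - t * Y \<omega>)\<^sup>2)" by (rule Bochner_Integration.integral_nonneg) simp
    also have "expectation (\<lambda>\<omega>. (s * X \<omega> - t * Y \<omega>)\<^sup>2) =
        expectation (\<lambda>\<omega>. s\<^sup>2 * (X \<omega>)\<^sup>2 - (2 * s * t) * (X \<omega> * Y \<omega>) + t\<^sup>2 * (Y \<omega>)\<^sup>2)"
      by (intro Bochner_Integration.integral_cong refl) (simp add: power2_eq_square algebra_simps)
    also have "\<dots> = s\<^sup>2 * ?a - 2 * s * t * ?c + t\<^sup>2 * ?b" by (simp add: X2 Y2 XY)
    finally show ?thesis by simp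
  qed
  have a: "?a \<ge> 0" and b: "?b \<ge> 0" by (simp_all add: Bochner_Integration.integral_nonneg)
  show "?c \<le> sqrt ?a * sqrt ?b"
  proof (cases "?a = 0 \<or> ?b = 0")
    case True
    have "?c \<le> 0"
    proof (rule ccontr)
      assume "\<not> ?c \<le> 0"
      from True show False
      proof
        assume "?a = 0"
        \<comment> \<open>Since E X^2 = 0 the coefficient of X is free. This choice makes the left
          side 2 (b + 1) with b = E Y^2, while the right side is only b.\<close>
        then show False using quad[of "(?b + 1) / ?c" 1] \<open>\<not> ?c \<le> 0\<close> b by simp
      next
        assume "?b = 0"
        then show False using quad[of 1 "(?a + 1) / ?c"] \<open>\<not> ?c \<le> 0\<close> a by simp
      qed
    qed
    then show ?thesis using a b by (meson mult_nonneg_nonneg order_trans real_sqrt_ge_zero)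
  next
    case False
    let ?r = "sqrt ?a * sqrt ?b"
    have "?a > 0" "?b > 0" using False a b by linarith+
    then have "?r > 0" by simp
    have "2 * sqrt ?b * sqrt ?a * ?c \<le> ?b * ?a + ?a * ?b" using quad[of "sqrt ?b" "sqrt ?a"] a b by simp
    also have "\<dots> = 2 * (?r * ?r)" using a b by (simp add: algebra_simps)
    finally have "?r * ?c \<le> ?r * ?r" by (simp add: mult_ac)
    then show ?thesis using \<open>?r > 0\<close> by (simp add: mult_le_cancel_left_pos)
  qed
qed

text \<open>Integrability travels with the identity through the induction, because splitting off a
  summand requires it for the cross term.\<close>

lemma (in prob_space) second_moment_indep_sum:
  fixes Z :: "'i \<Rightarrow> 'a \<Rightarrow> real"
  assumes "finite I" "indep_vars (\<lambda>_. borel) Z I"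
    and "\<And>i. i \<in> I \<Longrightarrow> integrable M (\<lambda>\<omega>. (Z i \<omega>)\<^sup>2)" "\<And>i. i \<in> I \<Longrightarrow> expectation (Z i) = 0"
  shows "integrable M (\<lambda>\<omega>. (\<Sum>i\<in>I. Z i \<omega>)\<^sup>2) \<and>
    expectation (\<lambda>\<omega>. (\<Sum>i\<in>I. Z i \<omega>)\<^sup>2) = (\<Sum>i\<in>I. expectation (\<lambda>\<omega>. (Z i \<omega>)\<^sup>2))"
  using assms
proof (induction I rule: finite_induct)
  case (insert x I)
  have ind: "indep_vars (\<lambda>_. borel) Z I" by (rule indep_vars_subset[OF insert.prems(1)]) auto
  let ?S = "\<lambda>\<omega>. \<Sum>i\<in>I. Z i \<omega>"
  have IH: "integrable M (\<lambda>\<omega>. (?S \<omega>)\<^sup>2)"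
    "expectation (\<lambda>\<omega>. (?S \<omega>)\<^sup>2) = (\<Sum>i\<in>I. expectation (\<lambda>\<omega>. (Z i \<omega>)\<^sup>2))"
    using insert.IH[OF ind] insert.prems by auto
  have meas: "Z i \<in> borel_measurable M" if "i \<in> insert x I" for i
    using insert.prems(1) that by (auto simp: indep_vars_def)
  have int: "integrable M (Z i)" if "i \<in> insert x I" for i
    using insert.prems(2)[OF that] meas[OF that] by (rule square_integrable_imp_integrable[rotated])
  have Smeas: "?S \<in> borel_measurable M" using meas by (intro borel_measurable_sum) auto
  have Sint: "integrable M ?S" by (rule square_integrable_imp_integrable[OF Smeas IH(1)])
  have iv: "indep_var borel (Z x) borel ?S" by (rule indep_vars_sum[OF insert.hyps insert.prems(1)])
  have cross: "integrable M (\<lambda>\<omega>. Z x \<omega> * ?S \<omega>)" "expectation (\<lambda>\<omega>. Z x \<omega> * ?S \<omega>) = 0"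
    using indep_var_integrable[OF iv int Sint] indep_var_lebesgue_integral[OF iv int Sint] insert.prems(3)[of x] by auto
  have eq: "(\<lambda>\<omega>. (\<Sum>i\<in>insert x I. Z i \<omega>)\<^sup>2) = (\<lambda>\<omega>. (Z x \<omega>)\<^sup>2 + 2 * (Z x \<omega> * ?S \<omega>) + (?S \<omega>)\<^sup>2)"
    using insert.hyps by (auto simp: power2_eq_square algebra_simps)
  show ?case unfolding eq using insert.hyps insert.prems(2)[of x] cross IH by simp
qed simp

text \<open>\<open>data_model\<close> gives independence inside each family and of the two families
  as blocks; the later summands mix both, so independence of the pairs over i is required.
  Rectangles form an intersection-stable generator of the pair sigma-algebras, on which the
  factorization can be checked.\<close>

lemma data_model_indep_pairs:
  fixes M :: "'a measure"
  assumes "data_model M n d P Q X \<epsilon>"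
  shows "prob_space.indep_vars M (\<lambda>_. RV d \<Otimes>\<^sub>M borel) (\<lambda>i \<omega>. (coords d (X i \<omega>), \<epsilon> i \<omega>)) {..<n}"
    and "\<And>i f h. i < n \<Longrightarrow> f \<in> borel_measurable (RV d) \<Longrightarrow> h \<in> borel_measurable borel \<Longrightarrow>
      prob_space.indep_var M (borel :: real measure) (\<lambda>\<omega>. f (coords d (X i \<omega>))) borel (\<lambda>\<omega>. h (\<epsilon> i \<omega>))"
proof -
  interpret prob_space M using assms by (simp add: data_model_def)
  define Z where "Z i \<omega> = coords d (X i \<omega>)" for i \<omega>
  have Z: "Z i \<in> measurable M (RV d)" if "i < n" for i
    using assms that by (auto simp: data_model_def random_vec_def Z_def[abs_def])
  have e: "\<epsilon> i \<in> borel_measurable M" if "i < n" for i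
    using assms that by (auto simp: data_model_def)
  have indZ: "indep_vars (\<lambda>_. RV d) Z {..<n}" and inde: "indep_vars (\<lambda>_. borel) \<epsilon> {..<n}"
    using assms by (auto simp: data_model_def Z_def[abs_def])
  let ?VZ = "vimage_algebra (space M) (\<lambda>\<omega>. \<lambda>i\<in>{..<n}. Z i \<omega>) (PiM {..<n} (\<lambda>_. RV d))"
  let ?Ve = "vimage_algebra (space M) (\<lambda>\<omega>. \<lambda>i\<in>{..<n}. \<epsilon> i \<omega>) (PiM {..<n} (\<lambda>_. borel :: real measure))"
  have ind: "indep_set (sets ?VZ) (sets ?Ve)"
    using assms by (simp add: data_model_def Z_def)
  have VZm: "Z j \<in> measurable ?VZ (RV d)" if "j < n" for j
  proof -
    have "(\<lambda>\<omega>. \<lambda>i\<in>{..<n}. Z i \<omega>) \<in> measurable ?VZ (PiM {..<n} (\<lambda>_. RV d))"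
      using measurable_space[OF Z]
      by (intro measurable_vimage_algebra1) (auto simp: space_PiM[of "{..<n}"] simp del: space_PiM)
    from measurable_compose[OF this measurable_component_singleton[of j]]
    show "Z j \<in> measurable ?VZ (RV d)" using that by simp
  qed
  have VZ: "Z j -` A \<inter> space M \<in> sets ?VZ" if "j < n" "A \<in> sets (RV d)" for j A
    using measurable_sets[OF VZm that(2)] that(1) by simp
  have Vem: "\<epsilon> j \<in> borel_measurable ?Ve" if "j < n" for j
  proof -
    have "(\<lambda>\<omega>. \<lambda>i\<in>{..<n}. \<epsilon> i \<omega>) \<in> measurable ?Ve (PiM {..<n} (\<lambda>_. borel))"
      by (rule measurable_vimage_algebra1) (auto simp: space_PiM)
    from measurable_compose[OF this measurable_component_singleton[of j]]
    show "\<epsilon> j \<in> measurable ?Ve borel" using that by simp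
  qed
  have Ve: "\<epsilon> j -` A \<inter> space M \<in> sets ?Ve" if "j < n" "A \<in> sets borel" for j A
    using measurable_sets[OF Vem that(2)] that(1) by simp
  define F where "F i = {(Z i -` A \<inter> space M) \<inter> (\<epsilon> i -` B \<inter> space M) | A B. A \<in> sets (RV d) \<and> B \<in> sets borel}" for i
  have indF: "indep_sets F {..<n}"
  proof (rule indep_setsI)
    show "F i \<subseteq> events" if "i \<in> {..<n}" for i
      using that measurable_sets[OF Z] measurable_sets[OF e] by (auto simp: F_def)
    fix C J assume J: "J \<noteq> {}" "J \<subseteq> {..<n}" "finite J" "\<forall>j\<in>J. C j \<in> F j"
    then obtain A B where AB: "\<And>j. j \<in> J \<Longrightarrow> C j = (Z j -` A j \<inter> space M) \<inter> (\<epsilon> j -` B j \<inter> space M)"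
      "\<And>j. j \<in> J \<Longrightarrow> A j \<in> sets (RV d)" "\<And>j. j \<in> J \<Longrightarrow> B j \<in> sets borel"
      unfolding F_def by (simp add: subset_iff) metis
    \<comment> \<open>Block independence separates the design part from the noise part, each factors
      over J, and block independence used backwards at a single index reassembles the probability of
      each rectangle.\<close>
    let ?a = "\<Inter>j\<in>J. Z j -` A j \<inter> space M" and ?b = "\<Inter>j\<in>J. \<epsilon> j -` B j \<inter> space M"
    have "?a \<in> sets ?VZ"
      by (rule sets.finite_INT) (use J AB in \<open>auto intro!: VZ\<close>)
    moreover have "?b \<in> sets ?Ve"
      by (rule sets.finite_INT) (use J AB in \<open>auto intro!: Ve\<close>)
    ultimately have "prob (?a \<inter> ?b) = prob ?a * prob ?b" by (rule indep_setD[OF ind])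
    also have "prob ?a = (\<Prod>j\<in>J. prob (Z j -` A j \<inter> space M))"
      using J AB by (intro indep_varsD[OF indZ]) auto
    also have "prob ?b = (\<Prod>j\<in>J. prob (\<epsilon> j -` B j \<inter> space M))"
      using J AB by (intro indep_varsD[OF inde]) auto
    finally have "prob (?a \<inter> ?b) = (\<Prod>j\<in>J. prob (Z j -` A j \<inter> space M) * prob (\<epsilon> j -` B j \<inter> space M))"
      by (simp add: prod.distrib)
    also have "\<dots> = (\<Prod>j\<in>J. prob (C j))"
    proof (rule prod.cong)
      fix j assume "j \<in> J"
      then have "Z j -` A j \<inter> space M \<in> sets ?VZ" "\<epsilon> j -` B j \<inter> space M \<in> sets ?Ve"
        using J AB VZ Ve by auto
      from indep_setD[OF ind this] show "prob (Z j -` A j \<inter> space M) * prob (\<epsilon> j -` B j \<inter> space M) = prob (C j)"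
        by (simp add: AB(1)[OF \<open>j \<in> J\<close>])
    qed simp
    also have "?a \<inter> ?b = (\<Inter>j\<in>J. C j)" using AB(1) J(1) by auto
    finally show "prob (\<Inter>j\<in>J. C j) = (\<Prod>j\<in>J. prob (C j))" .
  qed
  have "Int_stable (F i)" for i
  proof (rule Int_stableI)
    fix a b assume "a \<in> F i" "b \<in> F i"
    then obtain A B A' B' where
      "a = (Z i -` A \<inter> space M) \<inter> (\<epsilon> i -` B \<inter> space M)" "A \<in> sets (RV d)" "B \<in> sets borel"
      "b = (Z i -` A' \<inter> space M) \<inter> (\<epsilon> i -` B' \<inter> space M)" "A' \<in> sets (RV d)" "B' \<in> sets borel"
      unfolding F_def by blast
    then show "a \<inter> b \<in> F i"
      unfolding F_def by (intro CollectI exI[of _ "A \<inter> A'"] exI[of _ "B \<inter> B'"]) auto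
  qed
  then have ind_sigma: "indep_sets (\<lambda>i. sigma_sets (space M) (F i)) {..<n}"
    by (intro indep_sets_sigma[OF indF]) auto
  have sub: "{(\<lambda>\<omega>. (Z i \<omega>, \<epsilon> i \<omega>)) -` A \<inter> space M | A. A \<in> sets (RV d \<Otimes>\<^sub>M borel)} \<subseteq> sigma_sets (space M) (F i)"
    if "i < n" for i
  proof -
    have F_sub: "F i \<subseteq> Pow (space M)" by (auto simp: F_def)
    have "Z i \<in> measurable (sigma (space M) (F i)) (RV d)"
    proof (rule measurableI)
      show "Z i \<omega> \<in> space (RV d)" if "\<omega> \<in> space (sigma (space M) (F i))" for \<omega>
        using measurable_space[OF Z[OF \<open>i < n\<close>]] that by (simp add: space_measure_of[OF F_sub])
      fix A assume "A \<in> sets (RV d)"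
      then have "Z i -` A \<inter> space M \<in> F i"
        unfolding F_def by (intro CollectI exI[of _ A] exI[of _ UNIV]) auto
      then show "Z i -` A \<inter> space (sigma (space M) (F i)) \<in> sets (sigma (space M) (F i))"
        by (simp add: F_sub)
    qed
    moreover have "\<epsilon> i \<in> measurable (sigma (space M) (F i)) borel"
    proof (rule measurableI)
      fix B :: "real set" assume "B \<in> sets borel"
      then have "\<epsilon> i -` B \<inter> space M \<in> F i"
        unfolding F_def using measurable_space[OF Z[OF \<open>i < n\<close>]]
        by (intro CollectI exI[of _ "space (RV d)"] exI[of _ B]) auto
      then show "\<epsilon> i -` B \<inter> space (sigma (space M) (F i)) \<in> sets (sigma (space M) (F i))"
        by (simp add: F_sub)
    qed simp
    ultimately have "(\<lambda>\<omega>. (Z i \<omega>, \<epsilon> i \<omega>)) \<in> measurable (sigma (space M) (F i)) (RV d \<Otimes>\<^sub>M borel)"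
      by (rule measurable_Pair)
    from measurable_sets[OF this] show ?thesis by (auto simp: F_sub)
  qed
  show "indep_vars (\<lambda>_. RV d \<Otimes>\<^sub>M borel) (\<lambda>i \<omega>. (coords d (X i \<omega>), \<epsilon> i \<omega>)) {..<n}"
    unfolding indep_vars_def2 Z_def[symmetric]
  proof (intro conjI ballI)
    show "indep_sets (\<lambda>i. {(\<lambda>\<omega>. (Z i \<omega>, \<epsilon> i \<omega>)) -` A \<inter> space M | A. A \<in> sets (RV d \<Otimes>\<^sub>M borel)}) {..<n}"
      by (rule indep_sets_mono_sets[OF ind_sigma]) (use sub in auto)
  qed (use Z e in auto)
  show "indep_var borel (\<lambda>\<omega>. f (coords d (X i \<omega>))) borel (\<lambda>\<omega>. h (\<epsilon> i \<omega>))"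
    if i: "i < n" and f: "f \<in> borel_measurable (RV d)" and h: "h \<in> borel_measurable borel"
    for i and f :: "_ \<Rightarrow> real" and h :: "real \<Rightarrow> real"
    unfolding indep_var_eq Z_def[symmetric]
  proof (intro conjI)
    let ?f = "\<lambda>\<omega>. f (Z i \<omega>)" and ?h = "\<lambda>\<omega>. h (\<epsilon> i \<omega>)"
    show fm: "?f \<in> borel_measurable M" and hm: "?h \<in> borel_measurable M"
      using measurable_compose[OF Z[OF i] f] measurable_compose[OF e[OF i] h] by auto
    have "indep_set {?f -` A \<inter> space M | A. A \<in> sets borel} {?h -` A \<inter> space M | A. A \<in> sets borel}"
    proof (rule indep_setI)
      fix a b assume "a \<in> {?f -` A \<inter> space M | A. A \<in> sets borel}" "b \<in> {?h -` A \<inter> space M | A. A \<in> sets borel}"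
      then have "a \<in> sets ?VZ" "b \<in> sets ?Ve"
        using measurable_sets[OF measurable_compose[OF VZm[OF i] f]]
          measurable_sets[OF measurable_compose[OF Vem[OF i] h]] by auto
      then show "prob (a \<inter> b) = prob a * prob b" by (rule indep_setD[OF ind])
    qed (use measurable_sets[OF fm] measurable_sets[OF hm] in auto)
    moreover have "Int_stable {g -` A \<inter> space M | A. A \<in> sets borel}" for g :: "'a \<Rightarrow> real"
    proof (rule Int_stableI)
      fix a b assume "a \<in> {g -` A \<inter> space M | A. A \<in> sets borel}" "b \<in> {g -` A \<inter> space M | A. A \<in> sets borel}"
      then obtain A B where "a = g -` A \<inter> space M" "A \<in> sets borel" "b = g -` B \<inter> space M" "B \<in> sets borel" by blast
      then show "a \<inter> b \<in> {g -` A \<inter> space M | A. A \<in> sets borel}"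
        by (intro CollectI exI[of _ "A \<inter> B"]) auto
    qed
    ultimately show "indep_set (sigma_sets (space M) {?f -` A \<inter> space M | A. A \<in> sets borel})
        (sigma_sets (space M) {?h -` A \<inter> space M | A. A \<in> sets borel})"
      by (intro indep_set_sigma_sets)
  qed
qed

lemma (in prob_space) prob_gt_le_second_moment:
  assumes "integrable M (\<lambda>\<omega>. (Z \<omega>)\<^sup>2)" "expectation (\<lambda>\<omega>. (Z \<omega>)\<^sup>2) \<le> b" "t > 0"
    and [measurable]: "Z \<in> borel_measurable M"
  shows "prob {\<omega> \<in> space M. \<bar>Z \<omega>\<bar> > t} \<le> b / t\<^sup>2"
proof -
  have "prob {\<omega> \<in> space M. \<bar>Z \<omega>\<bar> > t} \<le> prob {\<omega> \<in> space M. (Z \<omega>)\<^sup>2 \<ge> t\<^sup>2}"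
  proof (rule finite_measure_mono)
    show "{\<omega> \<in> space M. \<bar>Z \<omega>\<bar> > t} \<subseteq> {\<omega> \<in> space M. (Z \<omega>)\<^sup>2 \<ge> t\<^sup>2}"
      using \<open>t > 0\<close> by (auto simp: abs_le_square_iff[symmetric])
  qed measurable
  also have "\<dots> \<le> expectation (\<lambda>\<omega>. (Z \<omega>)\<^sup>2) / t\<^sup>2"
    by (rule integral_Markov_inequality_measure[where A = "{}"]) (use assms in auto)
  also have "\<dots> \<le> b / t\<^sup>2" using assms(2) by (rule divide_right_mono) simp
  finally show ?thesis .
qed

lemma integral_double_sum:
  fixes f :: "nat \<Rightarrow> nat \<Rightarrow> 'a \<Rightarrow> real"
  assumes "\<And>j k. j < d \<Longrightarrow> k < e \<Longrightarrow> integrable M (f j k)"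
  shows "(\<integral>x. (\<Sum>j<d. \<Sum>k<e. f j k x) \<partial>M) = (\<Sum>j<d. \<Sum>k<e. \<integral>x. f j k x \<partial>M)"
proof -
  have "(\<integral>x. (\<Sum>j<d. \<Sum>k<e. f j k x) \<partial>M) = (\<Sum>j<d. \<integral>x. (\<Sum>k<e. f j k x) \<partial>M)"
    using assms by (intro Bochner_Integration.integral_sum Bochner_Integration.integrable_sum) auto
  also have "\<dots> = (\<Sum>j<d. \<Sum>k<e. \<integral>x. f j k x \<partial>M)"
    using assms by (intro sum.cong refl Bochner_Integration.integral_sum) auto
  finally show ?thesis .
qed

section \<open>Moment bounds for one sample\<close>

lemma coord_measurable: "j < d \<Longrightarrow> (\<lambda>x. x j) \<in> borel_measurable (RV d)"
  by (rule measurable_component_singleton) simp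

text \<open>One sample size and no limits: the law changes with the sample size, so the bounds are
  kept explicit in \<open>n\<close>, \<open>d\<close> and the moments.\<close>

locale regression_sample = prob_space M for M :: "'a measure" +
  fixes n d :: nat and P :: "(nat \<Rightarrow> real) measure" and Q :: "real measure"
    and X :: "nat \<Rightarrow> 'a \<Rightarrow> real vec" and \<epsilon> :: "nat \<Rightarrow> 'a \<Rightarrow> real" and \<sigma> :: real
  assumes model: "data_model M n d P Q X \<epsilon>"
    and design: "design_law d P" and noise: "noise_law \<sigma> Q"
    and fourth: "j < d \<Longrightarrow> integrable P (\<lambda>x. x j ^ 4)"
begin

definition x :: "nat \<Rightarrow> 'a \<Rightarrow> nat \<Rightarrow> real" where
  "x i \<omega> j = X i \<omega> $ j"

definition Sig :: "nat \<Rightarrow> nat \<Rightarrow> real" where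
  "Sig j k = cov_mat d P $$ (j, k)"

text \<open>This is \<open>d\<close> times \<open>kappa_X\<close>, hence O(d) when the latter is
  bounded. It dominates the trace of the covariance, and its square dominates E |X|^4.\<close>

definition \<tau> :: real where
  "\<tau> = (\<Sum>j<d. sqrt (\<integral>x. x j ^ 4 \<partial>P))"

lemma sets_P: "sets P = sets (RV d)" using design by (simp add: design_law_def)

lemma X_carrier: "i < n \<Longrightarrow> \<omega> \<in> space M \<Longrightarrow> X i \<omega> \<in> carrier_vec d"
  using model by (auto simp: data_model_def random_vec_def)

lemma coords_measurable: "i < n \<Longrightarrow> (\<lambda>\<omega>. coords d (X i \<omega>)) \<in> measurable M (RV d)"
  using model by (auto simp: data_model_def random_vec_def)

lemma eps_measurable: "i < n \<Longrightarrow> \<epsilon> i \<in> borel_measurable M"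
  using model by (auto simp: data_model_def)

lemma x_measurable:
  assumes "i < n" "j < d" shows "(\<lambda>\<omega>. x i \<omega> j) \<in> borel_measurable M"
proof -
  have "(\<lambda>\<omega>. coords d (X i \<omega>) j) \<in> borel_measurable M"
    using measurable_compose[OF coords_measurable[OF assms(1)] measurable_component_singleton[of j]] assms(2) by simp
  then show ?thesis using assms(2) by (simp add: coords_def x_def)
qed

lemma design_moment:
  assumes "i < n" "f \<in> borel_measurable (RV d)"
  shows "integrable M (\<lambda>\<omega>. f (coords d (X i \<omega>))) \<longleftrightarrow> integrable P f"
    and "expectation (\<lambda>\<omega>. f (coords d (X i \<omega>))) = (\<integral>x. (f x :: real) \<partial>P)"
proof -
  have P: "P = distr M (RV d) (\<lambda>\<omega>. coords d (X i \<omega>))"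
    using model assms(1) by (auto simp: data_model_def vec_law_def)
  show "integrable M (\<lambda>\<omega>. f (coords d (X i \<omega>))) \<longleftrightarrow> integrable P f"
    unfolding P using coords_measurable[OF assms(1)] assms(2) by (simp add: integrable_distr_eq)
  show "expectation (\<lambda>\<omega>. f (coords d (X i \<omega>))) = (\<integral>x. f x \<partial>P)"
    unfolding P using coords_measurable[OF assms(1)] assms(2) by (simp add: integral_distr)
qed

lemma noise_moment:
  assumes "i < n" "f \<in> borel_measurable borel"
  shows "integrable M (\<lambda>\<omega>. f (\<epsilon> i \<omega>)) \<longleftrightarrow> integrable Q f"
    and "expectation (\<lambda>\<omega>. f (\<epsilon> i \<omega>)) = (\<integral>x. (f x :: real) \<partial>Q)"
proof -
  have Q: "Q = distr M borel (\<epsilon> i)" using model assms(1) by (auto simp: data_model_def)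
  show "integrable M (\<lambda>\<omega>. f (\<epsilon> i \<omega>)) \<longleftrightarrow> integrable Q f"
    unfolding Q using eps_measurable[OF assms(1)] assms(2) by (simp add: integrable_distr_eq)
  show "expectation (\<lambda>\<omega>. f (\<epsilon> i \<omega>)) = (\<integral>x. f x \<partial>Q)"
    unfolding Q using eps_measurable[OF assms(1)] assms(2) by (simp add: integral_distr)
qed

lemma product_moment:
  assumes "i < n" "f \<in> borel_measurable (RV d)" "h \<in> borel_measurable borel"
    "integrable P f" "integrable Q h"
  shows "integrable M (\<lambda>\<omega>. f (coords d (X i \<omega>)) * h (\<epsilon> i \<omega>))"
    and "expectation (\<lambda>\<omega>. f (coords d (X i \<omega>)) * h (\<epsilon> i \<omega>)) = (\<integral>x. (f x :: real) \<partial>P) * (\<integral>x. h x \<partial>Q)"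
proof -
  note iv = data_model_indep_pairs(2)[OF model assms(1-3)]
  have "integrable M (\<lambda>\<omega>. f (coords d (X i \<omega>)))" "integrable M (\<lambda>\<omega>. h (\<epsilon> i \<omega>))"
    using design_moment(1)[OF assms(1,2)] noise_moment(1)[OF assms(1,3)] assms(4,5) by auto
  from indep_var_integrable[OF iv this] indep_var_lebesgue_integral[OF iv this]
  show "integrable M (\<lambda>\<omega>. f (coords d (X i \<omega>)) * h (\<epsilon> i \<omega>))"
    "expectation (\<lambda>\<omega>. f (coords d (X i \<omega>)) * h (\<epsilon> i \<omega>)) = (\<integral>x. f x \<partial>P) * (\<integral>x. h x \<partial>Q)"
    using design_moment(2)[OF assms(1,2)] noise_moment(2)[OF assms(1,3)] by auto
qed

lemma indep_pair_functions:
  assumes "\<And>i. i \<in> J \<Longrightarrow> g i \<in> borel_measurable (RV d \<Otimes>\<^sub>M borel)" "J \<subseteq> {..<n}"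
  shows "indep_vars (\<lambda>_. borel) (\<lambda>i \<omega>. g i (coords d (X i \<omega>), \<epsilon> i \<omega>)) J"
  by (rule indep_vars_compose2[where Y = g and N = "\<lambda>_. borel",
        OF indep_vars_subset[OF data_model_indep_pairs(1)[OF model] assms(2)]]) (rule assms(1))

lemma fst_coord_measurable: "j < d \<Longrightarrow> (\<lambda>p :: (nat \<Rightarrow> real) \<times> real. fst p j) \<in> borel_measurable (RV d \<Otimes>\<^sub>M borel)"
  by (rule measurable_compose[OF measurable_fst measurable_component_singleton]) simp

sublocale P: prob_space P using design by (simp add: design_law_def)

sublocale Q: prob_space Q using noise by (simp add: noise_law_def)

lemma coord_measurable_P [measurable]: "j < d \<Longrightarrow> (\<lambda>x. x j) \<in> borel_measurable P"
  by (simp add: measurable_cong_sets[OF sets_P refl] coord_measurable)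

lemma P_moments:
  assumes "j < d" "k < d"
  shows "integrable P (\<lambda>x. x j)" "(\<integral>x. x j \<partial>P) = 0" "integrable P (\<lambda>x. (x j)\<^sup>2)"
    "integrable P (\<lambda>x. x j * x k)" "(\<integral>x. x j * x k \<partial>P) = Sig j k"
    "integrable P (\<lambda>x. (x j)\<^sup>2 * (x k)\<^sup>2)"
    "(\<integral>x. (x j)\<^sup>2 * (x k)\<^sup>2 \<partial>P) \<le> sqrt (\<integral>x. x j ^ 4 \<partial>P) * sqrt (\<integral>x. x k ^ 4 \<partial>P)"
    "(\<integral>x. (x j)\<^sup>2 \<partial>P) \<le> sqrt (\<integral>x. x j ^ 4 \<partial>P)"
proof -
  have sq: "((x :: real)\<^sup>2)\<^sup>2 = x ^ 4" for x by simp
  have mean: "(\<integral>x. x j \<partial>P) = 0" if "j < d" for j using design that by (simp add: design_law_def)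
  have sq_int: "integrable P (\<lambda>x. (x j)\<^sup>2)" if "j < d" for j using design that by (simp add: design_law_def)
  show "(\<integral>x. x j \<partial>P) = 0" "integrable P (\<lambda>x. (x j)\<^sup>2)" by (rule mean sq_int, fact)+
  show "integrable P (\<lambda>x. x j)"
    by (rule P.square_integrable_imp_integrable) (use assms sq_int in auto)
  show "integrable P (\<lambda>x. x j * x k)"
    by (rule P.expectation_mult_le_sqrt) (use assms sq_int in auto)
  show "(\<integral>x. x j * x k \<partial>P) = Sig j k"
    using assms by (simp add: Sig_def cov_mat_def mean)
  show "integrable P (\<lambda>x. (x j)\<^sup>2 * (x k)\<^sup>2)"
    by (rule P.expectation_mult_le_sqrt) (use assms fourth in auto)
  show "(\<integral>x. (x j)\<^sup>2 * (x k)\<^sup>2 \<partial>P) \<le> sqrt (\<integral>x. x j ^ 4 \<partial>P) * sqrt (\<integral>x. x k ^ 4 \<partial>P)"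
    using P.expectation_mult_le_sqrt(2)[of "\<lambda>x. (x j)\<^sup>2" "\<lambda>x. (x k)\<^sup>2"] assms fourth by simp
  show "(\<integral>x. (x j)\<^sup>2 \<partial>P) \<le> sqrt (\<integral>x. x j ^ 4 \<partial>P)"
    using P.expectation_mult_le_sqrt(2)[of "\<lambda>x. (x j)\<^sup>2" "\<lambda>_. 1"] assms fourth by (simp add: P.prob_space)
qed

lemma \<tau>_nonneg: "\<tau> \<ge> 0"
  unfolding \<tau>_def by (intro sum_nonneg real_sqrt_ge_zero Bochner_Integration.integral_nonneg) auto

lemma trace_le: "(\<Sum>j<d. \<integral>x. (x j)\<^sup>2 \<partial>P) \<le> \<tau>"
  unfolding \<tau>_def by (intro sum_mono P_moments) auto

text \<open>After expanding |x|^4 over pairs of coordinates, Cauchy-Schwarz for each pair turns the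
  double sum into a product, the square of \<open>\<tau>\<close>.\<close>

lemma fourth_moment_le:
  shows "integrable P (\<lambda>x. (nrm d x) ^ 4)" "(\<integral>x. (nrm d x) ^ 4 \<partial>P) \<le> \<tau>\<^sup>2"
proof -
  have eq: "(nrm d x) ^ 4 = (\<Sum>j<d. \<Sum>k<d. (x j)\<^sup>2 * (x k)\<^sup>2)" for x :: "nat \<Rightarrow> real"
  proof -
    have "(nrm d x) ^ 4 = ((nrm d x)\<^sup>2)\<^sup>2" by simp
    also have "(nrm d x)\<^sup>2 = (\<Sum>j<d. (x j)\<^sup>2)" by (simp add: L2_set_def sum_nonneg)
    also have "\<dots>\<^sup>2 = (\<Sum>j<d. \<Sum>k<d. (x j)\<^sup>2 * (x k)\<^sup>2)" by (simp add: power2_eq_square sum_product)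
    finally show ?thesis .
  qed
  show "integrable P (\<lambda>x. (nrm d x) ^ 4)" unfolding eq by (intro Bochner_Integration.integrable_sum P_moments) auto
  have "(\<integral>x. (nrm d x) ^ 4 \<partial>P) = (\<Sum>j<d. \<Sum>k<d. \<integral>x. (x j)\<^sup>2 * (x k)\<^sup>2 \<partial>P)"
    unfolding eq by (rule integral_double_sum) (rule P_moments)
  also have "\<dots> \<le> (\<Sum>j<d. \<Sum>k<d. sqrt (\<integral>x. x j ^ 4 \<partial>P) * sqrt (\<integral>x. x k ^ 4 \<partial>P))"
    by (intro sum_mono P_moments) auto
  also have "\<dots> = \<tau>\<^sup>2" by (simp add: \<tau>_def power2_eq_square sum_product)
  finally show "(\<integral>x. (nrm d x) ^ 4 \<partial>P) \<le> \<tau>\<^sup>2" .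
qed

lemma Q_moments:
  "integrable Q (\<lambda>x. x\<^sup>2)" "(\<integral>x. x\<^sup>2 \<partial>Q) = \<sigma>\<^sup>2" "integrable Q (\<lambda>x. x)" "(\<integral>x. x \<partial>Q) = 0"
proof -
  have s: "sets Q = sets borel" using noise by (simp add: noise_law_def)
  show 1: "integrable Q (\<lambda>x. x\<^sup>2)" "(\<integral>x. x\<^sup>2 \<partial>Q) = \<sigma>\<^sup>2" "(\<integral>x. x \<partial>Q) = 0"
    using noise by (auto simp: noise_law_def)
  show "integrable Q (\<lambda>x. x)"
    by (rule Q.square_integrable_imp_integrable) (use 1 in \<open>auto simp: measurable_cong_sets[OF s refl]\<close>)
qed

lemma coords_nth: "j < d \<Longrightarrow> coords d (X i \<omega>) j = x i \<omega> j"
  by (simp add: coords_def x_def)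

lemma nrm_coords: "nrm d (coords d (X i \<omega>)) = nrm d (x i \<omega>)"
  by (rule L2_set_cong) (auto simp: coords_nth)

text \<open>Meant for a i = sgn (\<mu> i): gross outliers act on the first step only through their
  signs, so their total pull has size sqrt (s1 d) however large they are.\<close>

lemma second_moment_weighted_rows:
  assumes J: "J \<subseteq> {..<n}"
  shows "integrable M (\<lambda>\<omega>. (nrm d (\<lambda>j. \<Sum>i\<in>J. a i * x i \<omega> j))\<^sup>2)"
    and "expectation (\<lambda>\<omega>. (nrm d (\<lambda>j. \<Sum>i\<in>J. a i * x i \<omega> j))\<^sup>2) \<le> (\<Sum>i\<in>J. (a i)\<^sup>2) * \<tau>"
proof -
  have fin: "finite J" using J finite_subset by blast
  have sq: "(nrm d v)\<^sup>2 = (\<Sum>j<d. (v j)\<^sup>2)" for v :: "nat \<Rightarrow> real" by (simp add: L2_set_def sum_nonneg)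
  have *: "integrable M (\<lambda>\<omega>. (\<Sum>i\<in>J. a i * x i \<omega> j)\<^sup>2) \<and>
      expectation (\<lambda>\<omega>. (\<Sum>i\<in>J. a i * x i \<omega> j)\<^sup>2) = (\<Sum>i\<in>J. (a i)\<^sup>2) * (\<integral>x. (x j)\<^sup>2 \<partial>P)" if j: "j < d" for j
  proof -
    have "indep_vars (\<lambda>_. borel) (\<lambda>i \<omega>. (\<lambda>p. a i * fst p j) (coords d (X i \<omega>), \<epsilon> i \<omega>)) J"
      by (rule indep_pair_functions[OF _ J]) (intro borel_measurable_times borel_measurable_const fst_coord_measurable measurable_snd j)
    then have iv: "indep_vars (\<lambda>_. borel) (\<lambda>i \<omega>. a i * x i \<omega> j) J" by (simp add: coords_nth j)
    have m2: "integrable M (\<lambda>\<omega>. (a i * x i \<omega> j)\<^sup>2)"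
      "expectation (\<lambda>\<omega>. (a i * x i \<omega> j)\<^sup>2) = (a i)\<^sup>2 * (\<integral>x. (x j)\<^sup>2 \<partial>P)"
      "expectation (\<lambda>\<omega>. a i * x i \<omega> j) = 0" if "i \<in> J" for i
    proof -
      have i: "i < n" using J that by auto
      have "(\<lambda>x. (x j)\<^sup>2) \<in> borel_measurable (RV d)" "(\<lambda>x. x j) \<in> borel_measurable (RV d)"
        by (intro borel_measurable_power coord_measurable j)+
      then show "integrable M (\<lambda>\<omega>. (a i * x i \<omega> j)\<^sup>2)"
        "expectation (\<lambda>\<omega>. (a i * x i \<omega> j)\<^sup>2) = (a i)\<^sup>2 * (\<integral>x. (x j)\<^sup>2 \<partial>P)"
        "expectation (\<lambda>\<omega>. a i * x i \<omega> j) = 0"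
        using design_moment[OF i, of "\<lambda>x. (x j)\<^sup>2"] design_moment[OF i, of "\<lambda>x. x j"] P_moments[OF j j]
        by (simp_all add: coords_nth j power_mult_distrib)
    qed
    show ?thesis using second_moment_indep_sum[OF fin iv] m2 by (simp add: sum_distrib_right)
  qed
  show "integrable M (\<lambda>\<omega>. (nrm d (\<lambda>j. \<Sum>i\<in>J. a i * x i \<omega> j))\<^sup>2)"
    unfolding sq using * by (intro Bochner_Integration.integrable_sum) auto
  have "expectation (\<lambda>\<omega>. (nrm d (\<lambda>j. \<Sum>i\<in>J. a i * x i \<omega> j))\<^sup>2) = (\<Sum>i\<in>J. (a i)\<^sup>2) * (\<Sum>j<d. \<integral>x. (x j)\<^sup>2 \<partial>P)"
    unfolding sq using * by (simp add: Bochner_Integration.integral_sum sum_distrib_left)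
  also have "\<dots> \<le> (\<Sum>i\<in>J. (a i)\<^sup>2) * \<tau>" by (intro mult_left_mono trace_le sum_nonneg) auto
  finally show "expectation (\<lambda>\<omega>. (nrm d (\<lambda>j. \<Sum>i\<in>J. a i * x i \<omega> j))\<^sup>2) \<le> (\<Sum>i\<in>J. (a i)\<^sup>2) * \<tau>" .
qed

text \<open>The noise is independent of its row and centred, so every product has mean zero and a
  second moment that factors.\<close>

lemma second_moment_noise_rows:
  assumes J: "J \<subseteq> {..<n}"
  shows "integrable M (\<lambda>\<omega>. (nrm d (\<lambda>j. \<Sum>i\<in>J. \<epsilon> i \<omega> * x i \<omega> j))\<^sup>2)"
    and "expectation (\<lambda>\<omega>. (nrm d (\<lambda>j. \<Sum>i\<in>J. \<epsilon> i \<omega> * x i \<omega> j))\<^sup>2) \<le> card J * \<sigma>\<^sup>2 * \<tau>"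
proof -
  have fin: "finite J" using J finite_subset by blast
  have sq: "(nrm d v)\<^sup>2 = (\<Sum>j<d. (v j)\<^sup>2)" for v :: "nat \<Rightarrow> real" by (simp add: L2_set_def sum_nonneg)
  have *: "integrable M (\<lambda>\<omega>. (\<Sum>i\<in>J. \<epsilon> i \<omega> * x i \<omega> j)\<^sup>2) \<and>
      expectation (\<lambda>\<omega>. (\<Sum>i\<in>J. \<epsilon> i \<omega> * x i \<omega> j)\<^sup>2) = card J * \<sigma>\<^sup>2 * (\<integral>x. (x j)\<^sup>2 \<partial>P)" if j: "j < d" for j
  proof -
    have "indep_vars (\<lambda>_. borel) (\<lambda>i \<omega>. (\<lambda>p. snd p * fst p j) (coords d (X i \<omega>), \<epsilon> i \<omega>)) J"
      by (rule indep_pair_functions[OF _ J]) (intro borel_measurable_times borel_measurable_const fst_coord_measurable measurable_snd j)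
    then have iv: "indep_vars (\<lambda>_. borel) (\<lambda>i \<omega>. \<epsilon> i \<omega> * x i \<omega> j) J" by (simp add: coords_nth j)
    have m2: "integrable M (\<lambda>\<omega>. (\<epsilon> i \<omega> * x i \<omega> j)\<^sup>2)"
      "expectation (\<lambda>\<omega>. (\<epsilon> i \<omega> * x i \<omega> j)\<^sup>2) = \<sigma>\<^sup>2 * (\<integral>x. (x j)\<^sup>2 \<partial>P)"
      "expectation (\<lambda>\<omega>. \<epsilon> i \<omega> * x i \<omega> j) = 0" if "i \<in> J" for i
    proof -
      have i: "i < n" using J that by auto
      have eq: "(\<epsilon> i \<omega> * x i \<omega> j)\<^sup>2 = (coords d (X i \<omega>) j)\<^sup>2 * (\<epsilon> i \<omega>)\<^sup>2"
        "\<epsilon> i \<omega> * x i \<omega> j = coords d (X i \<omega>) j * \<epsilon> i \<omega>" for \<omega>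
        by (simp_all add: coords_nth j power_mult_distrib mult.commute)
      have ms: "(\<lambda>x. (x j)\<^sup>2) \<in> borel_measurable (RV d)" "(\<lambda>x. x j) \<in> borel_measurable (RV d)"
        by (intro borel_measurable_power coord_measurable j)+
      note PM = P_moments(1-3)[OF j j]
      have Qm: "(\<lambda>x :: real. x\<^sup>2) \<in> borel_measurable borel" "(\<lambda>x :: real. x) \<in> borel_measurable borel" by auto
      show "integrable M (\<lambda>\<omega>. (\<epsilon> i \<omega> * x i \<omega> j)\<^sup>2)"
        unfolding eq(1) by (rule product_moment(1)[OF i ms(1) Qm(1) PM(3) Q_moments(1)])
      show "expectation (\<lambda>\<omega>. (\<epsilon> i \<omega> * x i \<omega> j)\<^sup>2) = \<sigma>\<^sup>2 * (\<integral>x. (x j)\<^sup>2 \<partial>P)"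
        unfolding eq(1) product_moment(2)[OF i ms(1) Qm(1) PM(3) Q_moments(1)] Q_moments(2) by (rule mult.commute)
      show "expectation (\<lambda>\<omega>. \<epsilon> i \<omega> * x i \<omega> j) = 0"
        unfolding eq(2) product_moment(2)[OF i ms(2) Qm(2) PM(1) Q_moments(3)] PM(2) by simp
    qed
    show ?thesis using second_moment_indep_sum[OF fin iv] m2 by simp
  qed
  show "integrable M (\<lambda>\<omega>. (nrm d (\<lambda>j. \<Sum>i\<in>J. \<epsilon> i \<omega> * x i \<omega> j))\<^sup>2)"
    unfolding sq using * by (intro Bochner_Integration.integrable_sum) auto
  have "expectation (\<lambda>\<omega>. (nrm d (\<lambda>j. \<Sum>i\<in>J. \<epsilon> i \<omega> * x i \<omega> j))\<^sup>2) = card J * \<sigma>\<^sup>2 * (\<Sum>j<d. \<integral>x. (x j)\<^sup>2 \<partial>P)"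
    unfolding sq using * by (simp add: Bochner_Integration.integral_sum sum_distrib_left)
  also have "\<dots> \<le> card J * \<sigma>\<^sup>2 * \<tau>" by (intro mult_left_mono trace_le) auto
  finally show "expectation (\<lambda>\<omega>. (nrm d (\<lambda>j. \<Sum>i\<in>J. \<epsilon> i \<omega> * x i \<omega> j))\<^sup>2) \<le> card J * \<sigma>\<^sup>2 * \<tau>" .
qed

text \<open>Frobenius distance of the Gram matrix of the rows in \<open>J\<close> from
  \<open>card J\<close> times the covariance. Centring inside the sum exhibits each entry as a sum
  of independent mean-zero terms.\<close>

definition gram_error :: "nat set \<Rightarrow> 'a \<Rightarrow> real" where
  "gram_error J \<omega> = L2_set (\<lambda>(j, k). \<Sum>i\<in>J. x i \<omega> j * x i \<omega> k - Sig j k) ({..<d} \<times> {..<d})"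

lemma second_moment_gram_error:
  assumes J: "J \<subseteq> {..<n}"
  shows "integrable M (\<lambda>\<omega>. (gram_error J \<omega>)\<^sup>2)"
    and "expectation (\<lambda>\<omega>. (gram_error J \<omega>)\<^sup>2) \<le> card J * \<tau>\<^sup>2"
proof -
  have fin: "finite J" using J finite_subset by blast
  have sq: "(gram_error J \<omega>)\<^sup>2 = (\<Sum>j<d. \<Sum>k<d. (\<Sum>i\<in>J. x i \<omega> j * x i \<omega> k - Sig j k)\<^sup>2)" for \<omega>
    by (simp add: gram_error_def L2_set_def sum_nonneg sum.cartesian_product split_def)
  have *: "integrable M (\<lambda>\<omega>. (\<Sum>i\<in>J. x i \<omega> j * x i \<omega> k - Sig j k)\<^sup>2) \<and>
      expectation (\<lambda>\<omega>. (\<Sum>i\<in>J. x i \<omega> j * x i \<omega> k - Sig j k)\<^sup>2)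
        \<le> card J * (sqrt (\<integral>x. x j ^ 4 \<partial>P) * sqrt (\<integral>x. x k ^ 4 \<partial>P))" if j: "j < d" and k: "k < d" for j k
  proof -
    have "indep_vars (\<lambda>_. borel) (\<lambda>i \<omega>. (\<lambda>p. fst p j * fst p k - Sig j k) (coords d (X i \<omega>), \<epsilon> i \<omega>)) J"
      by (rule indep_pair_functions[OF _ J]) (intro borel_measurable_diff borel_measurable_times borel_measurable_const fst_coord_measurable j k)
    then have iv: "indep_vars (\<lambda>_. borel) (\<lambda>i \<omega>. x i \<omega> j * x i \<omega> k - Sig j k) J" by (simp add: coords_nth j k)
    have m2: "integrable M (\<lambda>\<omega>. (x i \<omega> j * x i \<omega> k - Sig j k)\<^sup>2)"
      "expectation (\<lambda>\<omega>. (x i \<omega> j * x i \<omega> k - Sig j k)\<^sup>2) \<le> sqrt (\<integral>x. x j ^ 4 \<partial>P) * sqrt (\<integral>x. x k ^ 4 \<partial>P)"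
      "expectation (\<lambda>\<omega>. x i \<omega> j * x i \<omega> k - Sig j k) = 0" if "i \<in> J" for i
    proof -
      have i: "i < n" using J that by auto
      have eq: "(y * z - Sig j k)\<^sup>2 = y\<^sup>2 * z\<^sup>2 - 2 * Sig j k * (y * z) + (Sig j k)\<^sup>2" for y z
        by (simp add: power2_eq_square algebra_simps)
      note PM = P_moments[OF j k]
      have ms: "(\<lambda>x. (x j * x k - Sig j k)\<^sup>2) \<in> borel_measurable (RV d)" "(\<lambda>x. x j * x k - Sig j k) \<in> borel_measurable (RV d)"
        by (intro borel_measurable_power borel_measurable_diff borel_measurable_times borel_measurable_const coord_measurable j k)+
      have "integrable P (\<lambda>x. (x j * x k - Sig j k)\<^sup>2)" unfolding eq using PM by simp
      then show "integrable M (\<lambda>\<omega>. (x i \<omega> j * x i \<omega> k - Sig j k)\<^sup>2)"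
        using design_moment(1)[OF i ms(1)] by (simp add: coords_nth j k)
      have "(\<integral>x. (x j * x k - Sig j k)\<^sup>2 \<partial>P) = (\<integral>x. (x j)\<^sup>2 * (x k)\<^sup>2 \<partial>P) - (Sig j k)\<^sup>2"
        unfolding eq using PM by (simp add: P.prob_space power2_eq_square)
      also have "\<dots> \<le> (\<integral>x. (x j)\<^sup>2 * (x k)\<^sup>2 \<partial>P)" by simp
      also note PM(7)
      finally show "expectation (\<lambda>\<omega>. (x i \<omega> j * x i \<omega> k - Sig j k)\<^sup>2) \<le> sqrt (\<integral>x. x j ^ 4 \<partial>P) * sqrt (\<integral>x. x k ^ 4 \<partial>P)"
        using design_moment(2)[OF i ms(1)] by (simp add: coords_nth j k)
      have "(\<integral>x. x j * x k - Sig j k \<partial>P) = 0" using PM by (simp add: P.prob_space)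
      then show "expectation (\<lambda>\<omega>. x i \<omega> j * x i \<omega> k - Sig j k) = 0"
        using design_moment(2)[OF i ms(2)] by (simp add: coords_nth j k)
    qed
    have "(\<Sum>i\<in>J. expectation (\<lambda>\<omega>. (x i \<omega> j * x i \<omega> k - Sig j k)\<^sup>2))
        \<le> card J * (sqrt (\<integral>x. x j ^ 4 \<partial>P) * sqrt (\<integral>x. x k ^ 4 \<partial>P))"
      using m2(2) by (intro sum_bounded_above[THEN order_trans]) auto
    then show ?thesis using second_moment_indep_sum[OF fin iv] m2 by simp
  qed
  show "integrable M (\<lambda>\<omega>. (gram_error J \<omega>)\<^sup>2)"
    unfolding sq using * by (intro Bochner_Integration.integrable_sum) auto
  have "expectation (\<lambda>\<omega>. (gram_error J \<omega>)\<^sup>2) =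
      (\<Sum>j<d. \<Sum>k<d. expectation (\<lambda>\<omega>. (\<Sum>i\<in>J. x i \<omega> j * x i \<omega> k - Sig j k)\<^sup>2))"
    unfolding sq using * by (intro integral_double_sum) auto
  also have "\<dots> \<le> (\<Sum>j<d. \<Sum>k<d. card J * (sqrt (\<integral>x. x j ^ 4 \<partial>P) * sqrt (\<integral>x. x k ^ 4 \<partial>P)))"
    using * by (intro sum_mono) auto
  also have "\<dots> = card J * \<tau>\<^sup>2"
    by (simp add: \<tau>_def power2_eq_square sum_product sum_distrib_left mult_ac)
  finally show "expectation (\<lambda>\<omega>. (gram_error J \<omega>)\<^sup>2) \<le> card J * \<tau>\<^sup>2" .
qed

text \<open>Fourth moments pay for the union bound over n rows: at t^2 = n / d the total is of order
  d^4 / n.\<close>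

lemma prob_large_row:
  assumes "t > 0"
  shows "prob {\<omega> \<in> space M. \<exists>i<n. nrm d (x i \<omega>) > t} \<le> n * (\<tau>\<^sup>2 / t ^ 4)"
proof -
  have nm: "(\<lambda>\<omega>. nrm d (x i \<omega>)) \<in> borel_measurable M" if "i < n" for i
    unfolding L2_set_def using x_measurable[OF that] by measurable
  have "prob {\<omega> \<in> space M. nrm d (x i \<omega>) > t} \<le> \<tau>\<^sup>2 / t ^ 4" if i: "i < n" for i
  proof -
    have ms: "(\<lambda>x. (nrm d x) ^ 4) \<in> borel_measurable (RV d)" unfolding L2_set_def by measurable
    have e: "expectation (\<lambda>\<omega>. (nrm d (x i \<omega>) ^ 2)\<^sup>2) \<le> \<tau>\<^sup>2"
      using design_moment(2)[OF i ms] fourth_moment_le(2) by (simp add: nrm_coords)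
    have int: "integrable M (\<lambda>\<omega>. (nrm d (x i \<omega>) ^ 2)\<^sup>2)"
      using design_moment(1)[OF i ms] fourth_moment_le(1) by (simp add: nrm_coords)
    have "prob {\<omega> \<in> space M. nrm d (x i \<omega>) > t} = prob {\<omega> \<in> space M. \<bar>(nrm d (x i \<omega>))\<^sup>2\<bar> > t\<^sup>2}"
      using \<open>t > 0\<close> power_mono_iff[of "nrm d (x i _)" t 2] by (simp add: not_le[symmetric])
    also have "\<dots> \<le> \<tau>\<^sup>2 / (t\<^sup>2)\<^sup>2"
      using \<open>t > 0\<close> nm[OF i] by (intro prob_gt_le_second_moment[OF int e]) auto
    finally show ?thesis by simp
  qed
  moreover have "{\<omega> \<in> space M. \<exists>i<n. nrm d (x i \<omega>) > t} = (\<Union>i<n. {\<omega> \<in> space M. nrm d (x i \<omega>) > t})" by auto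
  moreover have "prob (\<Union>i<n. {\<omega> \<in> space M. nrm d (x i \<omega>) > t}) \<le> (\<Sum>i<n. prob {\<omega> \<in> space M. nrm d (x i \<omega>) > t})"
    using nm by (intro finite_measure_subadditive_finite) auto
  ultimately show ?thesis
    using sum_bounded_above[of "{..<n}" "\<lambda>i. prob {\<omega> \<in> space M. nrm d (x i \<omega>) > t}" "\<tau>\<^sup>2 / t ^ 4"] by simp
qed

end

section \<open>Characteristic functions of linear statistics\<close>

lemma exp_minus_bounds:
  fixes y :: real assumes "y \<ge> 0"
  shows "\<bar>exp (- y) - (1 - y)\<bar> \<le> y\<^sup>2"
proof -
  have "exp (- y) \<ge> 1 - y" using exp_ge_add_one_self[of "- y"] by simp
  moreover have "exp (- y) \<le> 1 - y + y\<^sup>2"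
  proof -
    have "exp (- y) = 1 / exp y" by (simp add: exp_minus inverse_eq_divide)
    also have "\<dots> \<le> 1 / (1 + y)" using exp_ge_add_one_self[of y] assms by (intro divide_left_mono) auto
    also have "\<dots> \<le> 1 - y + y\<^sup>2"
    proof -
      have "1 \<le> (1 - y + y\<^sup>2) * (1 + y)" using assms by (simp add: algebra_simps power2_eq_square)
      then show ?thesis using assms by (simp add: pos_divide_le_eq)
    qed
    finally show ?thesis .
  qed
  ultimately show ?thesis by (simp add: abs_le_iff)
qed

context regression_sample
begin

lemma ip_measurable: "(\<lambda>x. ip d u x) \<in> borel_measurable (RV d)"
  unfolding ip_def by (intro borel_measurable_sum borel_measurable_times borel_measurable_const coord_measurable) auto

lemma ip_coords: "ip d u (coords d (X i \<omega>)) = ip d u (x i \<omega>)"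
  by (simp add: ip_def coords_nth)

lemma bil_Sig:
  "integrable P (\<lambda>x. (ip d u x)\<^sup>2)" "(\<integral>x. (ip d u x)\<^sup>2 \<partial>P) = bil d Sig u u"
  "integrable P (\<lambda>x. ip d u x)" "(\<integral>x. ip d u x \<partial>P) = 0"
proof -
  have eq: "(ip d u x)\<^sup>2 = (\<Sum>j<d. \<Sum>k<d. u j * u k * (x j * x k))" for x :: "nat \<Rightarrow> real"
    by (simp add: ip_def power2_eq_square sum_product mult_ac)
  have int: "integrable P (\<lambda>x. u j * u k * (x j * x k))" if "j < d" "k < d" for j k
    using P_moments(4)[OF that] by simp
  show "integrable P (\<lambda>x. (ip d u x)\<^sup>2)"
    unfolding eq using int by (intro Bochner_Integration.integrable_sum) auto
  have "(\<integral>x. (ip d u x)\<^sup>2 \<partial>P) = (\<Sum>j<d. \<Sum>k<d. \<integral>x. u j * u k * (x j * x k) \<partial>P)"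
    unfolding eq using int by (rule integral_double_sum)
  also have "\<dots> = bil d Sig u u"
    unfolding bil_def
  proof (intro sum.cong refl)
    fix j k assume "j \<in> {..<d}" "k \<in> {..<d}"
    then show "(\<integral>x. u j * u k * (x j * x k) \<partial>P) = u j * Sig j k * u k"
      using P_moments(5)[of j k] by (subst integral_mult_right_zero) auto
  qed
  finally show "(\<integral>x. (ip d u x)\<^sup>2 \<partial>P) = bil d Sig u u" .
  have i1: "integrable P (\<lambda>x. u j * x j)" "(\<integral>x. u j * x j \<partial>P) = 0" if "j < d" for j
    using P_moments(1,2)[OF that that] by auto
  show "integrable P (\<lambda>x. ip d u x)"
    unfolding ip_def using i1 by (intro Bochner_Integration.integrable_sum) auto
  have "(\<integral>x. ip d u x \<partial>P) = (\<Sum>j<d. \<integral>x. u j * x j \<partial>P)"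
    unfolding ip_def using i1 by (intro Bochner_Integration.integral_sum) auto
  also have "\<dots> = 0" using i1 by (intro sum.neutral) auto
  finally show "(\<integral>x. ip d u x \<partial>P) = 0" .
qed

lemma bil_Sig_nonneg: "0 \<le> bil d Sig u u"
  unfolding bil_Sig(2)[symmetric] by (rule Bochner_Integration.integral_nonneg) simp

text \<open>Cauchy-Schwarz ignores the direction of \<open>u\<close> and costs a factor of order
  d^2. The truncation at \<open>T\<close> absorbs it later, since d^2 / sqrt n tends to 0.\<close>

lemma ip_fourth_moment:
  "integrable P (\<lambda>x. (ip d u x) ^ 4)" "(\<integral>x. (ip d u x) ^ 4 \<partial>P) \<le> nrm d u ^ 4 * \<tau>\<^sup>2"
proof -
  have le: "(ip d u x) ^ 4 \<le> nrm d u ^ 4 * nrm d x ^ 4" for x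
  proof -
    have "(ip d u x) ^ 4 = \<bar>ip d u x\<bar> ^ 4" by simp
    also have "\<dots> \<le> (nrm d u * nrm d x) ^ 4" by (intro power_mono abs_ip_le) simp
    finally show ?thesis by (simp add: power_mult_distrib)
  qed
  have int: "integrable P (\<lambda>x. nrm d u ^ 4 * nrm d x ^ 4)" using fourth_moment_le(1) by simp
  have m: "(\<lambda>x. (ip d u x) ^ 4) \<in> borel_measurable P"
    using ip_measurable[of u] by (simp add: measurable_cong_sets[OF sets_P refl])
  show i: "integrable P (\<lambda>x. (ip d u x) ^ 4)"
    by (rule Bochner_Integration.integrable_bound[OF int m]) (use le in simp)
  have "(\<integral>x. (ip d u x) ^ 4 \<partial>P) \<le> (\<integral>x. nrm d u ^ 4 * nrm d x ^ 4 \<partial>P)"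
    by (rule integral_mono[OF i int le])
  also have "\<dots> \<le> nrm d u ^ 4 * \<tau>\<^sup>2" using fourth_moment_le(2) by (simp add: mult_left_mono)
  finally show "(\<integral>x. (ip d u x) ^ 4 \<partial>P) \<le> nrm d u ^ 4 * \<tau>\<^sup>2" .
qed

text \<open>With \<open>u\<close> a row of \<open>A * inv_mat (cov_mat d P)\<close> and a = sqrt n /
  (n - s1) this is the leading term of one coordinate of the normalized estimation error.\<close>

definition lin_stat :: "nat set \<Rightarrow> real \<Rightarrow> (nat \<Rightarrow> real) \<Rightarrow> 'a \<Rightarrow> real" where
  "lin_stat J a u \<omega> = (\<Sum>i\<in>J. a * (ip d u (x i \<omega>) * \<epsilon> i \<omega>))"

lemma lin_stat_term:
  assumes "i < n"
  shows "(\<lambda>\<omega>. a * (ip d u (x i \<omega>) * \<epsilon> i \<omega>)) \<in> borel_measurable M"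
    and "integrable M (\<lambda>\<omega>. (a * (ip d u (x i \<omega>) * \<epsilon> i \<omega>))\<^sup>2)"
    and "expectation (\<lambda>\<omega>. (a * (ip d u (x i \<omega>) * \<epsilon> i \<omega>))\<^sup>2) = a\<^sup>2 * \<sigma>\<^sup>2 * bil d Sig u u"
    and "expectation (\<lambda>\<omega>. a * (ip d u (x i \<omega>) * \<epsilon> i \<omega>)) = 0"
proof -
  have m: "(\<lambda>x. (ip d u x)\<^sup>2) \<in> borel_measurable (RV d)" using ip_measurable by simp
  have Qm: "(\<lambda>x :: real. x\<^sup>2) \<in> borel_measurable borel" "(\<lambda>x :: real. x) \<in> borel_measurable borel" by auto
  have "(\<lambda>\<omega>. ip d u (coords d (X i \<omega>))) \<in> borel_measurable M"
    by (rule measurable_compose[OF coords_measurable[OF assms] ip_measurable])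
  then show "(\<lambda>\<omega>. a * (ip d u (x i \<omega>) * \<epsilon> i \<omega>)) \<in> borel_measurable M"
    using eps_measurable[OF assms] by (simp add: ip_coords)
  have eq: "(a * (ip d u (x i \<omega>) * \<epsilon> i \<omega>))\<^sup>2 = a\<^sup>2 * ((ip d u (coords d (X i \<omega>)))\<^sup>2 * (\<epsilon> i \<omega>)\<^sup>2)" for \<omega>
    by (simp add: ip_coords power_mult_distrib)
  note p2 = product_moment[OF assms m Qm(1) bil_Sig(1) Q_moments(1)]
  note p1 = product_moment[OF assms ip_measurable Qm(2) bil_Sig(3) Q_moments(3), of u]
  show "integrable M (\<lambda>\<omega>. (a * (ip d u (x i \<omega>) * \<epsilon> i \<omega>))\<^sup>2)"
    unfolding eq by (rule integrable_mult_right) (rule p2(1))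
  show "expectation (\<lambda>\<omega>. (a * (ip d u (x i \<omega>) * \<epsilon> i \<omega>))\<^sup>2) = a\<^sup>2 * \<sigma>\<^sup>2 * bil d Sig u u"
    unfolding eq using p2 by (simp add: bil_Sig Q_moments)
  show "expectation (\<lambda>\<omega>. a * (ip d u (x i \<omega>) * \<epsilon> i \<omega>)) = 0"
    using p1 by (simp add: bil_Sig Q_moments ip_coords)
qed

lemma lin_stat_indep:
  assumes "J \<subseteq> {..<n}"
  shows "indep_vars (\<lambda>_. borel) (\<lambda>i \<omega>. a * (ip d u (x i \<omega>) * \<epsilon> i \<omega>)) J"
proof -
  have "indep_vars (\<lambda>_. borel) (\<lambda>i \<omega>. (\<lambda>p. a * (ip d u (fst p) * snd p)) (coords d (X i \<omega>), \<epsilon> i \<omega>)) J"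
    by (rule indep_pair_functions[OF _ assms])
      (intro borel_measurable_times borel_measurable_const measurable_snd measurable_compose[OF measurable_fst ip_measurable])
  then show ?thesis by (simp add: ip_coords)
qed

lemma lin_stat_measurable: "J \<subseteq> {..<n} \<Longrightarrow> lin_stat J a u \<in> borel_measurable M"
  unfolding lin_stat_def[abs_def] by (intro borel_measurable_sum lin_stat_term(1)) auto

lemma lin_stat_second_moment:
  assumes "J \<subseteq> {..<n}"
  shows "integrable M (\<lambda>\<omega>. (lin_stat J a u \<omega>)\<^sup>2)"
    "expectation (\<lambda>\<omega>. (lin_stat J a u \<omega>)\<^sup>2) = card J * (a\<^sup>2 * \<sigma>\<^sup>2 * bil d Sig u u)"
proof -
  have "finite J" using assms finite_subset by blast
  from second_moment_indep_sum[OF this lin_stat_indep[OF assms]] assms lin_stat_term(2-4)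
  have "integrable M (\<lambda>\<omega>. (\<Sum>i\<in>J. a * (ip d u (x i \<omega>) * \<epsilon> i \<omega>))\<^sup>2) \<and>
    expectation (\<lambda>\<omega>. (\<Sum>i\<in>J. a * (ip d u (x i \<omega>) * \<epsilon> i \<omega>))\<^sup>2) = (\<Sum>i\<in>J. a\<^sup>2 * \<sigma>\<^sup>2 * bil d Sig u u)"
    by (auto simp: subset_iff)
  then show "integrable M (\<lambda>\<omega>. (lin_stat J a u \<omega>)\<^sup>2)"
    "expectation (\<lambda>\<omega>. (lin_stat J a u \<omega>)\<^sup>2) = card J * (a\<^sup>2 * \<sigma>\<^sup>2 * bil d Sig u u)"
    by (simp_all add: lin_stat_def)
qed

text \<open>Bound for E min (6 \<eta>^2, |\<eta>|^3) of one summand \<eta>. Its three parts belong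
  to the cases where both factors stay below their levels, where the design factor exceeds
  \<open>T\<close>, and where the noise exceeds \<open>T'\<close>.\<close>

definition lindeberg :: "real \<Rightarrow> real \<Rightarrow> real \<Rightarrow> (nat \<Rightarrow> real) \<Rightarrow> real" where
  "lindeberg a T T' u = a\<^sup>2 * (a * T * T' * \<sigma>\<^sup>2 * bil d Sig u u + 6 * \<sigma>\<^sup>2 * (nrm d u ^ 4 * \<tau>\<^sup>2) / T\<^sup>2
      + 6 * bil d Sig u u * (\<integral>x. x\<^sup>2 * indicator {x. \<bar>x\<bar> > T'} x \<partial>Q))"

text \<open>The truncation levels \<open>T\<close> and \<open>T'\<close> act on the design and on the noise separately: the
  fourth moment of the design controls the former, while the latter only uses \<open>E \<epsilon>\<^sup>2 < \<infinity>\<close>.\<close>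

lemma char_term_bound:
  fixes u :: "nat \<Rightarrow> real" and a T T' v :: real
  assumes i: "i < n" and a: "a \<ge> 0" and T: "T > 0" "T' > 0"
  defines "v \<equiv> a\<^sup>2 * \<sigma>\<^sup>2 * bil d Sig u u"
  shows "cmod (char (distr M borel (\<lambda>\<omega>. a * (ip d u (x i \<omega>) * \<epsilon> i \<omega>))) 1 - complex_of_real (exp (- v / 2)))
    \<le> lindeberg a T T' u / 6 + v\<^sup>2 / 4"
proof -
  define \<eta> where "\<eta> \<omega> = a * (ip d u (x i \<omega>) * \<epsilon> i \<omega>)" for \<omega>
  note trm = lin_stat_term[OF i, of a u, folded \<eta>_def]
  have \<eta>_int: "integrable M \<eta>" by (rule square_integrable_imp_integrable[OF trm(1,2)])
  have var: "variance \<eta> = v" using trm(3,4) by (simp add: v_def)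
  \<comment> \<open>Evaluation at 1 is enough, because all scaling and the direction of the test
    vector sit inside \<open>a\<close> and \<open>u\<close>.\<close>
  have c1: "cmod (char (distr M borel \<eta>) 1 - (1 - 1\<^sup>2 * v / 2)) \<le> (1\<^sup>2 / 6) * expectation (\<lambda>\<omega>. min (6 * (\<eta> \<omega>)\<^sup>2) (\<bar>1\<bar> * \<bar>\<eta> \<omega>\<bar> ^ 3))"
    by (rule char_approx3'[OF trm(1) \<eta>_int trm(2) trm(4) var refl])
  let ?I = "\<lambda>x :: real. x\<^sup>2 * indicator {x. \<bar>x\<bar> > T'} x"
  let ?Z = "\<lambda>\<omega>. coords d (X i \<omega>)"
  have Qs: "sets Q = sets borel" using noise by (simp add: noise_law_def)
  have Im: "?I \<in> borel_measurable borel" by measurable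
  have Qm: "(\<lambda>x :: real. x\<^sup>2) \<in> borel_measurable borel" by auto
  have Iint: "integrable Q ?I"
    by (rule Bochner_Integration.integrable_bound[OF Q_moments(1)])
      (auto simp: measurable_cong_sets[OF Qs refl] split: split_indicator)
  have m2: "(\<lambda>x. (ip d u x)\<^sup>2) \<in> borel_measurable (RV d)" and m4: "(\<lambda>x. (ip d u x) ^ 4) \<in> borel_measurable (RV d)"
    using ip_measurable by simp_all
  note p22 = product_moment[OF i m2 Qm bil_Sig(1) Q_moments(1)]
  note p42 = product_moment[OF i m4 Qm ip_fourth_moment(1) Q_moments(1)]
  note p2I = product_moment[OF i m2 Im bil_Sig(1) Iint]
  define R where "R \<omega> = (a * T * T') * (a\<^sup>2 * ((ip d u (?Z \<omega>))\<^sup>2 * (\<epsilon> i \<omega>)\<^sup>2))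
      + (6 * a\<^sup>2 / T\<^sup>2) * ((ip d u (?Z \<omega>)) ^ 4 * (\<epsilon> i \<omega>)\<^sup>2) + (6 * a\<^sup>2) * ((ip d u (?Z \<omega>))\<^sup>2 * ?I (\<epsilon> i \<omega>))" for \<omega>
  have R_int: "integrable M R"
    unfolding R_def[abs_def] by (intro Bochner_Integration.integrable_add integrable_mult_right p22 p42 p2I)
  have pt: "min (6 * (\<eta> \<omega>)\<^sup>2) (\<bar>\<eta> \<omega>\<bar> ^ 3) \<le> R \<omega>" for \<omega>
  proof -
    let ?s = "ip d u (?Z \<omega>)" and ?e = "\<epsilon> i \<omega>"
    have \<eta>: "\<eta> \<omega> = a * (?s * ?e)" by (simp add: \<eta>_def ip_coords)
    have nn: "0 \<le> (a * T * T') * (a\<^sup>2 * (?s\<^sup>2 * ?e\<^sup>2))" "0 \<le> (6 * a\<^sup>2 / T\<^sup>2) * (?s ^ 4 * ?e\<^sup>2)" "0 \<le> (6 * a\<^sup>2) * (?s\<^sup>2 * ?I ?e)"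
      using a T by (auto intro!: mult_nonneg_nonneg)
    consider "\<bar>?e\<bar> > T'" | "\<bar>?s\<bar> > T" | "\<bar>?s\<bar> \<le> T" "\<bar>?e\<bar> \<le> T'" by linarith
    then show ?thesis
    proof cases
      case 1
      then have "6 * (\<eta> \<omega>)\<^sup>2 = (6 * a\<^sup>2) * (?s\<^sup>2 * ?I ?e)" by (simp add: \<eta> power_mult_distrib)
      then show ?thesis using nn unfolding R_def by linarith
    next
      case 2
      then have "T\<^sup>2 \<le> ?s\<^sup>2" using T by (simp add: abs_le_square_iff[symmetric])
      then have "1 \<le> ?s\<^sup>2 / T\<^sup>2" using T by simp
      \<comment> \<open>The factor s^2 / T^2 \<ge> 1 is inserted to trade the truncated second
        moment for the fourth moment of the design factor.\<close>
      then have "6 * (\<eta> \<omega>)\<^sup>2 * 1 \<le> 6 * (\<eta> \<omega>)\<^sup>2 * (?s\<^sup>2 / T\<^sup>2)" by (intro mult_left_mono) auto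
      also have "\<dots> = (6 * a\<^sup>2 / T\<^sup>2) * (?s ^ 4 * ?e\<^sup>2)"
        by (simp add: \<eta> power_mult_distrib power4_eq_xxxx power2_eq_square)
      finally show ?thesis using nn unfolding R_def by linarith
    next
      case 3
      have "\<bar>\<eta> \<omega>\<bar> = a * (\<bar>?s\<bar> * \<bar>?e\<bar>)" using a by (simp add: \<eta> abs_mult)
      also have "\<dots> \<le> a * (T * T')" using 3 a T by (intro mult_left_mono mult_mono) auto
      finally have "\<bar>\<eta> \<omega>\<bar> * (\<eta> \<omega>)\<^sup>2 \<le> (a * (T * T')) * (\<eta> \<omega>)\<^sup>2" by (rule mult_right_mono) simp
      moreover have "\<bar>\<eta> \<omega>\<bar> ^ 3 = \<bar>\<eta> \<omega>\<bar> * (\<eta> \<omega>)\<^sup>2" by (simp add: power3_eq_cube power2_eq_square)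
      ultimately have "\<bar>\<eta> \<omega>\<bar> ^ 3 \<le> (a * T * T') * (a\<^sup>2 * (?s\<^sup>2 * ?e\<^sup>2))" by (simp add: \<eta> power_mult_distrib mult.assoc)
      then show ?thesis using nn unfolding R_def by linarith
    qed
  qed
  have min_int: "integrable M (\<lambda>\<omega>. min (6 * (\<eta> \<omega>)\<^sup>2) (\<bar>\<eta> \<omega>\<bar> ^ 3))"
  proof (rule Bochner_Integration.integrable_bound[OF integrable_mult_right[OF trm(2), of 6]])
    show "(\<lambda>\<omega>. min (6 * (\<eta> \<omega>)\<^sup>2) (\<bar>\<eta> \<omega>\<bar> ^ 3)) \<in> borel_measurable M"
      using trm(1) by measurable
  qed auto
  have "expectation (\<lambda>\<omega>. min (6 * (\<eta> \<omega>)\<^sup>2) (\<bar>\<eta> \<omega>\<bar> ^ 3)) \<le> expectation R"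
    by (rule integral_mono[OF min_int R_int pt])
  also have "expectation R = (a * T * T') * (a\<^sup>2 * (bil d Sig u u * \<sigma>\<^sup>2))
      + (6 * a\<^sup>2 / T\<^sup>2) * ((\<integral>x. (ip d u x) ^ 4 \<partial>P) * \<sigma>\<^sup>2) + (6 * a\<^sup>2) * (bil d Sig u u * (\<integral>x. ?I x \<partial>Q))"
    unfolding R_def
    by (subst Bochner_Integration.integral_add Bochner_Integration.integral_add, (intro Bochner_Integration.integrable_add integrable_mult_right p22 p42 p2I)+)+
      (simp add: p22(2) p42(2) p2I(2) bil_Sig Q_moments)
  also have "\<dots> \<le> (a * T * T') * (a\<^sup>2 * (bil d Sig u u * \<sigma>\<^sup>2))
      + (6 * a\<^sup>2 / T\<^sup>2) * ((nrm d u ^ 4 * \<tau>\<^sup>2) * \<sigma>\<^sup>2) + (6 * a\<^sup>2) * (bil d Sig u u * (\<integral>x. ?I x \<partial>Q))"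
    using ip_fourth_moment(2)[of u] by (intro add_mono mult_left_mono mult_right_mono order_refl) auto
  also have "\<dots> = lindeberg a T T' u" by (simp add: lindeberg_def field_simps)
  finally have L: "expectation (\<lambda>\<omega>. min (6 * (\<eta> \<omega>)\<^sup>2) (\<bar>\<eta> \<omega>\<bar> ^ 3)) \<le> lindeberg a T T' u" .
  have "v \<ge> 0" unfolding v_def using bil_Sig_nonneg by simp
  then have e: "\<bar>exp (- (v / 2)) - (1 - v / 2)\<bar> \<le> (v / 2)\<^sup>2" by (intro exp_minus_bounds) simp
  have "cmod (complex_of_real (1 - v / 2) - complex_of_real (exp (- v / 2))) = \<bar>(1 - v / 2) - exp (- v / 2)\<bar>"
    unfolding of_real_diff[symmetric] norm_of_real ..
  then have c2: "cmod (complex_of_real (1 - v / 2) - complex_of_real (exp (- v / 2))) \<le> v\<^sup>2 / 4"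
    using e by (simp add: power_divide abs_minus_commute del: of_real_diff)
  have "cmod (char (distr M borel \<eta>) 1 - complex_of_real (exp (- v / 2))) \<le>
      cmod (char (distr M borel \<eta>) 1 - complex_of_real (1 - v / 2)) + cmod (complex_of_real (1 - v / 2) - complex_of_real (exp (- v / 2)))"
    by (rule norm_diff_triangle_le[OF order_refl order_refl])
  also have "\<dots> \<le> lindeberg a T T' u / 6 + v\<^sup>2 / 4"
    using c1 c2 L by simp
  finally show ?thesis by (simp add: \<eta>_def[abs_def])
qed

text \<open>Products of numbers in the unit disc differ by at most the sum of the differences of
  their factors. Comparing with exp (-v/2) rather than 1 - v/2 keeps the second factors in the disc
  for every v \<ge> 0.\<close>

lemma char_lin_stat:
  fixes u :: "nat \<Rightarrow> real" and a T T' v :: real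
  assumes J: "J \<subseteq> {..<n}" and a: "a \<ge> 0" and T: "T > 0" "T' > 0"
  defines "v \<equiv> a\<^sup>2 * \<sigma>\<^sup>2 * bil d Sig u u"
  shows "cmod (char (distr M borel (lin_stat J a u)) 1 - complex_of_real (exp (- (card J * v) / 2)))
    \<le> card J * (lindeberg a T T' u / 6 + v\<^sup>2 / 4)"
proof -
  have fin: "finite J" using J finite_subset by blast
  let ?\<phi> = "\<lambda>i. char (distr M borel (\<lambda>\<omega>. a * (ip d u (x i \<omega>) * \<epsilon> i \<omega>))) 1"
  have "v \<ge> 0" unfolding v_def using bil_Sig_nonneg by simp
  have "char (distr M borel (lin_stat J a u)) 1 = (\<Prod>i\<in>J. ?\<phi> i)"
    unfolding lin_stat_def[abs_def] by (rule char_distr_sum[OF lin_stat_indep[OF J]])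
  moreover have "complex_of_real (exp (- (card J * v) / 2)) = (\<Prod>i\<in>J. complex_of_real (exp (- v / 2)))"
    by (simp add: exp_of_nat_mult[symmetric] flip: of_real_power)
  ultimately have "cmod (char (distr M borel (lin_stat J a u)) 1 - complex_of_real (exp (- (card J * v) / 2))) =
      cmod ((\<Prod>i\<in>J. ?\<phi> i) - (\<Prod>i\<in>J. complex_of_real (exp (- v / 2))))" by simp
  also have "\<dots> \<le> (\<Sum>i\<in>J. cmod (?\<phi> i - complex_of_real (exp (- v / 2))))"
  proof (rule norm_prod_diff)
    fix i assume "i \<in> J"
    then have "(\<lambda>\<omega>. a * (ip d u (x i \<omega>) * \<epsilon> i \<omega>)) \<in> borel_measurable M" using J by (intro lin_stat_term(1)) auto
    then interpret D: real_distribution "distr M borel (\<lambda>\<omega>. a * (ip d u (x i \<omega>) * \<epsilon> i \<omega>))"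
      by (rule real_distribution_distr)
    show "cmod (?\<phi> i) \<le> 1" by (rule D.cmod_char_le_1)
    show "cmod (complex_of_real (exp (- v / 2))) \<le> 1" using \<open>v \<ge> 0\<close> by simp
  qed
  also have "\<dots> \<le> (\<Sum>i\<in>J. lindeberg a T T' u / 6 + v\<^sup>2 / 4)"
    using J char_term_bound[OF _ a T, of _ u] by (intro sum_mono) (auto simp: v_def subset_iff)
  finally show ?thesis by simp
qed

end

section \<open>The second step on the good event\<close>

context regression_sample
begin

lemma gram_bilinear:
  "\<bar>(\<Sum>i\<in>J. ip d (x i \<omega>) u * ip d (x i \<omega>) v) - card J * bil d Sig u v\<bar> \<le> nrm d u * gram_error J \<omega> * nrm d v"
proof -
  have "(\<Sum>i\<in>J. ip d (x i \<omega>) u * ip d (x i \<omega>) v) = (\<Sum>j<d. \<Sum>k<d. u j * (\<Sum>i\<in>J. x i \<omega> j * x i \<omega> k) * v k)"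
  proof -
    have "(\<Sum>i\<in>J. ip d (x i \<omega>) u * ip d (x i \<omega>) v) = (\<Sum>i\<in>J. \<Sum>j<d. \<Sum>k<d. u j * (x i \<omega> j * x i \<omega> k) * v k)"
      by (simp add: ip_def sum_product mult_ac)
    also have "\<dots> = (\<Sum>j<d. \<Sum>i\<in>J. \<Sum>k<d. u j * (x i \<omega> j * x i \<omega> k) * v k)" by (rule sum.swap)
    also have "\<dots> = (\<Sum>j<d. \<Sum>k<d. \<Sum>i\<in>J. u j * (x i \<omega> j * x i \<omega> k) * v k)" by (intro sum.cong refl sum.swap)
    finally show ?thesis by (simp add: sum_distrib_left sum_distrib_right)
  qed
  then have "(\<Sum>i\<in>J. ip d (x i \<omega>) u * ip d (x i \<omega>) v) - card J * bil d Sig u v =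
      (\<Sum>j<d. \<Sum>k<d. u j * (\<Sum>i\<in>J. x i \<omega> j * x i \<omega> k - Sig j k) * v k)"
    by (simp add: bil_def sum_subtractf sum_distrib_left algebra_simps)
  then show ?thesis unfolding gram_error_def by (simp only: bilinear_le_L2_set)
qed

lemma Sig_sym: "j < d \<Longrightarrow> k < d \<Longrightarrow> Sig j k = Sig k j"
  using P_moments(5)[of j k] P_moments(5)[of k j] by (simp add: mult.commute)

lemma sum_ip_rows: "(\<Sum>i\<in>J. a i * ip d (x i \<omega>) v) = ip d (\<lambda>j. \<Sum>i\<in>J. a i * x i \<omega> j) v"
proof -
  have "(\<Sum>i\<in>J. a i * ip d (x i \<omega>) v) = (\<Sum>i\<in>J. \<Sum>j<d. a i * x i \<omega> j * v j)"
    by (simp add: ip_def sum_distrib_left mult_ac)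
  also have "\<dots> = (\<Sum>j<d. \<Sum>i\<in>J. a i * x i \<omega> j * v j)" by (rule sum.swap)
  finally show ?thesis by (simp add: ip_def sum_distrib_right)
qed

lemma lin_stat_ip: "lin_stat J a u \<omega> = a * ip d (\<lambda>j. \<Sum>i\<in>J. \<epsilon> i \<omega> * x i \<omega> j) u"
  unfolding sum_ip_rows[symmetric] by (simp add: lin_stat_def sum_distrib_left ip_commute[of d u] mult_ac)

text \<open>A deterministic statement at one point of the good event. After exact selection the
  normal equations are tested against \<open>u\<close>; replacing the Gram matrix by m times the
  covariance costs m h |u| |D|, and the hypothesis on \<open>u\<close> turns the main term into the
  inner product of \<open>a\<close> with D. The right-hand side is the linear statistic plus the
  contribution of the \<open>s2\<close> small shifts. \<open>w1\<close>, \<open>w2\<close>,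
  \<open>w3\<close> bound the noise sum, the sign sum of the outliers and these shifts.\<close>

lemma two_step_error_bound:
  fixes lam \<theta> \<gamma> K c h w1 w2 w3 :: real and s1 s2 :: nat
  assumes \<omega>: "\<omega> \<in> space M"
    and \<mu>: "\<mu> \<in> carrier_vec n" and \<beta>: "\<beta> \<in> carrier_vec d" and s: "s1 + s2 \<le> n" "s1 < n"
    and lam: "lam > 0" and \<theta>: "0 < \<theta>" "\<theta> < 1" and \<gamma>: "0 < \<gamma>" "2 * \<gamma> \<le> (1 - \<theta>) * lam"
    and \<mu>1: "\<And>i. i < s1 \<Longrightarrow> \<bar>\<mu> $ i\<bar> \<ge> 8 * lam"
    and \<mu>2: "\<And>i. s1 \<le> i \<Longrightarrow> i < s1 + s2 \<Longrightarrow> \<bar>\<mu> $ i\<bar> \<le> \<gamma>"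
    and \<mu>3: "\<And>i. s1 + s2 \<le> i \<Longrightarrow> i < n \<Longrightarrow> \<mu> $ i = 0"
    and K: "K > 0" "\<And>i. i < n \<Longrightarrow> nrm d (x i \<omega>) \<le> K"
    and eps: "\<And>i. i < n \<Longrightarrow> \<bar>\<epsilon> i \<omega>\<bar> \<le> \<gamma>"
    and c: "c > 0" "\<And>v. c * (nrm d v)\<^sup>2 \<le> bil d Sig v v"
    and h: "gram_error {s1..<n} \<omega> \<le> real (n - s1) * h" "h \<le> c / 2"
    and w1: "nrm d (\<lambda>j. \<Sum>i\<in>{s1..<n}. \<epsilon> i \<omega> * x i \<omega> j) \<le> w1"
    and w2: "nrm d (\<lambda>j. \<Sum>i<s1. sgn (\<mu> $ i) * x i \<omega> j) \<le> w2"
    and w3: "real s2 * K * \<gamma> \<le> w3"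
    and small: "2 * (w1 + w3 + lam * w2) < real (n - s1) * c / 2 * (\<theta> * lam / (2 * K))"
    and mh: "mh \<in> carrier_vec n" and bh: "bh \<in> carrier_vec d" and bt: "bt \<in> carrier_vec d"
    and minimizer: "penalized_minimizer n d lam (design_mat n d X \<omega>) (response n \<mu> \<beta> X \<epsilon> \<omega>) mh bh"
    and ols: "ols_on (zero_set mh) (design_mat n d X \<omega>) (response n \<mu> \<beta> X \<epsilon> \<omega>) bt"
    and u: "\<And>k. k < d \<Longrightarrow> ip d (Sig k) u = a k"
  shows "\<bar>ip d a (\<lambda>j. bt $ j - \<beta> $ j) - lin_stat {s1..<n} (1 / real (n - s1)) u \<omega>\<bar>
    \<le> nrm d u * (h * (2 * (w1 + w3) / (real (n - s1) * c)) + w3 / real (n - s1))"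
proof -
  let ?J = "{s1..<n}" and ?m = "real (n - s1)"
  have m: "?m > 0" using s by simp
  have cardJ: "real (card ?J) = ?m" by simp
  define z where "z i = \<mu> $ i + \<epsilon> i \<omega>" for i
  \<comment> \<open>Over the selected rows the right-hand side of the normal equations splits into
    noise \<open>W\<close> and leftover shifts \<open>U\<close>.\<close>
  define W where "W = (\<lambda>j. \<Sum>i\<in>?J. \<epsilon> i \<omega> * x i \<omega> j)"
  define U where "U = (\<lambda>j. \<Sum>i\<in>?J. \<mu> $ i * x i \<omega> j)"
  have U: "nrm d U \<le> w3"
  proof -
    have eq: "U j = (\<Sum>i\<in>{s1..<s1 + s2}. \<mu> $ i * x i \<omega> j)" for j
      unfolding U_def using s \<mu>3 by (intro sum.mono_neutral_right) auto
    have "nrm d U \<le> (\<Sum>i\<in>{s1..<s1 + s2}. nrm d (\<lambda>j. \<mu> $ i * x i \<omega> j))"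
    proof -
      have "nrm d (\<lambda>j. \<Sum>i\<in>I. f i j) \<le> (\<Sum>i\<in>I. nrm d (f i))" if "finite I" for I :: "nat set" and f
        using that
      proof (induction I rule: finite_induct)
        case (insert i I)
        then show ?case using L2_set_triangle_ineq[of "f i" "\<lambda>j. \<Sum>i\<in>I. f i j" "{..<d}"] by simp
      qed (simp add: L2_set_def)
      from this[of "{s1..<s1 + s2}" "\<lambda>i j. \<mu> $ i * x i \<omega> j"] show ?thesis unfolding eq[abs_def] by simp
    qed
    also have "\<dots> \<le> (\<Sum>i\<in>{s1..<s1 + s2}. \<gamma> * K)"
    proof (intro sum_mono)
      fix i assume i: "i \<in> {s1..<s1 + s2}"
      have "nrm d (\<lambda>j. \<mu> $ i * x i \<omega> j) = \<bar>\<mu> $ i\<bar> * nrm d (x i \<omega>)"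
        by (simp add: L2_set_def power_mult_distrib sum_distrib_left[symmetric] real_sqrt_mult)
      also have "\<dots> \<le> \<gamma> * K" using i s \<mu>2 K \<gamma> by (intro mult_mono) auto
      finally show "nrm d (\<lambda>j. \<mu> $ i * x i \<omega> j) \<le> \<gamma> * K" .
    qed
    also have "\<dots> = real s2 * K * \<gamma>" by simp
    finally show ?thesis using w3 by simp
  qed
  have zW: "(\<Sum>i\<in>?J. z i * ip d (x i \<omega>) v) = ip d U v + ip d W v" for v
    unfolding sum_ip_rows by (simp add: z_def U_def W_def ip_def algebra_simps sum.distrib sum_distrib_left)
  have zW_le: "\<bar>ip d U v + ip d W v\<bar> \<le> (w1 + w3) * nrm d v" for v
  proof -
    have "\<bar>ip d U v\<bar> \<le> w3 * nrm d v" using abs_ip_le[of d U v] mult_right_mono[OF U, of "nrm d v"] by simp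
    moreover have "\<bar>ip d W v\<bar> \<le> w1 * nrm d v"
      using abs_ip_le[of d W v] mult_right_mono[OF w1[folded W_def], of "nrm d v"] by simp
    ultimately show ?thesis by (simp add: algebra_simps)
  qed
  \<comment> \<open>Because h \<le> c / 2, the Gram error removes at most half of the
    curvature.\<close>
  have coercive: "?m * c / 2 * (nrm d v)\<^sup>2 \<le> (\<Sum>i\<in>?J. (ip d (x i \<omega>) v)\<^sup>2)" for v
  proof -
    have "nrm d v * gram_error ?J \<omega> * nrm d v \<le> nrm d v * (?m * (c / 2)) * nrm d v"
      using h mult_left_mono[OF h(2), of ?m] by (intro mult_right_mono mult_left_mono) auto
    moreover have "?m * (c * (nrm d v)\<^sup>2) \<le> ?m * bil d Sig v v" using c(2)[of v] by (intro mult_left_mono) auto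
    ultimately show ?thesis using gram_bilinear[where J = ?J and \<omega> = \<omega> and u = v and v = v] unfolding cardJ
      by (simp add: power2_eq_square abs_le_iff algebra_simps)
  qed
  have zs: "zero_set mh = ?J"
  proof -
    let ?b = "\<lambda>j. bh $ j - \<beta> $ j"
    have loss: "penalized_loss lam (design_mat n d X \<omega>) (response n \<mu> \<beta> X \<epsilon> \<omega>) (m', b') =
        (\<Sum>i<n. (z i - m' $ i - ip d (x i \<omega>) (\<lambda>j. b' $ j - \<beta> $ j))\<^sup>2 + 2 * lam * \<bar>m' $ i\<bar>)"
      if "m' \<in> carrier_vec n" "b' \<in> carrier_vec d" for m' b'
      using penalized_loss_sum[where X = X and \<omega> = \<omega> and \<epsilon> = \<epsilon>, OF \<mu> \<beta> X_carrier[OF _ \<omega>] that] by (simp add: z_def x_def[abs_def])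
    have "{i. i < n \<and> mh $ i = 0} = ?J"
    proof (rule penalized_minimizer_support(2)[where b = ?b and z = z and x = "\<lambda>i. x i \<omega>" and d = d and lam = lam
          and \<theta> = \<theta> and K = K and c = "?m * c / 2" and R = "\<theta> * lam / (2 * K)" and w = "w1 + w3 + lam * w2"])
      fix m' b' :: "nat \<Rightarrow> real"
      have "\<not> penalized_loss lam (design_mat n d X \<omega>) (response n \<mu> \<beta> X \<epsilon> \<omega>) (vec n m', vec d (\<lambda>j. b' j + \<beta> $ j))
        < penalized_loss lam (design_mat n d X \<omega>) (response n \<mu> \<beta> X \<epsilon> \<omega>) (mh, bh)"
        using minimizer unfolding penalized_minimizer_def is_arg_min_def by auto
      moreover have "ip d (x i \<omega>) (\<lambda>j. vec d (\<lambda>j. b' j + \<beta> $ j) $ j - \<beta> $ j) = ip d (x i \<omega>) b'" for i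
        by (simp add: ip_def)
      ultimately show "(\<Sum>i<n. (z i - mh $ i - ip d (x i \<omega>) ?b)\<^sup>2 + 2 * lam * \<bar>mh $ i\<bar>)
        \<le> (\<Sum>i<n. (z i - m' i - ip d (x i \<omega>) b')\<^sup>2 + 2 * lam * \<bar>m' i\<bar>)"
        by (simp add: loss mh bh not_less)
    next
      fix i assume "s1 \<le> i" "i < n"
      then show "\<bar>z i\<bar> \<le> (1 - \<theta>) * lam"
        using eps[of i] \<mu>2[of i] \<mu>3[of i] \<gamma> unfolding z_def by (cases "i < s1 + s2") auto
    next
      fix i assume i: "i < s1"
      have "\<theta> * lam \<ge> 0" "\<theta> * lam < 1 * lam" using \<theta> lam by (simp, intro mult_strict_right_mono) auto
      moreover have "\<bar>z i\<bar> \<ge> 8 * lam - \<gamma>" using \<mu>1[OF i] eps[of i] i s unfolding z_def by linarith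
      ultimately show "\<bar>z i\<bar> > (1 + \<theta>) * lam" using \<gamma> lam by (simp add: algebra_simps)
    next
      fix v
      show "?m * c / 2 * (nrm d v)\<^sup>2 \<le> (\<Sum>i\<in>?J. (ip d (x i \<omega>) v)\<^sup>2)" by (rule coercive)
      \<comment> \<open>Outliers are at least 8 lam while the noise is below lam / 2, so the sign is
        that of the deterministic shift and the sign sum has fixed weights.\<close>
      have sg: "sgn (z i) = sgn (\<mu> $ i)" if "i < s1" for i
      proof -
        have "0 \<le> \<theta> * lam" using \<theta> lam by simp
        then have "\<gamma> < 8 * lam" using \<gamma> lam by (simp add: algebra_simps)
        then show ?thesis using \<mu>1[OF that] eps[of i] that s unfolding z_def sgn_real_def by auto
      qed
      have "(\<Sum>i<s1. sgn (z i) * ip d (x i \<omega>) v) = ip d (\<lambda>j. \<Sum>i<s1. sgn (\<mu> $ i) * x i \<omega> j) v"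
        unfolding sum_ip_rows[symmetric] using sg by (intro sum.cong) auto
      also have "\<dots> \<le> w2 * nrm d v"
        using abs_ip_le[of d "\<lambda>j. \<Sum>i<s1. sgn (\<mu> $ i) * x i \<omega> j" v] mult_right_mono[OF w2, of "nrm d v"] by simp
      finally have "lam * (\<Sum>i<s1. sgn (z i) * ip d (x i \<omega>) v) \<le> lam * (w2 * nrm d v)"
        using lam by (intro mult_left_mono) auto
      then show "(\<Sum>i\<in>?J. z i * ip d (x i \<omega>) v) + lam * (\<Sum>i<s1. sgn (z i) * ip d (x i \<omega>) v)
          \<le> (w1 + w3 + lam * w2) * nrm d v"
        using zW_le[of v] unfolding zW by (simp add: algebra_simps abs_le_iff)
    qed (use s lam \<theta> K small in auto)
    then show ?thesis using mh by (simp add: zero_set_def)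
  qed
  define D where "D = (\<lambda>j. bt $ j - \<beta> $ j)"
  have normal: "(\<Sum>i\<in>?J. ip d (x i \<omega>) v * ip d (x i \<omega>) D) = ip d U v + ip d W v" for v
  proof -
    have row: "ip d (\<lambda>j. design_mat n d X \<omega> $$ (i, j)) f = ip d (x i \<omega>) f" if "i < n" for i f
      using that by (simp add: ip_def design_mat_def x_def)
    have eq: "(\<Sum>i\<in>?J. x i \<omega> j * (z i - ip d (x i \<omega>) D)) = 0" if "j < d" for j
    proof -
      have "(\<Sum>i\<in>?J. design_mat n d X \<omega> $$ (i, j) *
          (response n \<mu> \<beta> X \<epsilon> \<omega> $ i - ip d (\<lambda>j. design_mat n d X \<omega> $$ (i, j)) (\<lambda>j. bt $ j))) = 0"
      proof (rule normal_equations_of_ols_on[OF _ _ bt _ ols[unfolded zs] _ _ that])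
        show "?m * c / 2 > 0" using m c by simp
        show "?m * c / 2 * (nrm d v)\<^sup>2 \<le> (\<Sum>i\<in>?J. (ip d (\<lambda>j. design_mat n d X \<omega> $$ (i, j)) v)\<^sup>2)" for v
          using coercive[of v] by (simp add: row)
      qed (use s in \<open>auto simp: design_mat_def response_def\<close>)
      also have "(\<Sum>i\<in>?J. design_mat n d X \<omega> $$ (i, j) *
          (response n \<mu> \<beta> X \<epsilon> \<omega> $ i - ip d (\<lambda>j. design_mat n d X \<omega> $$ (i, j)) (\<lambda>j. bt $ j))) =
          (\<Sum>i\<in>?J. x i \<omega> j * (z i - ip d (x i \<omega>) D))"
      proof (intro sum.cong refl)
        fix i assume "i \<in> ?J"
        then have i: "i < n" by simp
        have "response n \<mu> \<beta> X \<epsilon> \<omega> $ i = z i + ip d (x i \<omega>) (\<lambda>j. \<beta> $ j)"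
          using i scalar_prod_ip[OF \<beta>, of "X i \<omega>"] by (simp add: response_def z_def x_def[abs_def])
        then have "response n \<mu> \<beta> X \<epsilon> \<omega> $ i - ip d (x i \<omega>) (\<lambda>j. bt $ j) = z i - ip d (x i \<omega>) D"
          by (simp add: D_def ip_def right_diff_distrib sum_subtractf)
        then show "design_mat n d X \<omega> $$ (i, j) *
          (response n \<mu> \<beta> X \<epsilon> \<omega> $ i - ip d (\<lambda>j. design_mat n d X \<omega> $$ (i, j)) (\<lambda>j. bt $ j)) =
          x i \<omega> j * (z i - ip d (x i \<omega>) D)"
          using i that by (simp add: row) (simp add: design_mat_def x_def)
      qed
      finally show ?thesis .
    qed
    have "0 = (\<Sum>j<d. v j * (\<Sum>i\<in>?J. x i \<omega> j * (z i - ip d (x i \<omega>) D)))" using eq by simp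
    also have "\<dots> = ip d (\<lambda>j. \<Sum>i\<in>?J. (z i - ip d (x i \<omega>) D) * x i \<omega> j) v"
      by (simp add: ip_def mult.commute)
    also have "\<dots> = (\<Sum>i\<in>?J. z i * ip d (x i \<omega>) v) - (\<Sum>i\<in>?J. ip d (x i \<omega>) v * ip d (x i \<omega>) D)"
      unfolding sum_ip_rows[symmetric] by (simp add: algebra_simps sum_subtractf)
    finally show ?thesis unfolding zW by simp
  qed
  \<comment> \<open>Testing the normal equations against \<open>D\<close> itself gives a first,
    crude bound on the second-step error.\<close>
  have D: "nrm d D \<le> 2 * (w1 + w3) / (?m * c)"
  proof -
    have "?m * c / 2 * (nrm d D)\<^sup>2 \<le> (w1 + w3) * nrm d D"
      using coercive[of D] normal[of D] zW_le[of D] by (simp add: power2_eq_square abs_le_iff)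
    then have "nrm d D * (?m * c * nrm d D) \<le> nrm d D * (2 * (w1 + w3))" by (simp add: power2_eq_square algebra_simps)
    moreover have "0 \<le> w1" "0 \<le> w3" using w1 U L2_set_nonneg order_trans by blast+
    ultimately have "?m * c * nrm d D \<le> 2 * (w1 + w3)"
      by (cases "nrm d D = 0") (auto simp: less_le)
    then show ?thesis using m c by (simp add: pos_le_divide_eq mult.commute)
  qed
  \<comment> \<open>Symmetry of the covariance lets it act on \<open>u\<close> instead of on
    \<open>D\<close>.\<close>
  have "ip d a D = bil d Sig D u"
    unfolding bil_ip ip_commute[of d a] using u by (simp add: ip_def)
  also have "\<dots> = bil d Sig u D" using Sig_sym by (rule bil_sym)
  finally have a: "ip d a D = bil d Sig u D" .
  have lin: "lin_stat ?J (1 / ?m) u \<omega> = ip d W u / ?m"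
    by (simp add: lin_stat_ip W_def)
  have scale: "k * \<bar>p - r / k\<bar> = \<bar>k * p - r\<bar>" if "k > 0" for k p r :: real
  proof -
    have "k * p - r = k * (p - r / k)" using that by (simp add: right_diff_distrib)
    then show ?thesis using that by (simp add: abs_mult)
  qed
  have "?m * \<bar>ip d a D - ip d W u / ?m\<bar> = \<bar>?m * bil d Sig u D - ip d W u\<bar>"
    unfolding a by (rule scale[OF m])
  also have "\<dots> \<le> \<bar>(\<Sum>i\<in>?J. ip d (x i \<omega>) u * ip d (x i \<omega>) D) - ?m * bil d Sig u D\<bar> + \<bar>ip d U u\<bar>"
    unfolding normal by linarith
  also have "\<dots> \<le> nrm d u * (?m * h) * nrm d D + w3 * nrm d u"
  proof (rule add_mono)
    have "nrm d u * gram_error ?J \<omega> * nrm d D \<le> nrm d u * (?m * h) * nrm d D"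
      using h by (intro mult_right_mono mult_left_mono) auto
    then show "\<bar>(\<Sum>i\<in>?J. ip d (x i \<omega>) u * ip d (x i \<omega>) D) - ?m * bil d Sig u D\<bar> \<le> nrm d u * (?m * h) * nrm d D"
      using gram_bilinear[where J = ?J and \<omega> = \<omega> and u = u and v = D] unfolding cardJ by linarith
    show "\<bar>ip d U u\<bar> \<le> w3 * nrm d u" using abs_ip_le[of d U u] mult_right_mono[OF U, of "nrm d u"] by simp
  qed
  also have "\<dots> \<le> nrm d u * (?m * h) * (2 * (w1 + w3) / (?m * c)) + w3 * nrm d u"
  proof -
    have "0 \<le> gram_error ?J \<omega>" by (simp add: gram_error_def)
    then have "0 \<le> ?m * h" using h(1) by linarith
    then show ?thesis using D by (intro add_right_mono mult_left_mono) auto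
  qed
  also have "\<dots> = ?m * (nrm d u * (h * (2 * (w1 + w3) / (?m * c)) + w3 / ?m))"
  proof -
    have "N * (k * h) * (y / (k * c)) + w3 * N = k * (N * (h * (y / (k * c)) + w3 / k))" if "k > 0" for k y N :: real
      using that by (simp add: distrib_left)
    then show ?thesis using m by blast
  qed
  finally show ?thesis using m unfolding D_def[symmetric] lin by simp
qed

end

section \<open>The normal limit law\<close>

lemma (in prob_space) expectation_cos_add:
  assumes [measurable]: "U \<in> borel_measurable M"
  shows "expectation (\<lambda>\<omega>. cos (U \<omega> + a)) = Re (char (distr M borel U) 1 * iexp a)"
proof -
  have int: "integrable M (\<lambda>\<omega>. iexp (U \<omega>))"
    by (intro integrable_const_bound[of _ 1]) auto
  have "char (distr M borel U) 1 * iexp a = expectation (\<lambda>\<omega>. iexp (U \<omega>)) * iexp a"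
    by (simp add: char_def integral_distr)
  also have "\<dots> = expectation (\<lambda>\<omega>. iexp (U \<omega>) * iexp a)" using int by simp
  also have "Re \<dots> = expectation (\<lambda>\<omega>. Re (iexp (U \<omega>) * iexp a))"
    using int by (intro integral_Re[symmetric]) simp
  also have "(\<lambda>\<omega>. Re (iexp (U \<omega>) * iexp a)) = (\<lambda>\<omega>. cos (U \<omega> + a))"
    by (simp add: Re_exp Im_exp cos_add)
  finally show ?thesis by simp
qed

lemma prob_space_tight:
  assumes "prob_space N" "sets N = sets (RV q)" "e > 0"
  shows "\<exists>K. measure N {x \<in> space (RV q). \<exists>r<q. \<bar>x r\<bar> > K} \<le> e"
proof -
  interpret prob_space N by fact
  let ?A = "\<lambda>k :: nat. {x \<in> space (RV q). \<exists>r<q. \<bar>x r\<bar> > real k}"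
  have "?A k \<in> sets (RV q)" for k by measurable
  then have "range ?A \<subseteq> sets N" unfolding assms(2) by (rule image_subsetI)
  moreover have "decseq ?A"
  proof (rule decseq_SucI)
    fix k
    have "\<exists>r<q. \<bar>x r\<bar> > real k" if "\<exists>r<q. \<bar>x r\<bar> > real (Suc k)" for x :: "nat \<Rightarrow> real"
    proof -
      from that obtain r where "r < q" "\<bar>x r\<bar> > real (Suc k)" by blast
      then have "\<bar>x r\<bar> > real k" by simp
      then show ?thesis using \<open>r < q\<close> by blast
    qed
    then show "?A (Suc k) \<subseteq> ?A k" by blast
  qed
  ultimately have "(\<lambda>k. measure N (?A k)) \<longlonglongrightarrow> measure N (\<Inter>k. ?A k)"
    by (rule finite_Lim_measure_decseq)
  moreover have "(\<Inter>k. ?A k) = {}"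
  proof -
    have "x \<notin> (\<Inter>k. ?A k)" for x
    proof
      assume x: "x \<in> (\<Inter>k. ?A k)"
      obtain k where k: "(\<Sum>r<q. \<bar>x r\<bar>) \<le> real k" using real_arch_simple by blast
      from x have "x \<in> ?A k" by (rule INT_D) simp
      then obtain r where "r < q" "\<bar>x r\<bar> > real k" by blast
      moreover have "\<bar>x r\<bar> \<le> (\<Sum>r<q. \<bar>x r\<bar>)" using \<open>r < q\<close> by (intro member_le_sum) auto
      ultimately show False using k by linarith
    qed
    then show ?thesis by blast
  qed
  ultimately have "(\<lambda>k. measure N (?A k)) \<longlonglongrightarrow> 0" by simp
  then have "\<forall>\<^sub>F k in sequentially. measure N (?A k) < e" using \<open>e > 0\<close> by (rule order_tendstoD)
  then obtain k where "measure N (?A k) < e" using eventually_happens' sequentially_bot by blast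
  then show ?thesis by (intro exI[of _ "real k"]) simp
qed

text \<open>A linear functional of L Z is a combination of independent standard normals with
  coefficients s = L^T t, and |s|^2 is the form of S at t. No inverse of S appears, so degenerate
  laws are included.\<close>

lemma normal_law_cos_integral:
  assumes "normal_law q (0\<^sub>v q) S N"
  shows "prob_space N" "sets N = sets (RV q)"
    "(\<integral>x. cos ((\<Sum>r<q. t r * x r) + a) \<partial>N) = exp (- bil q (\<lambda>i j. S $$ (i, j)) t t / 2) * cos a"
proof -
  obtain L where L: "L \<in> carrier_mat q q" and S: "L * transpose_mat L = S"
    and N: "N = distr (PiM {..<q} (\<lambda>_. std_normal_distribution)) (RV q) (\<lambda>z. coords q (0\<^sub>v q + L *\<^sub>v vec q z))"
    using assms unfolding normal_law_def by blast
  let ?G = "PiM {..<q} (\<lambda>_. std_normal_distribution)"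
  interpret std: prob_space std_normal_distribution by (rule prob_space_normal_density) simp
  interpret product_prob_space "\<lambda>_. std_normal_distribution" "{..<q}" ..
  let ?f = "\<lambda>z. coords q (0\<^sub>v q + L *\<^sub>v vec q z)"
  have f_nth: "?f z r = (\<Sum>l<q. L $$ (r, l) * z l)" if "r < q" for z r
    using that L by (simp add: coords_def scalar_prod_def lessThan_atLeast0)
  have setsG: "sets ?G = sets (RV q)" by (rule sets_PiM_cong) auto
  have coordG: "(\<lambda>z. z l) \<in> borel_measurable ?G" if "l < q" for l
    using that coord_measurable by (simp add: measurable_cong_sets[OF setsG refl])
  have fm: "?f \<in> measurable ?G (RV q)"
  proof (rule measurable_PiM_single')
    show "?f \<in> space ?G \<rightarrow> {..<q} \<rightarrow>\<^sub>E space borel" by (auto simp: coords_def)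
    fix r assume "r \<in> {..<q}"
    then show "(\<lambda>z. ?f z r) \<in> borel_measurable ?G"
      using coordG by (simp add: f_nth)
  qed
  show N_prob: "prob_space N" unfolding N
    by (rule prob_space.prob_space_distr[OF _ fm]) (rule prob_space_PiM, rule std.prob_space_axioms)
  show N_sets: "sets N = sets (RV q)" by (simp add: N)
  interpret N: prob_space N by fact
  let ?U = "\<lambda>x. \<Sum>r<q. t r * x r"
  have Um: "?U \<in> borel_measurable (RV q)" by (intro borel_measurable_sum borel_measurable_times borel_measurable_const coord_measurable) auto
  define s where "s l = (\<Sum>r<q. t r * L $$ (r, l))" for l
  have Uf: "?U (?f z) = (\<Sum>l<q. s l * z l)" for z
  proof -
    have "?U (?f z) = (\<Sum>r<q. \<Sum>l<q. t r * L $$ (r, l) * z l)"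
      by (intro sum.cong refl) (simp add: f_nth sum_distrib_left mult.assoc)
    also have "\<dots> = (\<Sum>l<q. \<Sum>r<q. t r * L $$ (r, l) * z l)" by (rule sum.swap)
    finally show ?thesis by (simp add: s_def sum_distrib_right)
  qed
  have "char (distr N borel ?U) 1 = (\<integral>x. iexp (?U x) \<partial>N)"
    using Um by (simp add: char_def integral_distr measurable_cong_sets[OF N_sets refl])
  also have "\<dots> = (\<integral>z. iexp (\<Sum>l<q. s l * z l) \<partial>?G)"
    unfolding N by (subst integral_distr[OF fm]) (use Um in \<open>simp_all only: Uf, measurable\<close>)
  also have "\<dots> = (\<integral>z. (\<Prod>l<q. iexp (s l * z l)) \<partial>?G)"
    by (simp add: exp_sum[symmetric] sum_distrib_left)
  also have "\<dots> = (\<Prod>l<q. \<integral>y. iexp (s l * y) \<partial>std_normal_distribution)"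
  proof (rule product_integral_prod)
    fix l assume "l \<in> {..<q}"
    show "integrable std_normal_distribution (\<lambda>y. iexp (s l * y))"
      by (intro std.integrable_const_bound[of _ 1]) auto
  qed simp
  also have "\<dots> = (\<Prod>l<q. complex_of_real (exp (- (s l)\<^sup>2 / 2)))"
    using char_std_normal_distribution by (intro prod.cong refl) (simp add: char_def fun_eq_iff)
  also have "\<dots> = complex_of_real (exp (- (\<Sum>l<q. (s l)\<^sup>2) / 2))"
    by (simp add: exp_sum[symmetric] sum_negf sum_divide_distrib flip: of_real_prod)
  also have "(\<Sum>l<q. (s l)\<^sup>2) = bil q (\<lambda>i j. S $$ (i, j)) t t"
  proof -
    have "S $$ (i, j) = (\<Sum>l<q. L $$ (i, l) * L $$ (j, l))" if "i < q" "j < q" for i j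
      unfolding S[symmetric] using L that by (simp add: scalar_prod_def lessThan_atLeast0)
    then have "bil q (\<lambda>i j. S $$ (i, j)) t t = (\<Sum>i<q. \<Sum>j<q. \<Sum>l<q. t i * (L $$ (i, l) * L $$ (j, l)) * t j)"
      unfolding bil_def by (simp add: sum_distrib_left sum_distrib_right)
    also have "\<dots> = (\<Sum>i<q. \<Sum>l<q. \<Sum>j<q. t i * (L $$ (i, l) * L $$ (j, l)) * t j)"
      by (intro sum.cong refl sum.swap)
    also have "\<dots> = (\<Sum>l<q. \<Sum>i<q. \<Sum>j<q. t i * (L $$ (i, l) * L $$ (j, l)) * t j)" by (rule sum.swap)
    also have "\<dots> = (\<Sum>l<q. (s l)\<^sup>2)" by (simp add: s_def power2_eq_square sum_product mult_ac)
    finally show ?thesis by simp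
  qed
  finally have ch: "char (distr N borel ?U) 1 = complex_of_real (exp (- bil q (\<lambda>i j. S $$ (i, j)) t t / 2))" .
  have "(\<integral>x. cos (?U x + a) \<partial>N) = Re (char (distr N borel ?U) 1 * iexp a)"
    using Um by (intro N.expectation_cos_add) (simp add: measurable_cong_sets[OF N_sets refl])
  then show "(\<integral>x. cos ((\<Sum>r<q. t r * x r) + a) \<partial>N) = exp (- bil q (\<lambda>i j. S $$ (i, j)) t t / 2) * cos a"
    unfolding ch by (simp add: Re_exp)
qed

lemma normal_law_exists:
  assumes S: "S \<in> carrier_mat q q" "transpose_mat S = S" and psd: "\<And>v. 0 \<le> bil q (\<lambda>i j. S $$ (i, j)) v v"
  shows "\<exists>N. normal_law q m S N"
proof -
  have "S $$ (i, j) = S $$ (j, i)" if "i < q" "j < q" for i j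
    using arg_cong[OF S(2), of "\<lambda>A. A $$ (i, j)"] S(1) that by simp
  then obtain L where L: "\<forall>i<q. \<forall>j<q. S $$ (i, j) = (\<Sum>l<q. L i l * L j l)"
    using psd_cholesky[of q "\<lambda>i j. S $$ (i, j)"] psd by blast
  define L' where "L' = mat q q (\<lambda>(i, l). L i l)"
  have "L' * transpose_mat L' = S"
    using S L by (intro eq_matI) (auto simp: L'_def scalar_prod_def lessThan_atLeast0)
  moreover have "L' \<in> carrier_mat q q" by (simp add: L'_def)
  ultimately show ?thesis unfolding normal_law_def by blast
qed

section \<open>Probability of the good event\<close>

lemma abs_cos_diff_le: "\<bar>cos x - cos y\<bar> \<le> \<bar>x - y\<bar>" for x y :: real
proof -
  have "\<bar>cos x - cos y\<bar> = 2 * \<bar>sin ((x + y) / 2)\<bar> * \<bar>sin ((y - x) / 2)\<bar>"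
    by (simp add: cos_diff_cos abs_mult)
  also have "\<dots> \<le> 2 * 1 * \<bar>(y - x) / 2\<bar>"
    by (intro mult_mono abs_sin_x_le_abs_x) auto
  finally show ?thesis by simp
qed

text \<open>The cosine is 1-Lipschitz and bounded, so closeness off a small event suffices. Nothing
  is asked of the values of \<open>V\<close> on \<open>B\<close>, where the estimator may be
  arbitrary.\<close>

lemma (in prob_space) expectation_cos_diff_le:
  assumes [measurable]: "U \<in> borel_measurable M" "V \<in> borel_measurable M" "B \<in> events"
    and close: "\<And>\<omega>. \<omega> \<in> space M \<Longrightarrow> \<omega> \<notin> B \<Longrightarrow> \<bar>V \<omega> - U \<omega>\<bar> \<le> e" and "e \<ge> 0"
  shows "\<bar>expectation (\<lambda>\<omega>. cos (V \<omega> + a)) - expectation (\<lambda>\<omega>. cos (U \<omega> + a))\<bar> \<le> e + 2 * prob B"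
proof -
  have int: "integrable M (\<lambda>\<omega>. cos (W \<omega> + a))" if [measurable]: "W \<in> borel_measurable M" for W :: "'a \<Rightarrow> real"
    by (intro integrable_const_bound[of _ 1]) auto
  have "\<bar>expectation (\<lambda>\<omega>. cos (V \<omega> + a)) - expectation (\<lambda>\<omega>. cos (U \<omega> + a))\<bar>
      = \<bar>expectation (\<lambda>\<omega>. cos (V \<omega> + a) - cos (U \<omega> + a))\<bar>"
    using int assms(1,2) by simp
  also have "\<dots> \<le> expectation (\<lambda>\<omega>. \<bar>cos (V \<omega> + a) - cos (U \<omega> + a)\<bar>)" by (rule integral_abs_bound)
  also have "\<dots> \<le> expectation (\<lambda>\<omega>. e + 2 * indicator B \<omega>)"
  proof (rule integral_mono)
    show "integrable M (\<lambda>\<omega>. \<bar>cos (V \<omega> + a) - cos (U \<omega> + a)\<bar>)" using int assms(1,2) by simp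
    show "integrable M (\<lambda>\<omega>. e + 2 * indicator B \<omega>)" by (simp add: emeasure_eq_measure)
    fix \<omega> assume \<omega>: "\<omega> \<in> space M"
    show "\<bar>cos (V \<omega> + a) - cos (U \<omega> + a)\<bar> \<le> e + 2 * indicator B \<omega>"
    proof (cases "\<omega> \<in> B")
      case True
      have "\<bar>cos (V \<omega> + a) - cos (U \<omega> + a)\<bar> \<le> 2"
        using abs_cos_le_one[of "V \<omega> + a"] abs_cos_le_one[of "U \<omega> + a"] by linarith
      then show ?thesis using True \<open>e \<ge> 0\<close> by simp
    next
      case False
      then show ?thesis using abs_cos_diff_le[of "V \<omega> + a" "U \<omega> + a"] close[OF \<omega>] by simp
    qed
  qed
  also have "\<dots> = e + 2 * prob B" by (simp add: emeasure_eq_measure prob_space)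
  finally show ?thesis .
qed

context regression_sample
begin

lemma nrm_weighted_measurable:
  assumes "J \<subseteq> {..<n}" "\<And>i. i \<in> J \<Longrightarrow> a i \<in> borel_measurable M"
  shows "(\<lambda>\<omega>. nrm d (\<lambda>j. \<Sum>i\<in>J. a i \<omega> * x i \<omega> j)) \<in> borel_measurable M"
  unfolding L2_set_def
  by (rule measurable_compose[OF _ borel_measurable_sqrt], intro borel_measurable_sum borel_measurable_power borel_measurable_times x_measurable assms(2))
    (use assms(1) in auto)

lemma gram_error_measurable: "J \<subseteq> {..<n} \<Longrightarrow> gram_error J \<in> borel_measurable M"
  unfolding gram_error_def[abs_def] L2_set_def split_def
  by (rule measurable_compose[OF _ borel_measurable_sqrt], intro borel_measurable_sum borel_measurable_power borel_measurable_diff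
      borel_measurable_times borel_measurable_const x_measurable) auto

lemma pos_def_Sig: "pos_def_mat d (cov_mat d P)"
  using design by (simp add: design_law_def)

lemma Sig_eq: "Sig = (\<lambda>j k. cov_mat d P $$ (j, k))"
  by (simp add: Sig_def fun_eq_iff)

text \<open>The absolute values around norms match the shape of the Chebyshev lemma. Rows are
  bounded twice: by the level \<open>\<kappa>\<close> of the model and by the level \<open>t\<close>
  that comes from fourth moments.\<close>

definition bad_event :: "nat \<Rightarrow> real vec \<Rightarrow> real \<Rightarrow> real \<Rightarrow> real \<Rightarrow> real \<Rightarrow> real \<Rightarrow> real \<Rightarrow> 'a set" where
  "bad_event s1 \<mu> \<kappa> \<gamma> t h w1 w2 =
    {\<omega> \<in> space M. Max ((\<lambda>i. vec_norm2 (X i \<omega>)) ` {..<n}) > \<kappa>} \<union>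
    {\<omega> \<in> space M. Max ((\<lambda>i. \<bar>\<epsilon> i \<omega>\<bar>) ` {..<n}) > \<gamma>} \<union>
    {\<omega> \<in> space M. \<exists>i<n. nrm d (x i \<omega>) > t} \<union>
    {\<omega> \<in> space M. \<bar>gram_error {s1..<n} \<omega>\<bar> > h} \<union>
    {\<omega> \<in> space M. \<bar>nrm d (\<lambda>j. \<Sum>i\<in>{s1..<n}. \<epsilon> i \<omega> * x i \<omega> j)\<bar> > w1} \<union>
    {\<omega> \<in> space M. \<bar>nrm d (\<lambda>j. \<Sum>i<s1. sgn (\<mu> $ i) * x i \<omega> j)\<bar> > w2}"

lemma bad_event:
  assumes n: "n \<ge> 1" and s1: "s1 \<le> n" and pos: "t > 0" "h > 0" "w1 > 0" "w2 > 0"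
  shows "bad_event s1 \<mu> \<kappa> \<gamma> t h w1 w2 \<in> events"
    and "prob (bad_event s1 \<mu> \<kappa> \<gamma> t h w1 w2) \<le>
      prob {\<omega> \<in> space M. Max ((\<lambda>i. vec_norm2 (X i \<omega>)) ` {..<n}) > \<kappa>} +
      prob {\<omega> \<in> space M. Max ((\<lambda>i. \<bar>\<epsilon> i \<omega>\<bar>) ` {..<n}) > \<gamma>} +
      real n * (\<tau>\<^sup>2 / t ^ 4) + real (n - s1) * \<tau>\<^sup>2 / h\<^sup>2 + real (n - s1) * \<sigma>\<^sup>2 * \<tau> / w1\<^sup>2 + real s1 * \<tau> / w2\<^sup>2"
    and "\<And>\<omega>. \<omega> \<in> space M \<Longrightarrow> \<omega> \<notin> bad_event s1 \<mu> \<kappa> \<gamma> t h w1 w2 \<Longrightarrow>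
      (\<forall>i<n. nrm d (x i \<omega>) \<le> min \<kappa> t \<and> \<bar>\<epsilon> i \<omega>\<bar> \<le> \<gamma>) \<and> gram_error {s1..<n} \<omega> \<le> h \<and>
      nrm d (\<lambda>j. \<Sum>i\<in>{s1..<n}. \<epsilon> i \<omega> * x i \<omega> j) \<le> w1 \<and> nrm d (\<lambda>j. \<Sum>i<s1. sgn (\<mu> $ i) * x i \<omega> j) \<le> w2"
proof -
  have J: "{s1..<n} \<subseteq> {..<n}" "{..<s1} \<subseteq> {..<n}" using s1 by auto
  have ne: "(\<lambda>i. f i) ` {..<n} \<noteq> {}" for f :: "nat \<Rightarrow> real" using n by (simp add: lessThan_empty_iff)
  let ?E1 = "{\<omega> \<in> space M. Max ((\<lambda>i. vec_norm2 (X i \<omega>)) ` {..<n}) > \<kappa>}"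
  let ?E2 = "{\<omega> \<in> space M. Max ((\<lambda>i. \<bar>\<epsilon> i \<omega>\<bar>) ` {..<n}) > \<gamma>}"
  let ?E3 = "{\<omega> \<in> space M. \<exists>i<n. nrm d (x i \<omega>) > t}"
  let ?E4 = "{\<omega> \<in> space M. \<bar>gram_error {s1..<n} \<omega>\<bar> > h}"
  let ?E5 = "{\<omega> \<in> space M. \<bar>nrm d (\<lambda>j. \<Sum>i\<in>{s1..<n}. \<epsilon> i \<omega> * x i \<omega> j)\<bar> > w1}"
  let ?E6 = "{\<omega> \<in> space M. \<bar>nrm d (\<lambda>j. \<Sum>i<s1. sgn (\<mu> $ i) * x i \<omega> j)\<bar> > w2}"
  have vn: "vec_norm2 (X i \<omega>) = nrm d (x i \<omega>)" if "i < n" "\<omega> \<in> space M" for i \<omega>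
    using X_carrier[OF that] by (simp add: vec_norm2_nrm x_def[abs_def])
  have E1: "?E1 = (\<Union>i<n. {\<omega> \<in> space M. nrm d (x i \<omega>) > \<kappa>})"
    using ne by (auto simp: Max_gr_iff vn)
  have E2: "?E2 = (\<Union>i<n. {\<omega> \<in> space M. \<bar>\<epsilon> i \<omega>\<bar> > \<gamma>})"
    using ne by (auto simp: Max_gr_iff)
  have E3: "?E3 = (\<Union>i<n. {\<omega> \<in> space M. nrm d (x i \<omega>) > t})" by auto
  have nm: "(\<lambda>\<omega>. nrm d (x i \<omega>)) \<in> borel_measurable M" if "i < n" for i
    unfolding L2_set_def using x_measurable[OF that] by measurable
  have m5: "(\<lambda>\<omega>. nrm d (\<lambda>j. \<Sum>i\<in>{s1..<n}. \<epsilon> i \<omega> * x i \<omega> j)) \<in> borel_measurable M"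
    using J(1) eps_measurable by (intro nrm_weighted_measurable) auto
  have m6: "(\<lambda>\<omega>. nrm d (\<lambda>j. \<Sum>i<s1. sgn (\<mu> $ i) * x i \<omega> j)) \<in> borel_measurable M"
    using J(2) by (intro nrm_weighted_measurable) auto
  have m4: "gram_error {s1..<n} \<in> borel_measurable M" by (rule gram_error_measurable[OF J(1)])
  have ev: "?E1 \<in> events" "?E2 \<in> events" "?E3 \<in> events" "?E4 \<in> events" "?E5 \<in> events" "?E6 \<in> events"
    unfolding E1 E2 E3 using nm eps_measurable m4 m5 m6 by (auto intro!: sets.finite_UN)
  then show "bad_event s1 \<mu> \<kappa> \<gamma> t h w1 w2 \<in> events" unfolding bad_event_def by (intro sets.Un)
  have "prob (bad_event s1 \<mu> \<kappa> \<gamma> t h w1 w2) \<le> prob ?E1 + prob ?E2 + prob ?E3 + prob ?E4 + prob ?E5 + prob ?E6"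
    unfolding bad_event_def
    by (intro order_trans[OF measure_Un_le] add_mono order_refl sets.Un ev)
  moreover have "prob ?E3 \<le> real n * (\<tau>\<^sup>2 / t ^ 4)" by (rule prob_large_row[OF pos(1)])
  moreover have "prob ?E4 \<le> real (n - s1) * \<tau>\<^sup>2 / h\<^sup>2"
    using second_moment_gram_error[OF J(1)] pos m4 by (intro prob_gt_le_second_moment) auto
  moreover have "prob ?E5 \<le> real (n - s1) * \<sigma>\<^sup>2 * \<tau> / w1\<^sup>2"
    using second_moment_noise_rows[OF J(1)] pos m5 by (intro prob_gt_le_second_moment) auto
  moreover have "prob ?E6 \<le> real s1 * \<tau> / w2\<^sup>2"
  proof (rule prob_gt_le_second_moment)
    have "(\<Sum>i<s1. (sgn (\<mu> $ i))\<^sup>2) \<le> (\<Sum>i<s1. 1)" by (intro sum_mono) (auto simp: sgn_real_def)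
    then have "(\<Sum>i<s1. (sgn (\<mu> $ i))\<^sup>2) * \<tau> \<le> real s1 * \<tau>" using \<tau>_nonneg by (intro mult_right_mono) auto
    then show "expectation (\<lambda>\<omega>. (nrm d (\<lambda>j. \<Sum>i<s1. sgn (\<mu> $ i) * x i \<omega> j))\<^sup>2) \<le> real s1 * \<tau>"
      using second_moment_weighted_rows(2)[OF J(2), of "\<lambda>i. sgn (\<mu> $ i)"] by linarith
    show "integrable M (\<lambda>\<omega>. (nrm d (\<lambda>j. \<Sum>i<s1. sgn (\<mu> $ i) * x i \<omega> j))\<^sup>2)"
      by (rule second_moment_weighted_rows(1)[OF J(2)])
  qed (use pos m6 in auto)
  ultimately show "prob (bad_event s1 \<mu> \<kappa> \<gamma> t h w1 w2) \<le>
      prob ?E1 + prob ?E2 + real n * (\<tau>\<^sup>2 / t ^ 4) + real (n - s1) * \<tau>\<^sup>2 / h\<^sup>2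
      + real (n - s1) * \<sigma>\<^sup>2 * \<tau> / w1\<^sup>2 + real s1 * \<tau> / w2\<^sup>2" by linarith
  fix \<omega> assume \<omega>: "\<omega> \<in> space M" "\<omega> \<notin> bad_event s1 \<mu> \<kappa> \<gamma> t h w1 w2"
  then have "\<omega> \<notin> ?E1" "\<omega> \<notin> ?E2" "\<omega> \<notin> ?E3" "\<omega> \<notin> ?E4" "\<omega> \<notin> ?E5" "\<omega> \<notin> ?E6"
    unfolding bad_event_def by blast+
  then show "(\<forall>i<n. nrm d (x i \<omega>) \<le> min \<kappa> t \<and> \<bar>\<epsilon> i \<omega>\<bar> \<le> \<gamma>) \<and> gram_error {s1..<n} \<omega> \<le> h \<and>
      nrm d (\<lambda>j. \<Sum>i\<in>{s1..<n}. \<epsilon> i \<omega> * x i \<omega> j) \<le> w1 \<and> nrm d (\<lambda>j. \<Sum>i<s1. sgn (\<mu> $ i) * x i \<omega> j) \<le> w2"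
    using \<omega>(1) unfolding E1 E2 E3 by (auto simp: not_less)
qed

text \<open>The concrete levels: since \<open>E \<parallel>X\<parallel>\<^sup>4 = O(d\<^sup>2)\<close>, the rows are bounded by
  \<open>sqrt (n / d)\<close> as well as by \<open>\<kappa>\<close>, and only the former bound is strong enough to control the
  \<open>s1\<close> gross outliers.\<close>

lemma two_step_close_to_lin_stat:
  fixes lam \<theta> \<gamma> \<kappa> c \<delta> CA :: real and s1 s2 :: nat and A :: "real mat" and \<mu> :: "real vec"
  defines "B \<equiv> A * inv_mat (cov_mat d P)"
  defines "Bad \<equiv> bad_event s1 \<mu> \<kappa> \<gamma> (sqrt (real n / real d)) (real (n - s1) * sqrt (real d ^ 3 / real n))
      (real d * sqrt (real n)) (\<delta> * sqrt (real n * real d))"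
  assumes nd: "n \<ge> 1" "d \<ge> 1" "d \<le> n"
    and \<mu>: "\<mu> \<in> carrier_vec n" and \<beta>: "\<beta> \<in> carrier_vec d"
    and s: "s1 + s2 \<le> n" "2 * s1 \<le> n"
    and lam: "lam > 0" and \<theta>: "0 < \<theta>" "\<theta> < 1" and \<gamma>: "0 < \<gamma>" "2 * \<gamma> \<le> (1 - \<theta>) * lam" and \<kappa>: "\<kappa> > 0"
    and \<mu>1: "\<And>i. i < s1 \<Longrightarrow> \<bar>\<mu> $ i\<bar> \<ge> 8 * lam"
    and \<mu>2: "\<And>i. s1 \<le> i \<Longrightarrow> i < s1 + s2 \<Longrightarrow> \<bar>\<mu> $ i\<bar> \<le> \<gamma>"
    and \<mu>3: "\<And>i. s1 + s2 \<le> i \<Longrightarrow> i < n \<Longrightarrow> \<mu> $ i = 0"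
    and c: "c > 0" "c \<le> lambda_min (cov_mat d P)" and \<delta>: "\<delta> = c * \<theta> / 64"
    and h: "sqrt (real d ^ 3 / real n) \<le> c / 2"
    and \<kappa>_lam: "sqrt (real d) * \<kappa> \<le> \<delta> * lam"
    and s2: "real s2 * \<kappa> * \<gamma> \<le> sqrt (real n) / sqrt (real d)"
    and A: "A \<in> carrier_mat q d" "frob_norm A \<le> CA"
    and carrier: "\<And>\<omega>. \<omega> \<in> space M \<Longrightarrow> mh \<omega> \<in> carrier_vec n \<and> bh \<omega> \<in> carrier_vec d \<and> bt \<omega> \<in> carrier_vec d"
    and minimizer: "\<And>\<omega>. \<omega> \<in> space M \<Longrightarrow>
      penalized_minimizer n d lam (design_mat n d X \<omega>) (response n \<mu> \<beta> X \<epsilon> \<omega>) (mh \<omega>) (bh \<omega>)"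
    and ols: "\<And>\<omega>. \<omega> \<in> space M \<Longrightarrow>
      ols_on (zero_set (mh \<omega>)) (design_mat n d X \<omega>) (response n \<mu> \<beta> X \<epsilon> \<omega>) (bt \<omega>)"
  shows "Bad \<in> events"
    and "prob Bad \<le>
      prob {\<omega> \<in> space M. Max ((\<lambda>i. vec_norm2 (X i \<omega>)) ` {..<n}) > \<kappa>} +
      prob {\<omega> \<in> space M. Max ((\<lambda>i. \<bar>\<epsilon> i \<omega>\<bar>) ` {..<n}) > \<gamma>} +
      \<tau>\<^sup>2 * (real d)\<^sup>2 / real n + 2 * \<tau>\<^sup>2 / real d ^ 3 + \<sigma>\<^sup>2 * \<tau> / (real d)\<^sup>2 + real s1 * \<tau> / (\<delta>\<^sup>2 * real n * real d)"
    and "\<And>\<omega> r. \<omega> \<in> space M \<Longrightarrow> \<omega> \<notin> Bad \<Longrightarrow> r < q \<Longrightarrow>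
      \<bar>(sqrt (real n) \<cdot>\<^sub>v (A *\<^sub>v (bt \<omega> - \<beta>))) $ r
        - lin_stat {s1..<n} (sqrt (real n) / real (n - s1)) (\<lambda>j. B $$ (r, j)) \<omega>\<bar>
      \<le> CA / c * (8 / c * sqrt (real d ^ 5 / real n) + 2 / sqrt (real d))"
proof -
  define m where "m = real (n - s1)"
  have m: "m > 0" "real n \<le> 2 * m" "m \<le> real n" and s1n: "s1 < n" "s1 \<le> n" using s nd by (auto simp: m_def)
  have n0: "real n > 0" and d0: "real d > 0" "real d \<ge> 1" and dn: "real d \<le> real n" using nd by auto
  have \<delta>0: "\<delta> > 0" unfolding \<delta> using c \<theta> by (intro divide_pos_pos mult_pos_pos) auto
  define hh where "hh = sqrt (real d ^ 3 / real n)"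
  have hh: "hh > 0" using n0 d0 by (simp add: hh_def)
  have pos: "sqrt (real n / real d) > 0" "m * hh > 0" "real d * sqrt (real n) > 0" "\<delta> * sqrt (real n * real d) > 0"
    using n0 d0 m hh \<delta>0 by auto
  note bad = bad_event[where \<mu> = \<mu> and \<kappa> = \<kappa> and \<gamma> = \<gamma>, OF nd(1) s1n(2) pos[unfolded m_def hh_def], folded Bad_def]
  show "Bad \<in> events" by (rule bad(1))
  have q: "(sqrt (real n / real d)) ^ 4 = (real n / real d)\<^sup>2"
  proof -
    have "y ^ 4 = (y\<^sup>2)\<^sup>2" for y :: real by simp
    then show ?thesis by (simp only:) (subst real_sqrt_pow2, auto)
  qed
  have "real n * (\<tau>\<^sup>2 / (sqrt (real n / real d)) ^ 4) = \<tau>\<^sup>2 * (real d)\<^sup>2 / real n"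
    unfolding q using n0 d0 by (simp add: field_simps power2_eq_square)
  moreover have "real (n - s1) * \<tau>\<^sup>2 / (real (n - s1) * sqrt (real d ^ 3 / real n))\<^sup>2 \<le> 2 * \<tau>\<^sup>2 / real d ^ 3"
  proof -
    have "m * \<tau>\<^sup>2 / (m * sqrt (real d ^ 3 / real n))\<^sup>2 = (\<tau>\<^sup>2 / real d ^ 3) * (real n / m)"
      using m n0 d0 by (simp add: power_mult_distrib field_simps) (simp add: power2_eq_square)
    also have "\<dots> \<le> (\<tau>\<^sup>2 / real d ^ 3) * 2" using m by (intro mult_left_mono) (auto simp: pos_divide_le_eq)
    finally show ?thesis unfolding m_def by (simp add: mult.commute)
  qed
  moreover have "real (n - s1) * \<sigma>\<^sup>2 * \<tau> / (real d * sqrt (real n))\<^sup>2 \<le> \<sigma>\<^sup>2 * \<tau> / (real d)\<^sup>2"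
  proof -
    have "m * \<sigma>\<^sup>2 * \<tau> / (real d * sqrt (real n))\<^sup>2 = (\<sigma>\<^sup>2 * \<tau> / (real d)\<^sup>2) * (m / real n)"
      using n0 d0 by (simp add: power_mult_distrib field_simps)
    also have "\<dots> \<le> (\<sigma>\<^sup>2 * \<tau> / (real d)\<^sup>2) * 1" using m n0 \<tau>_nonneg by (intro mult_left_mono) auto
    finally show ?thesis unfolding m_def by simp
  qed
  moreover have "real s1 * \<tau> / (\<delta> * sqrt (real n * real d))\<^sup>2 = real s1 * \<tau> / (\<delta>\<^sup>2 * real n * real d)"
    by (simp add: power_mult_distrib mult.assoc)
  ultimately show "prob Bad \<le>
      prob {\<omega> \<in> space M. Max ((\<lambda>i. vec_norm2 (X i \<omega>)) ` {..<n}) > \<kappa>} +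
      prob {\<omega> \<in> space M. Max ((\<lambda>i. \<bar>\<epsilon> i \<omega>\<bar>) ` {..<n}) > \<gamma>} +
      \<tau>\<^sup>2 * (real d)\<^sup>2 / real n + 2 * \<tau>\<^sup>2 / real d ^ 3 + \<sigma>\<^sup>2 * \<tau> / (real d)\<^sup>2 + real s1 * \<tau> / (\<delta>\<^sup>2 * real n * real d)"
    using bad(2) by linarith
  have Sc: "cov_mat d P \<in> carrier_mat d d" "transpose_mat (cov_mat d P) = cov_mat d P"
    using pos_def_Sig by (auto simp: pos_def_mat_def)
  have coer: "c * (nrm d v)\<^sup>2 \<le> bil d Sig v v" for v
    using lambda_min_le_bil[OF Sc nd(2), of v] mult_right_mono[OF c(2), of "(nrm d v)\<^sup>2"] by (simp add: Sig_eq)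
  note rows = mult_inv_mat_rows[OF A(1) pos_def_Sig c(1) coer[unfolded Sig_eq], folded B_def]
  define K where "K = min \<kappa> (sqrt (real n / real d))"
  have K: "K > 0" "K \<le> \<kappa>" "K \<le> sqrt (real n / real d)" using \<kappa> pos(1) by (auto simp: K_def)
  define w1 where "w1 = real d * sqrt (real n)"
  define w2 where "w2 = \<delta> * sqrt (real n * real d)"
  define w3 where "w3 = sqrt (real n) / sqrt (real d)"
  have w3_le: "w3 \<le> w1"
  proof -
    have "1 \<le> sqrt (real d)" using d0 by simp
    then have "sqrt (real n) / sqrt (real d) \<le> sqrt (real n) / 1" by (intro divide_left_mono) auto
    then have "w3 \<le> sqrt (real n)" by (simp add: w3_def)
    also have "\<dots> \<le> w1" using d0 by (simp add: w1_def mult_le_cancel_right1)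
    finally show ?thesis .
  qed
  \<comment> \<open>Noise against \<open>\<kappa>\<close>: the bound of sqrt d * \<kappa> by
    \<delta> * lam pays for one factor sqrt d of \<open>w1\<close>, and d \<le> n pays for the
    other.\<close>
  have w1K: "w1 * K \<le> \<delta> * lam * real n"
  proof -
    have "w1 * K = (sqrt (real d) * sqrt (real d)) * sqrt (real n) * K" by (simp add: w1_def)
    also have "\<dots> = sqrt (real d) * sqrt (real n) * (sqrt (real d) * K)" by (simp only: mult_ac)
    also have "\<dots> \<le> sqrt (real d) * sqrt (real n) * (sqrt (real d) * \<kappa>)" using K by (intro mult_left_mono) auto
    also have "\<dots> \<le> sqrt (real n) * sqrt (real n) * (\<delta> * lam)"
    proof (rule mult_mono[OF _ \<kappa>_lam])
      show "sqrt (real d) * sqrt (real n) \<le> sqrt (real n) * sqrt (real n)" using dn by (intro mult_right_mono) auto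
    qed (use \<kappa> in auto)
    finally show ?thesis by (simp add: mult_ac)
  qed
  \<comment> \<open>Outliers against the moment bound on the rows: sqrt (n d) times sqrt (n / d) is
    exactly n.\<close>
  have w2K: "w2 * K \<le> \<delta> * real n"
  proof -
    have "w2 * K \<le> w2 * sqrt (real n / real d)" using K pos(4) by (intro mult_left_mono) (auto simp: w2_def)
    also have "\<dots> = \<delta> * sqrt ((real n * real d) * (real n / real d))"
      by (subst real_sqrt_mult[of "real n * real d" "real n / real d"]) (simp only: w2_def mult.assoc)
    also have "(real n * real d) * (real n / real d) = (real n)\<^sup>2" using d0 by (simp add: power2_eq_square)
    finally show ?thesis by simp
  qed
  \<comment> \<open>Origin of \<delta> = c \<theta> / 64: the left side times K is at most 6
    \<delta> lam n, while n \<le> 2 m bounds 8 \<delta> lam n by 16 \<delta> lam m, which is the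
    right side times K, that is m c \<theta> lam / 4.\<close>
  have small: "2 * (w1 + w3 + lam * w2) < m * c / 2 * (\<theta> * lam / (2 * K))"
  proof -
    have "2 * (w1 + w3 + lam * w2) * K \<le> 2 * (w1 + w1 + lam * w2) * K"
      using w3_le K by (intro mult_right_mono) auto
    also have "\<dots> = 4 * (w1 * K) + 2 * lam * (w2 * K)" by (simp add: algebra_simps)
    also have "\<dots> \<le> 4 * (\<delta> * lam * real n) + 2 * lam * (\<delta> * real n)"
      using w1K w2K lam by (intro add_mono mult_left_mono) auto
    also have "\<dots> = 6 * (\<delta> * lam * real n)" by simp
    also have "\<dots> < 8 * (\<delta> * lam * real n)" using \<delta>0 lam n0 by simp
    also have "\<dots> \<le> 8 * (\<delta> * lam * (2 * m))" using \<delta>0 lam m by (intro mult_left_mono) auto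
    also have "\<dots> = m * c / 2 * (\<theta> * lam / 2)" by (simp add: \<delta>)
    finally have "2 * (w1 + w3 + lam * w2) * K < m * c / 2 * (\<theta> * lam / 2)" .
    then have "2 * (w1 + w3 + lam * w2) < m * c / 2 * (\<theta> * lam / 2) / K" using K(1) by (simp add: pos_less_divide_eq)
    then show ?thesis by simp
  qed
  have s2K: "real s2 * K * \<gamma> \<le> w3"
  proof -
    have "real s2 * K * \<gamma> \<le> real s2 * \<kappa> * \<gamma>" using K \<gamma> by (intro mult_right_mono mult_left_mono) auto
    then show ?thesis using s2 by (simp add: w3_def)
  qed
  \<comment> \<open>The Gram error sqrt (d^3 / n) times the second-step error of order d / sqrt n,
    scaled by sqrt n, gives the first term; \<open>w3\<close>, the root of n / d, gives the second.
    Replacing m by n costs factors 2, from n \<le> 2 m.\<close>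
  have err: "sqrt (real n) * (hh * (2 * (w1 + w3) / (m * c)) + w3 / m) \<le> 8 / c * sqrt (real d ^ 5 / real n) + 2 / sqrt (real d)"
  proof -
    have inv: "1 / m \<le> 2 / real n" using m n0 by (simp add: field_simps)
    have "hh * (2 * (w1 + w3) / (m * c)) = (hh * (2 * (w1 + w3)) / c) * (1 / m)" by simp
    also have "\<dots> \<le> (hh * (4 * w1) / c) * (2 / real n)"
    proof (rule mult_mono[OF _ inv])
      have "2 * (w1 + w3) \<le> 4 * w1" using w3_le by simp
      then show "hh * (2 * (w1 + w3)) / c \<le> hh * (4 * w1) / c"
        using hh c by (intro divide_right_mono mult_left_mono) auto
      show "0 \<le> hh * (4 * w1) / c" using hh c by (simp add: w1_def)
    qed (use m in simp)
    finally have "sqrt (real n) * (hh * (2 * (w1 + w3) / (m * c))) \<le> sqrt (real n) * ((hh * (4 * w1) / c) * (2 / real n))"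
      by (intro mult_left_mono) auto
    also have "\<dots> = 8 / c * (real d * hh) * (sqrt (real n) * sqrt (real n) / real n)"
    proof -
      have "y * ((hh * (4 * (D * y)) / c) * (2 / k)) = 8 / c * (D * hh) * (y * y / k)" for y D k :: real
        by (simp add: mult_ac)
      then show ?thesis unfolding w1_def .
    qed
    also have "\<dots> = 8 / c * (real d * hh)" using n0 by simp
    also have "real d * hh = sqrt (real d ^ 5 / real n)"
    proof -
      have "real d * hh = sqrt ((real d)\<^sup>2) * sqrt (real d ^ 3 / real n)" by (simp add: hh_def)
      also have "\<dots> = sqrt ((real d)\<^sup>2 * (real d ^ 3 / real n))" by (rule real_sqrt_mult[symmetric])
      finally show ?thesis by (simp add: power_add[symmetric])
    qed
    finally have 1: "sqrt (real n) * (hh * (2 * (w1 + w3) / (m * c))) \<le> 8 / c * sqrt (real d ^ 5 / real n)" .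
    have "sqrt (real n) * (w3 / m) = (sqrt (real n) * w3) * (1 / m)" by simp
    also have "\<dots> \<le> (sqrt (real n) * w3) * (2 / real n)" using inv d0 by (intro mult_left_mono) (auto simp: w3_def)
    also have "\<dots> = (2 / sqrt (real d)) * (sqrt (real n) * sqrt (real n) / real n)" by (simp add: w3_def)
    also have "\<dots> = 2 / sqrt (real d)" using n0 by simp
    finally show ?thesis using 1 by (simp add: distrib_left)
  qed
  fix \<omega> r assume \<omega>: "\<omega> \<in> space M" "\<omega> \<notin> Bad" and r: "r < q"
  let ?u = "\<lambda>j. B $$ (r, j)" and ?a = "\<lambda>j. A $$ (r, j)"
  note good = bad(3)[OF \<omega>]
  have cr: "mh \<omega> \<in> carrier_vec n" "bh \<omega> \<in> carrier_vec d" "bt \<omega> \<in> carrier_vec d" using carrier[OF \<omega>(1)] by auto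
  have bnd: "\<bar>ip d ?a (\<lambda>j. bt \<omega> $ j - \<beta> $ j) - lin_stat {s1..<n} (1 / real (n - s1)) ?u \<omega>\<bar>
    \<le> nrm d ?u * (hh * (2 * (w1 + w3) / (real (n - s1) * c)) + w3 / real (n - s1))"
  proof (rule two_step_error_bound[OF \<omega>(1) \<mu> \<beta> s(1) s1n(1) lam \<theta> \<gamma> \<mu>1 \<mu>2 \<mu>3 K(1) _ _ c(1) coer _ _ _ _ s2K
        small[unfolded m_def] cr minimizer[OF \<omega>(1)] ols[OF \<omega>(1)]])
    show "nrm d (x i \<omega>) \<le> K" "\<bar>\<epsilon> i \<omega>\<bar> \<le> \<gamma>" if "i < n" for i using good that by (auto simp: K_def)
    show "gram_error {s1..<n} \<omega> \<le> real (n - s1) * hh" "hh \<le> c / 2" using good h by (auto simp: hh_def)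
    show "nrm d (\<lambda>j. \<Sum>i\<in>{s1..<n}. \<epsilon> i \<omega> * x i \<omega> j) \<le> w1" using good by (simp add: w1_def)
    show "nrm d (\<lambda>j. \<Sum>i<s1. sgn (\<mu> $ i) * x i \<omega> j) \<le> w2" using good by (simp add: w2_def)
    show "ip d (Sig k) ?u = A $$ (r, k)" if "k < d" for k using rows(1)[OF r that] by (simp add: Sig_eq)
  qed
  have V: "(sqrt (real n) \<cdot>\<^sub>v (A *\<^sub>v (bt \<omega> - \<beta>))) $ r = sqrt (real n) * ip d ?a (\<lambda>j. bt \<omega> $ j - \<beta> $ j)"
  proof -
    have "bt \<omega> - \<beta> \<in> carrier_vec d" using cr \<beta> by simp
    then show ?thesis using mult_mat_vec_ip[OF A(1) _ r, of "bt \<omega> - \<beta>"] A(1) r \<beta> cr by (simp add: ip_def)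
  qed
  have U: "lin_stat {s1..<n} (sqrt (real n) / real (n - s1)) ?u \<omega> =
      sqrt (real n) * lin_stat {s1..<n} (1 / real (n - s1)) ?u \<omega>"
    by (simp add: lin_stat_ip)
  have "\<bar>(sqrt (real n) \<cdot>\<^sub>v (A *\<^sub>v (bt \<omega> - \<beta>))) $ r - lin_stat {s1..<n} (sqrt (real n) / real (n - s1)) ?u \<omega>\<bar>
      = sqrt (real n) * \<bar>ip d ?a (\<lambda>j. bt \<omega> $ j - \<beta> $ j) - lin_stat {s1..<n} (1 / real (n - s1)) ?u \<omega>\<bar>"
    unfolding V U right_diff_distrib[symmetric] by (simp add: abs_mult)
  also have "\<dots> \<le> sqrt (real n) * (nrm d ?u * (hh * (2 * (w1 + w3) / (m * c)) + w3 / m))"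
    using bnd unfolding m_def by (rule mult_left_mono) simp
  also have "\<dots> = nrm d ?u * (sqrt (real n) * (hh * (2 * (w1 + w3) / (m * c)) + w3 / m))" by simp
  also have "\<dots> \<le> CA / c * (8 / c * sqrt (real d ^ 5 / real n) + 2 / sqrt (real d))"
  proof (rule mult_mono)
    show "nrm d ?u \<le> CA / c" using rows(3)[OF r] divide_right_mono[OF A(2), of c] c by simp
    show "0 \<le> CA / c" using \<open>nrm d ?u \<le> CA / c\<close> L2_set_nonneg order_trans by blast
    show "0 \<le> sqrt (real n) * (hh * (2 * (w1 + w3) / (m * c)) + w3 / m)"
      using hh m c pos(3) d0 by (auto simp: w1_def w3_def intro!: mult_nonneg_nonneg add_nonneg_nonneg)
  qed (rule err)
  finally show "\<bar>(sqrt (real n) \<cdot>\<^sub>v (A *\<^sub>v (bt \<omega> - \<beta>))) $ r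
        - lin_stat {s1..<n} (sqrt (real n) / real (n - s1)) (\<lambda>j. B $$ (r, j)) \<omega>\<bar>
      \<le> CA / c * (8 / c * sqrt (real d ^ 5 / real n) + 2 / sqrt (real d))" .
qed

end

section \<open>The limit theorem\<close>

context regression_sample
begin

lemma lin_stat_sum: "lin_stat J a (\<lambda>j. \<Sum>r<q. t r * B r j) \<omega> = (\<Sum>r<q. t r * lin_stat J a (B r) \<omega>)"
proof -
  have "ip d w (\<lambda>j. \<Sum>r<q. t r * B r j) = (\<Sum>r<q. t r * ip d w (B r))" for w
  proof -
    have "ip d w (\<lambda>j. \<Sum>r<q. t r * B r j) = (\<Sum>j<d. \<Sum>r<q. t r * (w j * B r j))"
      by (simp add: ip_def sum_distrib_left mult_ac)
    also have "\<dots> = (\<Sum>r<q. \<Sum>j<d. t r * (w j * B r j))" by (rule sum.swap)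
    finally show ?thesis by (simp add: ip_def sum_distrib_left)
  qed
  then show ?thesis by (simp add: lin_stat_ip sum_distrib_left mult_ac)
qed

end

lemma bil_sum:
  "bil d S (\<lambda>j. \<Sum>r<q. t r * B r j) (\<lambda>j. \<Sum>r<q. t r * B r j) = (\<Sum>r<q. \<Sum>r'<q. t r * bil d S (B r) (B r') * t r')"
proof -
  have "bil d S (\<lambda>j. \<Sum>r<q. t r * B r j) (\<lambda>j. \<Sum>r<q. t r * B r j) =
      (\<Sum>j<d. \<Sum>k<d. \<Sum>r<q. \<Sum>r'<q. t r * (B r j * S j k * B r' k) * t r')"
    by (simp add: bil_def sum_distrib_left sum_distrib_right mult_ac)
  also have "\<dots> = (\<Sum>j<d. \<Sum>r<q. \<Sum>k<d. \<Sum>r'<q. t r * (B r j * S j k * B r' k) * t r')"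
    by (intro sum.cong refl sum.swap)
  also have "\<dots> = (\<Sum>r<q. \<Sum>j<d. \<Sum>k<d. \<Sum>r'<q. t r * (B r j * S j k * B r' k) * t r')"
    by (rule sum.swap)
  also have "\<dots> = (\<Sum>r<q. \<Sum>j<d. \<Sum>r'<q. \<Sum>k<d. t r * (B r j * S j k * B r' k) * t r')"
    by (intro sum.cong refl sum.swap)
  also have "\<dots> = (\<Sum>r<q. \<Sum>r'<q. \<Sum>j<d. \<Sum>k<d. t r * (B r j * S j k * B r' k) * t r')"
    by (intro sum.cong refl sum.swap)
  finally show ?thesis by (simp add: bil_def sum_distrib_left sum_distrib_right)
qed

lemma nrm_sum_le: "nrm d (\<lambda>j. \<Sum>r<q. t r * B r j) \<le> (\<Sum>r<q. \<bar>t r\<bar> * nrm d (B r))" for q :: nat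
proof (induction q)
  case (Suc q)
  have "nrm d (\<lambda>j. t q * B q j) = \<bar>t q\<bar> * nrm d (B q)"
    by (simp add: L2_set_def power_mult_distrib sum_distrib_left[symmetric] real_sqrt_mult)
  then show ?case
    using L2_set_triangle_ineq[of "\<lambda>j. \<Sum>r<q. t r * B r j" "\<lambda>j. t q * B q j" "{..<d}"] Suc by simp
qed (simp add: L2_set_def)

lemma truncated_second_moment_tendsto:
  assumes Q: "sets Q = sets borel" "integrable Q (\<lambda>x :: real. x\<^sup>2)" and T: "filterlim T at_top sequentially"
  shows "(\<lambda>n. \<integral>x. x\<^sup>2 * indicator {x. \<bar>x\<bar> > T n} x \<partial>Q) \<longlonglongrightarrow> (0 :: real)"
proof -
  have "(\<lambda>n. \<integral>x. x\<^sup>2 * indicator {x. \<bar>x\<bar> > T n} x \<partial>Q) \<longlonglongrightarrow> (\<integral>x. 0 \<partial>Q)"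
  proof (rule integral_dominated_convergence[where w = "\<lambda>x. x\<^sup>2"])
    show "AE x in Q. (\<lambda>n. x\<^sup>2 * indicator {x. \<bar>x\<bar> > T n} x) \<longlonglongrightarrow> 0"
    proof (rule AE_I2)
      fix x :: real
      have "\<forall>\<^sub>F n in sequentially. \<bar>x\<bar> \<le> T n" using T by (simp add: filterlim_at_top)
      then have "\<forall>\<^sub>F n in sequentially. x\<^sup>2 * indicator {x. \<bar>x\<bar> > T n} x = 0"
        by eventually_elim simp
      then show "(\<lambda>n. x\<^sup>2 * indicator {x. \<bar>x\<bar> > T n} x) \<longlonglongrightarrow> 0" by (rule tendsto_eventually)
    qed
    show "AE x in Q. norm (x\<^sup>2 * indicator {x. \<bar>x\<bar> > T n} x) \<le> x\<^sup>2" for n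
      by (auto split: split_indicator)
  qed (use Q in \<open>auto simp: measurable_cong_sets[OF Q(1) refl]\<close>)
  then show ?thesis by simp
qed

text \<open>A central limit theorem for a triangular array of growing dimension: the vectors
  \<open>u n\<close> stay bounded and only their quadratic forms converge, so the error is followed
  through an explicit majorant.\<close>

lemma lin_stat_char_tendsto:
  fixes M :: "nat \<Rightarrow> 'a measure" and u :: "nat \<Rightarrow> nat \<Rightarrow> real" and g U C :: real
  assumes RS: "\<And>n. n \<ge> 1 \<Longrightarrow> regression_sample (M n) n (d n) (P n) Q (X n) (\<epsilon> n) \<sigma>"
    and s: "(\<lambda>n. real (s n) / real n) \<longlonglongrightarrow> 0" "\<And>n. n \<ge> 1 \<Longrightarrow> s n \<le> n"
    and u: "\<And>n. n \<ge> 1 \<Longrightarrow> nrm (d n) (u n) \<le> U"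
    and g: "(\<lambda>n. bil (d n) (regression_sample.Sig (d n) (P n)) (u n) (u n)) \<longlonglongrightarrow> g"
    and \<tau>: "\<And>n. n \<ge> 1 \<Longrightarrow> regression_sample.\<tau> (d n) (P n) \<le> C * real (d n)"
    and d: "(\<lambda>n. real (d n) ^ 4 / real n) \<longlonglongrightarrow> 0"
  shows "(\<lambda>n. char (distr (M n) borel (regression_sample.lin_stat (d n) (X n) (\<epsilon> n) {s n..<n}
      (sqrt (real n) / real (n - s n)) (u n))) 1) \<longlonglongrightarrow> complex_of_real (exp (- (\<sigma>\<^sup>2 * g) / 2))"
proof -
  define m where "m n = real (n - s n)" for n
  define a where "a n = sqrt (real n) / m n" for n
  define b where "b n = bil (d n) (regression_sample.Sig (d n) (P n)) (u n) (u n)" for n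
  \<comment> \<open>T = n^(1/4) makes d^2 / T^2 tend to 0, and T' = n^(1/8) tends to infinity slowly
    enough that a T T' is of order n^(-1/8).\<close>
  define T where "T n = sqrt (sqrt (real n))" for n
  define T' where "T' n = sqrt (T n)" for n
  define tau where "tau n = regression_sample.\<tau> (d n) (P n)" for n
  define I where "I n = (\<integral>x. x\<^sup>2 * indicator {x. \<bar>x\<bar> > T' n} x \<partial>Q)" for n
  have b: "b \<longlonglongrightarrow> g" using g by (simp add: b_def[abs_def])
  have RS1: "regression_sample (M 1) 1 (d 1) (P 1) Q (X 1) (\<epsilon> 1) \<sigma>" by (rule RS) simp
  have Q: "sets Q = sets borel" "integrable Q (\<lambda>x. x\<^sup>2)"
    using regression_sample.noise[OF RS1] by (auto simp: noise_law_def)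
  have Tlim: "filterlim T at_top sequentially" unfolding T_def[abs_def]
    by (intro filterlim_compose[OF sqrt_at_top] filterlim_real_sequentially)
  have T'lim: "filterlim T' at_top sequentially" unfolding T'_def[abs_def]
    by (intro filterlim_compose[OF sqrt_at_top] Tlim)
  have I: "I \<longlonglongrightarrow> 0" unfolding I_def[abs_def] by (rule truncated_second_moment_tendsto[OF Q T'lim])
  have ratio: "(\<lambda>n. real n / m n) \<longlonglongrightarrow> 1"
  proof -
    have "(\<lambda>n. 1 / (1 - real (s n) / real n)) \<longlonglongrightarrow> 1 / (1 - 0)" by (intro tendsto_intros s) simp
    moreover have "\<forall>\<^sub>F n in sequentially. 1 / (1 - real (s n) / real n) = real n / m n"
      using eventually_ge_at_top[of 1]
    proof eventually_elim
      case (elim n)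
      then have "1 - real (s n) / real n = m n / real n" using s(2)[of n] by (simp add: m_def field_simps)
      then show ?case by simp
    qed
    ultimately show ?thesis by (simp add: filterlim_cong)
  qed
  have m_pos: "\<forall>\<^sub>F n in sequentially. m n > 0 \<and> n \<ge> 1"
  proof -
    \<comment> \<open>Division by zero gives 0, so a ratio near 1 also rules out m n = 0.\<close>
    have "\<forall>\<^sub>F n in sequentially. real n / m n > 1 / 2" by (rule order_tendstoD[OF ratio]) simp
    then show ?thesis using eventually_ge_at_top[of 1]
      by eventually_elim (auto simp: m_def intro: ccontr)
  qed
  have sqrt_d: "(\<lambda>n. (real (d n))\<^sup>2 / sqrt (real n)) \<longlonglongrightarrow> 0"
  proof -
    have "(\<lambda>n. sqrt (real (d n) ^ 4 / real n)) \<longlonglongrightarrow> sqrt 0" by (intro tendsto_intros d)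
    moreover have "sqrt (real (d n) ^ 4 / real n) = (real (d n))\<^sup>2 / sqrt (real n)" for n
    proof -
      have "real (d n) ^ 4 = ((real (d n))\<^sup>2)\<^sup>2" by simp
      then show ?thesis by (simp only: real_sqrt_divide real_sqrt_abs) simp
    qed
    ultimately show ?thesis by simp
  qed
  \<comment> \<open>Majorant of the error after summation over the m n rows, using m a^2 = n / m;
    the last summand comes from the term v^2 / 4.\<close>
  define E where "E n = (real n / m n) * ((real n / m n) * (1 / T' n) * \<sigma>\<^sup>2 * b n
      + 6 * \<sigma>\<^sup>2 * U ^ 4 * C\<^sup>2 * ((real (d n))\<^sup>2 / sqrt (real n)) + 6 * b n * I n) / 6
      + (real n / m n)\<^sup>2 * (\<sigma>\<^sup>2)\<^sup>2 * (b n)\<^sup>2 * (real n / m n) * (1 / real n) / 4" for n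
  have "(\<lambda>n. 1 / T' n) \<longlonglongrightarrow> 0" using T'lim by (intro tendsto_divide_0[OF tendsto_const] filterlim_at_top_imp_at_infinity)
  moreover have "(\<lambda>n. 1 / real n) \<longlonglongrightarrow> 0" by (rule lim_1_over_n)
  ultimately have "E \<longlonglongrightarrow> 1 * (1 * 0 * \<sigma>\<^sup>2 * g + 6 * \<sigma>\<^sup>2 * U ^ 4 * C\<^sup>2 * 0 + 6 * g * 0) / 6
      + 1\<^sup>2 * (\<sigma>\<^sup>2)\<^sup>2 * g\<^sup>2 * 1 * 0 / 4"
    unfolding E_def[abs_def] by (intro tendsto_intros ratio b sqrt_d I) auto
  then have E: "E \<longlonglongrightarrow> 0" by simp
  define ch where "ch n = char (distr (M n) borel (regression_sample.lin_stat (d n) (X n) (\<epsilon> n) {s n..<n} (a n) (u n))) 1" for n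
  have "\<forall>\<^sub>F n in sequentially. norm (ch n - complex_of_real (exp (- ((real n / m n) * \<sigma>\<^sup>2 * b n) / 2))) \<le> E n"
    using m_pos
  proof eventually_elim
    case (elim n)
    then have n: "n \<ge> 1" and m: "m n > 0" and n0: "real n > 0" by auto
    interpret regression_sample "M n" n "d n" "P n" Q "X n" "\<epsilon> n" \<sigma> by (rule RS[OF n])
    have a0: "a n \<ge> 0" using m by (simp add: a_def)
    have T0: "T n > 0" "T' n > 0" using n0 by (simp_all add: T_def T'_def)
    have ma: "m n * (a n)\<^sup>2 = real n / m n" using m by (simp add: a_def power_divide) (simp add: power2_eq_square)
    have card: "real (card {s n..<n}) = m n" by (simp add: m_def)
    have b_eq: "bil (d n) Sig (u n) (u n) = b n" and \<tau>_eq: "regression_sample.\<tau> (d n) (P n) = tau n" by (simp_all add: b_def tau_def)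
    let ?v = "(a n)\<^sup>2 * \<sigma>\<^sup>2 * b n"
    have "norm (ch n - complex_of_real (exp (- (m n * ?v) / 2))) \<le> m n * (lindeberg (a n) (T n) (T' n) (u n) / 6 + ?v\<^sup>2 / 4)"
    proof -
      have "{s n..<n} \<subseteq> {..<n}" by auto
      from char_lin_stat[OF this a0 T0, of "u n"] show ?thesis unfolding card b_eq ch_def .
    qed
    also have "m n * ?v = (real n / m n) * \<sigma>\<^sup>2 * b n" unfolding ma[symmetric] by simp
    also have "m n * (lindeberg (a n) (T n) (T' n) (u n) / 6 + ?v\<^sup>2 / 4) \<le> E n"
    proof -
      have TT: "T n * T n = sqrt (real n)" "T' n * T' n = T n" using n0 by (simp_all add: T_def T'_def)
      have "a n * T n * T' n = (real n / m n) * (1 / T' n)"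
      proof -
        have "real n = sqrt (real n) * (T n * T n)" unfolding TT(1) using n0 by simp
        also have "\<dots> = sqrt (real n) * T n * (T' n * T' n)" unfolding TT(2) by simp
        finally have "real n / T' n = sqrt (real n) * T n * T' n" using T0 by (simp add: field_simps)
        then show ?thesis by (simp add: a_def field_simps)
      qed
      moreover have "6 * \<sigma>\<^sup>2 * (nrm (d n) (u n) ^ 4 * (tau n)\<^sup>2) / (T n)\<^sup>2 \<le> 6 * \<sigma>\<^sup>2 * U ^ 4 * C\<^sup>2 * ((real (d n))\<^sup>2 / sqrt (real n))"
      proof -
        have "nrm (d n) (u n) ^ 4 * (tau n)\<^sup>2 \<le> U ^ 4 * (C * real (d n))\<^sup>2"
          using u[OF n] \<tau>[OF n] \<tau>_nonneg by (intro mult_mono power_mono) (auto simp: tau_def)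
        then have "6 * \<sigma>\<^sup>2 * (nrm (d n) (u n) ^ 4 * (tau n)\<^sup>2) / (T n)\<^sup>2 \<le> 6 * \<sigma>\<^sup>2 * (U ^ 4 * (C * real (d n))\<^sup>2) / (T n)\<^sup>2"
          by (intro divide_right_mono mult_left_mono) auto
        also have "\<dots> = 6 * \<sigma>\<^sup>2 * U ^ 4 * C\<^sup>2 * ((real (d n))\<^sup>2 / sqrt (real n))"
          using TT(1) by (simp add: power_mult_distrib power2_eq_square[of "T n"])
        finally show ?thesis .
      qed
      ultimately have "a n * T n * T' n * \<sigma>\<^sup>2 * b n + 6 * \<sigma>\<^sup>2 * (nrm (d n) (u n) ^ 4 * (tau n)\<^sup>2) / (T n)\<^sup>2 + 6 * b n * I n
          \<le> (real n / m n) * (1 / T' n) * \<sigma>\<^sup>2 * b n + 6 * \<sigma>\<^sup>2 * U ^ 4 * C\<^sup>2 * ((real (d n))\<^sup>2 / sqrt (real n)) + 6 * b n * I n"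
        (is "?l \<le> ?r") by simp
      then have le: "(real n / m n) * ?l \<le> (real n / m n) * ?r" using m n0 by (intro mult_left_mono) auto
      have L: "m n * lindeberg (a n) (T n) (T' n) (u n) = (real n / m n) * ?l"
        unfolding ma[symmetric] lindeberg_def b_eq \<tau>_eq I_def by (simp add: mult.assoc)
      have v: "m n * ?v\<^sup>2 = (real n / m n)\<^sup>2 * (\<sigma>\<^sup>2)\<^sup>2 * (b n)\<^sup>2 * (real n / m n) * (1 / real n)"
      proof -
        have "m n * ?v\<^sup>2 = (m n * (a n)\<^sup>2)\<^sup>2 * (\<sigma>\<^sup>2)\<^sup>2 * (b n)\<^sup>2 / m n"
          using m by (simp add: power_mult_distrib power2_eq_square)
        then show ?thesis unfolding ma using n0 by simp
      qed
      have "m n * (lindeberg (a n) (T n) (T' n) (u n) / 6 + ?v\<^sup>2 / 4) =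
          (m n * lindeberg (a n) (T n) (T' n) (u n)) / 6 + (m n * ?v\<^sup>2) / 4"
        by (simp only: distrib_left times_divide_eq_right)
      also have "\<dots> \<le> E n" unfolding L v E_def
        by (intro add_mono divide_right_mono le order_refl) simp
      finally show ?thesis .
    qed
    finally show ?case .
  qed
  then have "(\<lambda>n. ch n - complex_of_real (exp (- ((real n / m n) * \<sigma>\<^sup>2 * b n) / 2))) \<longlonglongrightarrow> 0"
    by (rule Lim_null_comparison) (rule E)
  moreover have "(\<lambda>n. complex_of_real (exp (- ((real n / m n) * \<sigma>\<^sup>2 * b n) / 2))) \<longlonglongrightarrow> complex_of_real (exp (- (1 * \<sigma>\<^sup>2 * g) / 2))"
    by (intro tendsto_intros ratio b) auto
  ultimately have "(\<lambda>n. (ch n - complex_of_real (exp (- ((real n / m n) * \<sigma>\<^sup>2 * b n) / 2)))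
      + complex_of_real (exp (- ((real n / m n) * \<sigma>\<^sup>2 * b n) / 2))) \<longlonglongrightarrow> 0 + complex_of_real (exp (- (1 * \<sigma>\<^sup>2 * g) / 2))"
    by (rule tendsto_add)
  then show ?thesis by (simp add: ch_def[abs_def] a_def m_def)
qed

theorem theorem4p5:
  fixes M :: "nat \<Rightarrow> 'a measure"
    and d s1 s2 :: "nat \<Rightarrow> nat" and q :: nat
    and P :: "nat \<Rightarrow> (nat \<Rightarrow> real) measure" and Q :: "real measure"
    and X :: "nat \<Rightarrow> nat \<Rightarrow> 'a \<Rightarrow> real vec" and \<epsilon> :: "nat \<Rightarrow> nat \<Rightarrow> 'a \<Rightarrow> real"
    and \<mu> \<beta> :: "nat \<Rightarrow> real vec"
    and \<kappa> \<gamma> lam :: "nat \<Rightarrow> real" and \<sigma> \<alpha> :: real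
    and A :: "nat \<Rightarrow> real mat" and G\<^sub>X :: "real mat"
    and mu_hat beta_hat beta_tilde :: "nat \<Rightarrow> 'a \<Rightarrow> real vec"
  \<comment> \<open>the model\<close>
  assumes "\<forall>n\<ge>1. d n \<ge> 1"
    and "filterlim d at_top sequentially"
    and "(\<lambda>n. real (d n)) \<in> o(\<lambda>n. real n)"
    and "\<sigma> > 0" and "noise_law \<sigma> Q"
    and "\<forall>n\<ge>1. design_law (d n) (P n)"
    and "\<forall>n\<ge>1. data_model (M n) n (d n) (P n) Q (X n) (\<epsilon> n)"
    and "\<forall>n\<ge>1. \<mu> n \<in> carrier_vec n"
    and "\<forall>n\<ge>1. \<beta> n \<in> carrier_vec (d n)"
  \<comment> \<open>(A)\<close>
    and "\<forall>n\<ge>1. \<kappa> n > 0" and "\<kappa> \<in> o(\<lambda>n. sqrt (real n))"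
    and "\<forall>n\<ge>1. \<gamma> n > 0" and "\<gamma> \<in> o(\<lambda>n. sqrt (real n))"
    and "(\<lambda>n. measure (M n) {\<omega> \<in> space (M n).
            Max ((\<lambda>i. vec_norm2 (X n i \<omega>)) ` {..<n}) > \<kappa> n}) \<longlonglongrightarrow> 0"
    and "(\<lambda>n. measure (M n) {\<omega> \<in> space (M n).
            Max ((\<lambda>i. \<bar>\<epsilon> n i \<omega>\<bar>) ` {..<n}) > \<gamma> n}) \<longlonglongrightarrow> 0"
  \<comment> \<open>incidental parameters\<close>
    and "\<forall>n\<ge>1. s1 n + s2 n \<le> n"
    and "(\<lambda>n. real (s1 n + s2 n)) \<in> o(\<lambda>n. real n)"
    and "negligible_to_mu_star (\<lambda>n. max (\<kappa> n) (\<gamma> n)) s1 \<mu>"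
    and "\<forall>n\<ge>1. \<forall>i. s1 n \<le> i \<and> i < s1 n + s2 n \<longrightarrow> 0 < \<bar>\<mu> n $ i\<bar> \<and> \<bar>\<mu> n $ i\<bar> \<le> \<gamma> n"
    and "\<forall>n\<ge>1. \<forall>i. s1 n + s2 n \<le> i \<and> i < n \<longrightarrow> \<mu> n $ i = 0"
  \<comment> \<open>(B')\<close>
    and "\<forall>n\<ge>1. lam n > 0"
    and "(\<lambda>n. sqrt (real (d n)) * \<kappa> n) \<in> o(lam)"
    and "\<alpha> > 2" and "\<forall>n\<ge>1. \<alpha> * \<gamma> n \<le> lam n"
    and "negligible_to_mu_star lam s1 \<mu>"
  \<comment> \<open>(D'), (D''), (E)\<close>
    and "bounded_away_from_zero (\<lambda>n. lambda_min (cov_mat (d n) (P n)))"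
    and "Bseq (\<lambda>n. frob_norm_scaled (d n) (cov_mat (d n) (P n)))"
    and "\<forall>n\<ge>1. \<forall>j<d n. integrable (P n) (\<lambda>x. x j ^ 4)"
    and "Bseq (\<lambda>n. kappa_X (d n) (P n))"
  \<comment> \<open>(F)\<close>
    and "q \<ge> 1" and "\<forall>n\<ge>1. A n \<in> carrier_mat q (d n)"
    and "Bseq (\<lambda>n. frob_norm (A n))"
    and "Bseq (\<lambda>n. lambda_max (A n * transpose_mat (A n)))"
    and "G\<^sub>X \<in> carrier_mat q q" and "transpose_mat G\<^sub>X = G\<^sub>X"
    and "(\<lambda>n. frob_norm (A n * inv_mat (cov_mat (d n) (P n)) * transpose_mat (A n) - G\<^sub>X))
            \<longlonglongrightarrow> 0"
  \<comment> \<open>(G)\<close>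
    and "\<forall>n\<ge>1. sigma_X_max (d n) (P n) > 0"
    and "Bseq (\<lambda>n. sigma_X_max (d n) (P n))"
    and "Bseq (\<lambda>n. gamma_X_max (d n) (P n))"
    and "bounded_away_from_zero (\<lambda>n. sigma_X_min (d n) (P n))"
  \<comment> \<open>the two-step estimator\<close>
    and "\<forall>n\<ge>1. random_vec (M n) n (mu_hat n)"
    and "\<forall>n\<ge>1. random_vec (M n) (d n) (beta_hat n)"
    and "\<forall>n\<ge>1. \<forall>\<omega>\<in>space (M n). penalized_minimizer n (d n) (lam n)
            (design_mat n (d n) (X n) \<omega>) (response n (\<mu> n) (\<beta> n) (X n) (\<epsilon> n) \<omega>)
            (mu_hat n \<omega>) (beta_hat n \<omega>)"
    and "\<forall>n\<ge>1. random_vec (M n) (d n) (beta_tilde n)"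
    and "\<forall>n\<ge>1. \<forall>\<omega>\<in>space (M n). ols_on (zero_set (mu_hat n \<omega>))
            (design_mat n (d n) (X n) \<omega>) (response n (\<mu> n) (\<beta> n) (X n) (\<epsilon> n) \<omega>)
            (beta_tilde n \<omega>)"
  \<comment> \<open>growth conditions\<close>
    and "(\<lambda>n. real (d n) ^ 5 * ln (real (d n))) \<in> o(\<lambda>n. real n)"
    and "(\<lambda>n. real (s2 n)) \<in> o(\<lambda>n. sqrt (real n) / (sqrt (real (d n)) * \<kappa> n * \<gamma> n))"
  shows "\<exists>N. normal_law q (0\<^sub>v q) (\<sigma>\<^sup>2 \<cdot>\<^sub>m G\<^sub>X) N \<and>
    weak_conv_vec q
      (\<lambda>n. vec_law (M n) q (\<lambda>\<omega>. sqrt (real n) \<cdot>\<^sub>v (A n *\<^sub>v (beta_tilde n \<omega> - \<beta> n)))) N"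
proof -
  have RS: "regression_sample (M n) n (d n) (P n) Q (X n) (\<epsilon> n) \<sigma>" if "n \<ge> 1" for n
  proof (intro regression_sample.intro regression_sample_axioms.intro)
    show "data_model (M n) n (d n) (P n) Q (X n) (\<epsilon> n)" using assms(7) that by blast
    then show "prob_space (M n)" by (simp add: data_model_def)
  qed (use assms(5,6,28) that in auto)
  obtain c where c: "c > 0" "\<And>n. n \<ge> 1 \<Longrightarrow> c \<le> lambda_min (cov_mat (d n) (P n))"
    using assms(26) unfolding bounded_away_from_zero_def by blast
  obtain CA where CA: "CA > 0" "\<And>n. frob_norm (A n) \<le> CA"
    using assms(32) unfolding Bseq_def by (metis abs_le_D1 real_norm_def)
  obtain Ck where Ck: "Ck > 0" "\<And>n. kappa_X (d n) (P n) \<le> Ck"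
    using assms(29) unfolding Bseq_def by (metis abs_le_D1 real_norm_def)
  \<comment> \<open>With this choice \<alpha> \<gamma> \<le> lam reads 2 \<gamma> \<le> (1 -
    \<theta>) lam, one \<gamma> for the noise and one for a small shift; \<alpha> > 2 makes the
    margin \<theta> positive.\<close>
  define \<theta> where "\<theta> = 1 - 2 / \<alpha>"
  have \<theta>: "0 < \<theta>" "\<theta> < 1" using assms(23) by (auto simp: \<theta>_def)
  define \<delta> where "\<delta> = c * \<theta> / 64"
  have \<delta>: "\<delta> > 0" using c(1) \<theta>(1) by (simp add: \<delta>_def)
  have tau_le: "regression_sample.\<tau> (d n) (P n) \<le> Ck * real (d n)" if "n \<ge> 1" for n
  proof -
    have "d n \<ge> 1" using assms(1) that by blast
    then show ?thesis
      using Ck(2)[of n] by (simp add: regression_sample.\<tau>_def[OF RS[OF that]] kappa_X_def pos_divide_le_eq)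
  qed
  define B where "B n = A n * inv_mat (cov_mat (d n) (P n))" for n
  define LS where "LS n u = regression_sample.lin_stat (d n) (X n) (\<epsilon> n) {s1 n..<n} (sqrt (real n) / real (n - s1 n)) u" for n u
  define V where "V n \<omega> = sqrt (real n) \<cdot>\<^sub>v (A n *\<^sub>v (beta_tilde n \<omega> - \<beta> n))" for n \<omega>
  define Bad where "Bad n = regression_sample.bad_event (M n) n (d n) (P n) (X n) (\<epsilon> n) (s1 n) (\<mu> n) (\<kappa> n) (\<gamma> n)
      (sqrt (real n / real (d n))) (real (n - s1 n) * sqrt (real (d n) ^ 3 / real n))
      (real (d n) * sqrt (real n)) (\<delta> * sqrt (real n * real (d n)))" for n
  define err where "err n = CA / c * (8 / c * sqrt (real (d n) ^ 5 / real n) + 2 / sqrt (real (d n)))" for n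

  \<comment> \<open>Limits of the rates\<close>
  have d_top: "filterlim (\<lambda>n. real (d n)) at_top sequentially"
    by (rule filterlim_compose[OF filterlim_real_sequentially assms(2)])
  have d5: "(\<lambda>n. real (d n) ^ 5 / real n) \<longlonglongrightarrow> 0"
  proof (rule Lim_null_comparison)
    show "(\<lambda>n. real (d n) ^ 5 * ln (real (d n)) / real n) \<longlonglongrightarrow> 0" using assms(46) by (rule smalloD_tendsto)
    \<comment> \<open>Once d exceeds e the logarithm is at least 1 and may be put in as a
      factor.\<close>
    have "\<forall>\<^sub>F n in sequentially. exp 1 \<le> real (d n)" using d_top by (simp add: filterlim_at_top)
    then show "\<forall>\<^sub>F n in sequentially. norm (real (d n) ^ 5 / real n) \<le> real (d n) ^ 5 * ln (real (d n)) / real n"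
    proof eventually_elim
      case (elim n)
      then have "ln (exp 1) \<le> ln (real (d n))" by (intro ln_mono) (auto intro: less_le_trans[OF exp_gt_zero])
      then have "real (d n) ^ 5 * 1 \<le> real (d n) ^ 5 * ln (real (d n))" by (intro mult_left_mono) auto
      then show ?case by (simp add: divide_right_mono)
    qed
  qed
  have d_pow: "(\<lambda>n. real (d n) ^ k / real n) \<longlonglongrightarrow> 0" if "k \<le> 5" for k
  proof (rule Lim_null_comparison[OF _ d5])
    show "\<forall>\<^sub>F n in sequentially. norm (real (d n) ^ k / real n) \<le> real (d n) ^ 5 / real n"
      using eventually_ge_at_top[of 1]
    proof eventually_elim
      case (elim n)
      then have "1 \<le> real (d n)" using assms(1) by force
      then show ?case using that by (simp add: divide_right_mono power_increasing)
    qed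
  qed
  have inv_d: "(\<lambda>n. 1 / real (d n)) \<longlonglongrightarrow> 0" "(\<lambda>n. 1 / sqrt (real (d n))) \<longlonglongrightarrow> 0"
    by (intro tendsto_divide_0[OF tendsto_const] filterlim_at_top_imp_at_infinity d_top filterlim_compose[OF sqrt_at_top d_top])+
  have s1_n: "(\<lambda>n. real (s1 n) / real n) \<longlonglongrightarrow> 0"
  proof (rule Lim_null_comparison)
    show "(\<lambda>n. real (s1 n + s2 n) / real n) \<longlonglongrightarrow> 0" using assms(17) by (rule smalloD_tendsto)
  qed (auto intro!: always_eventually divide_right_mono)
  have err0: "err \<longlonglongrightarrow> 0"
  proof -
    have "err \<longlonglongrightarrow> CA / c * (8 / c * sqrt 0 + 2 * 0)"
      unfolding err_def[abs_def] using inv_d(2) by (intro tendsto_intros d5) (simp add: tendsto_mult_right_zero divide_inverse)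
    then show ?thesis by simp
  qed
  have err_nonneg: "err n \<ge> 0" for n using c CA by (auto simp: err_def)

  \<comment> \<open>The good event for large sample sizes\<close>
  have regime: "\<forall>\<^sub>F n in sequentially. Bad n \<in> sets (M n) \<and>
      measure (M n) (Bad n) \<le> measure (M n) {\<omega> \<in> space (M n). Max ((\<lambda>i. vec_norm2 (X n i \<omega>)) ` {..<n}) > \<kappa> n} +
        measure (M n) {\<omega> \<in> space (M n). Max ((\<lambda>i. \<bar>\<epsilon> n i \<omega>\<bar>) ` {..<n}) > \<gamma> n} +
        Ck\<^sup>2 * (real (d n) ^ 4 / real n) + 2 * Ck\<^sup>2 * (1 / real (d n)) + \<sigma>\<^sup>2 * Ck * (1 / real (d n)) +
        Ck / \<delta>\<^sup>2 * (real (s1 n) / real n) \<and>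
      (\<forall>\<omega>\<in>space (M n). \<omega> \<notin> Bad n \<longrightarrow> (\<forall>r<q. \<bar>V n \<omega> $ r - LS n (\<lambda>j. B n $$ (r, j)) \<omega>\<bar> \<le> err n))"
  proof -
    have "\<forall>\<^sub>F n in sequentially. real (s1 n) / real n < 1 / 2" by (rule order_tendstoD[OF s1_n]) simp
    moreover have "\<forall>\<^sub>F n in sequentially. real (d n) ^ 3 / real n < (c / 2)\<^sup>2"
      using c by (intro order_tendstoD[OF d_pow]) auto
    moreover have "\<forall>\<^sub>F n in sequentially. real (d n) ^ 1 / real n < 1" by (intro order_tendstoD[OF d_pow]) auto
    moreover have "\<forall>\<^sub>F n in sequentially. norm (sqrt (real (d n)) * \<kappa> n) \<le> \<delta> * norm (lam n)"
      using assms(22) \<delta> by (rule landau_o.smallD)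
    \<comment> \<open>The factor 1 / 8 yields |\<mu> i| \<ge> 8 lam for the outliers. For s1 = 0
      there is no outlier, and the minimum of the empty set in \<open>mu_star\<close> is never
      consulted.\<close>
    moreover have "\<forall>\<^sub>F n in sequentially. s1 n > 0 \<longrightarrow> \<bar>lam n\<bar> \<le> 1 / 8 * mu_star (s1 n) (\<mu> n)"
    proof -
      have "(1 / 8 :: real) > 0" by simp
      with assms(25) show ?thesis unfolding negligible_to_mu_star_def by blast
    qed
    moreover have "\<forall>\<^sub>F n in sequentially. norm (real (s2 n)) \<le> 1 * norm (sqrt (real n) / (sqrt (real (d n)) * \<kappa> n * \<gamma> n))"
      using assms(47) by (rule landau_o.smallD) simp
    ultimately show ?thesis using eventually_ge_at_top[of 1]
    proof eventually_elim
      case (elim n)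
      then have n: "n \<ge> 1" by simp
      interpret regression_sample "M n" n "d n" "P n" Q "X n" "\<epsilon> n" \<sigma> by (rule RS[OF n])
      have n0: "real n > 0" and dn1: "d n \<ge> 1" using n assms(1) by auto
      have pos: "lam n > 0" "\<kappa> n > 0" "\<gamma> n > 0" using assms(10,12,21) n by auto
      have \<gamma>_lam: "2 * \<gamma> n \<le> (1 - \<theta>) * lam n"
      proof -
        have "\<alpha> * \<gamma> n \<le> lam n" using assms(24) n by blast
        then have "(2 / \<alpha>) * (\<alpha> * \<gamma> n) \<le> (2 / \<alpha>) * lam n" using assms(23) by (intro mult_left_mono) auto
        then show ?thesis using assms(23) by (simp add: \<theta>_def)
      qed
      have \<mu>1: "\<bar>\<mu> n $ i\<bar> \<ge> 8 * lam n" if "i < s1 n" for i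
      proof -
        have "mu_star (s1 n) (\<mu> n) \<le> \<bar>\<mu> n $ i\<bar>" unfolding mu_star_def using that by (intro Min_le) auto
        then show ?thesis using elim(5) that pos by auto
      qed
      have small_h: "sqrt (real (d n) ^ 3 / real n) \<le> c / 2"
        using real_sqrt_le_mono[OF less_imp_le[OF elim(2)]] c by simp
      have s2: "real (s2 n) * \<kappa> n * \<gamma> n \<le> sqrt (real n) / sqrt (real (d n))"
      proof -
        have "real (s2 n) \<le> sqrt (real n) / (sqrt (real (d n)) * \<kappa> n * \<gamma> n)"
          using elim(6) pos by (simp add: abs_mult)
        then have "real (s2 n) * (\<kappa> n * \<gamma> n) \<le> sqrt (real n) / (sqrt (real (d n)) * \<kappa> n * \<gamma> n) * (\<kappa> n * \<gamma> n)"
          using pos by (intro mult_right_mono) auto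
        then show ?thesis using pos by (simp add: mult.assoc)
      qed
      have dn: "d n \<le> n" using elim(3) n0 by (simp add: pos_divide_less_eq)
      have s_half: "2 * s1 n \<le> n" using elim(1) n0 by (simp add: pos_divide_less_eq)
      have \<kappa>_lam: "sqrt (real (d n)) * \<kappa> n \<le> \<delta> * lam n" using elim(4) pos by simp
      have carrier: "mu_hat n \<omega> \<in> carrier_vec n \<and> beta_hat n \<omega> \<in> carrier_vec (d n) \<and> beta_tilde n \<omega> \<in> carrier_vec (d n)"
        if "\<omega> \<in> space (M n)" for \<omega>
        using assms(41,42,44) n that by (auto simp: random_vec_def)
      note close = two_step_close_to_lin_stat[OF n dn1 dn assms(8)[rule_format, OF n] assms(9)[rule_format, OF n]
          assms(16)[rule_format, OF n] s_half pos(1) \<theta> pos(3) \<gamma>_lam pos(2) \<mu>1 _ _ c(1) c(2)[OF n] \<delta>_def small_h \<kappa>_lam s2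
          assms(31)[rule_format, OF n] CA(2)[of n] carrier assms(43)[rule_format, OF n] assms(45)[rule_format, OF n],
          folded Bad_def V_def B_def LS_def err_def]
      have \<mu>2: "\<bar>\<mu> n $ i\<bar> \<le> \<gamma> n" if "s1 n \<le> i" "i < s1 n + s2 n" for i using assms(19) n that by blast
      have \<mu>3: "\<mu> n $ i = 0" if "s1 n + s2 n \<le> i" "i < n" for i using assms(20) n that by blast
      have d0: "real (d n) > 0" using dn1 by simp
      have b1: "\<tau>\<^sup>2 * (real (d n))\<^sup>2 / real n \<le> Ck\<^sup>2 * (real (d n) ^ 4 / real n)"
      proof -
        have "\<tau>\<^sup>2 * (real (d n))\<^sup>2 \<le> (Ck * real (d n))\<^sup>2 * (real (d n))\<^sup>2"
          using tau_le[OF n] \<tau>_nonneg by (intro mult_right_mono power_mono) auto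
        also have "\<dots> = Ck\<^sup>2 * real (d n) ^ 4" by (simp add: power_mult_distrib flip: power_add)
        finally show ?thesis by (simp add: divide_right_mono)
      qed
      have b2: "2 * \<tau>\<^sup>2 / real (d n) ^ 3 \<le> 2 * Ck\<^sup>2 * (1 / real (d n))"
      proof -
        have "2 * \<tau>\<^sup>2 / real (d n) ^ 3 \<le> 2 * (Ck * real (d n))\<^sup>2 / real (d n) ^ 3"
          using tau_le[OF n] \<tau>_nonneg by (intro divide_right_mono mult_left_mono power_mono) auto
        also have "\<dots> = 2 * Ck\<^sup>2 * (1 / real (d n))" using d0 by (simp add: power2_eq_square power3_eq_cube)
        finally show ?thesis .
      qed
      have b3: "\<sigma>\<^sup>2 * \<tau> / (real (d n))\<^sup>2 \<le> \<sigma>\<^sup>2 * Ck * (1 / real (d n))"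
      proof -
        have "\<sigma>\<^sup>2 * \<tau> / (real (d n))\<^sup>2 \<le> \<sigma>\<^sup>2 * (Ck * real (d n)) / (real (d n))\<^sup>2"
          using tau_le[OF n] by (intro divide_right_mono mult_left_mono) auto
        also have "\<dots> = \<sigma>\<^sup>2 * Ck * (1 / real (d n))" using d0 by (simp add: power2_eq_square)
        finally show ?thesis .
      qed
      have b4: "real (s1 n) * \<tau> / (\<delta>\<^sup>2 * real n * real (d n)) \<le> Ck / \<delta>\<^sup>2 * (real (s1 n) / real n)"
      proof -
        have "real (s1 n) * \<tau> / (\<delta>\<^sup>2 * real n * real (d n)) \<le> real (s1 n) * (Ck * real (d n)) / (\<delta>\<^sup>2 * real n * real (d n))"
          using tau_le[OF n] by (intro divide_right_mono mult_left_mono) auto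
        also have "\<dots> = Ck / \<delta>\<^sup>2 * (real (s1 n) / real n)" using d0 by (simp add: field_simps)
        finally show ?thesis .
      qed
      have "Bad n \<in> events" by (rule close(1)) (use \<mu>2 \<mu>3 in auto)
      moreover have "prob (Bad n) \<le> prob {\<omega> \<in> space (M n). Max ((\<lambda>i. vec_norm2 (X n i \<omega>)) ` {..<n}) > \<kappa> n} +
        prob {\<omega> \<in> space (M n). Max ((\<lambda>i. \<bar>\<epsilon> n i \<omega>\<bar>) ` {..<n}) > \<gamma> n} +
        \<tau>\<^sup>2 * (real (d n))\<^sup>2 / real n + 2 * \<tau>\<^sup>2 / real (d n) ^ 3 + \<sigma>\<^sup>2 * \<tau> / (real (d n))\<^sup>2
          + real (s1 n) * \<tau> / (\<delta>\<^sup>2 * real n * real (d n))"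
        by (rule close(2)) (use \<mu>2 \<mu>3 in auto)
      moreover have "\<bar>V n \<omega> $ r - LS n (\<lambda>j. B n $$ (r, j)) \<omega>\<bar> \<le> err n"
        if "\<omega> \<in> space (M n)" "\<omega> \<notin> Bad n" "r < q" for \<omega> r
        by (rule close(3)[OF _ _ _ _ _ _ that]) (use \<mu>2 \<mu>3 in auto)
      ultimately show ?case using b1 b2 b3 b4 by (intro conjI) auto
    qed
  qed
  have bad0: "(\<lambda>n. measure (M n) (Bad n)) \<longlonglongrightarrow> 0"
  proof (rule Lim_null_comparison)
    let ?b = "\<lambda>n. measure (M n) {\<omega> \<in> space (M n). Max ((\<lambda>i. vec_norm2 (X n i \<omega>)) ` {..<n}) > \<kappa> n} +
        measure (M n) {\<omega> \<in> space (M n). Max ((\<lambda>i. \<bar>\<epsilon> n i \<omega>\<bar>) ` {..<n}) > \<gamma> n} +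
        Ck\<^sup>2 * (real (d n) ^ 4 / real n) + 2 * Ck\<^sup>2 * (1 / real (d n)) + \<sigma>\<^sup>2 * Ck * (1 / real (d n)) +
        Ck / \<delta>\<^sup>2 * (real (s1 n) / real n)"
    show "\<forall>\<^sub>F n in sequentially. norm (measure (M n) (Bad n)) \<le> ?b n"
      using regime by eventually_elim simp
    have "?b \<longlonglongrightarrow> 0 + 0 + Ck\<^sup>2 * 0 + 2 * Ck\<^sup>2 * 0 + \<sigma>\<^sup>2 * Ck * 0 + Ck / \<delta>\<^sup>2 * 0"
      by (intro tendsto_intros assms(14,15) d_pow inv_d s1_n) simp
    then show "?b \<longlonglongrightarrow> 0" by simp
  qed

  \<comment> \<open>Measurability of the normalized error\<close>
  have V_carrier: "V n \<omega> \<in> carrier_vec q" if "n \<ge> 1" for n \<omega>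
  proof (rule carrier_vecI)
    have "A n \<in> carrier_mat q (d n)" using assms(31) that by blast
    then show "dim_vec (V n \<omega>) = q" by (simp add: V_def)
  qed
  have V_nth: "V n \<omega> $ r = sqrt (real n) * ip (d n) (\<lambda>j. A n $$ (r, j)) (\<lambda>j. beta_tilde n \<omega> $ j - \<beta> n $ j)"
    if "n \<ge> 1" "r < q" "\<omega> \<in> space (M n)" for n r \<omega>
  proof -
    have A: "A n \<in> carrier_mat q (d n)" and b: "beta_tilde n \<omega> \<in> carrier_vec (d n)" "\<beta> n \<in> carrier_vec (d n)"
      using assms(9,31,44) that by (auto simp: random_vec_def)
    then have "beta_tilde n \<omega> - \<beta> n \<in> carrier_vec (d n)" by simp
    then show ?thesis using mult_mat_vec_ip[OF A _ that(2), of "beta_tilde n \<omega> - \<beta> n"] A b that(2)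
      by (simp add: V_def ip_def)
  qed
  have V_meas: "(\<lambda>\<omega>. V n \<omega> $ r) \<in> borel_measurable (M n)" if n: "n \<ge> 1" and r: "r < q" for n r
  proof -
    have "(\<lambda>\<omega>. beta_tilde n \<omega> $ j) \<in> borel_measurable (M n)" if "j < d n" for j
    proof -
      have "(\<lambda>\<omega>. coords (d n) (beta_tilde n \<omega>)) \<in> measurable (M n) (RV (d n))"
        using assms(44) n by (auto simp: random_vec_def)
      from measurable_compose[OF this coord_measurable[OF that]] show ?thesis using that by (simp add: coords_def)
    qed
    then have "(\<lambda>\<omega>. sqrt (real n) * ip (d n) (\<lambda>j. A n $$ (r, j)) (\<lambda>j. beta_tilde n \<omega> $ j - \<beta> n $ j)) \<in> borel_measurable (M n)"
      unfolding ip_def by (intro borel_measurable_times borel_measurable_const borel_measurable_sum borel_measurable_diff) auto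
    then show ?thesis by (subst measurable_cong[OF V_nth[OF n r]])
  qed
  have V_coords: "(\<lambda>\<omega>. coords q (V n \<omega>)) \<in> measurable (M n) (RV q)" if "n \<ge> 1" for n
  proof (rule measurable_PiM_single')
    show "(\<lambda>\<omega>. coords q (V n \<omega>)) \<in> space (M n) \<rightarrow> {..<q} \<rightarrow>\<^sub>E space borel" by (auto simp: coords_def)
    show "(\<lambda>\<omega>. coords q (V n \<omega>) r) \<in> borel_measurable (M n)" if "r \<in> {..<q}" for r
      using V_meas[OF \<open>n \<ge> 1\<close>] that by (simp add: coords_def)
  qed

  \<comment> \<open>Linear combinations of the coordinates and their limiting variance\<close>
  define W where "W t n = (\<lambda>j. \<Sum>r<q. t r * B n $$ (r, j))" for t :: "nat \<Rightarrow> real" and n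
  have rows: "bil (d n) (regression_sample.Sig (d n) (P n)) (\<lambda>j. B n $$ (r, j)) (\<lambda>j. B n $$ (r', j))
        = (A n * inv_mat (cov_mat (d n) (P n)) * transpose_mat (A n)) $$ (r, r')"
      "nrm (d n) (\<lambda>j. B n $$ (r, j)) \<le> CA / c" if "n \<ge> 1" "r < q" "r' < q" for n r r'
  proof -
    interpret regression_sample "M n" n "d n" "P n" Q "X n" "\<epsilon> n" \<sigma> by (rule RS[OF that(1)])
    have S: "cov_mat (d n) (P n) \<in> carrier_mat (d n) (d n)" "transpose_mat (cov_mat (d n) (P n)) = cov_mat (d n) (P n)"
      using pos_def_Sig by (auto simp: pos_def_mat_def)
    have dn1: "d n \<ge> 1" and A: "A n \<in> carrier_mat q (d n)" using assms(1,31) that by auto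
    have coer: "c * (nrm (d n) v)\<^sup>2 \<le> bil (d n) (\<lambda>j k. cov_mat (d n) (P n) $$ (j, k)) v v" for v
      using lambda_min_le_bil[OF S dn1, of v] mult_right_mono[OF c(2)[OF that(1)], of "(nrm (d n) v)\<^sup>2"] by simp
    show "bil (d n) Sig (\<lambda>j. B n $$ (r, j)) (\<lambda>j. B n $$ (r', j))
        = (A n * inv_mat (cov_mat (d n) (P n)) * transpose_mat (A n)) $$ (r, r')"
      unfolding Sig_eq B_def by (rule mult_inv_mat_rows(2)[OF A pos_def_Sig c(1) coer that(2,3)])
    show "nrm (d n) (\<lambda>j. B n $$ (r, j)) \<le> CA / c"
      using mult_inv_mat_rows(3)[OF A pos_def_Sig c(1) coer that(2), folded B_def] divide_right_mono[OF CA(2)[of n], of c] c by simp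
  qed
  have G_entry: "(\<lambda>n. (A n * inv_mat (cov_mat (d n) (P n)) * transpose_mat (A n)) $$ (r, r')) \<longlonglongrightarrow> G\<^sub>X $$ (r, r')"
    if "r < q" "r' < q" for r r'
  proof -
    have "(\<lambda>n. (A n * inv_mat (cov_mat (d n) (P n)) * transpose_mat (A n)) $$ (r, r') - G\<^sub>X $$ (r, r')) \<longlonglongrightarrow> 0"
    proof (rule Lim_null_comparison[OF _ assms(36)])
      show "\<forall>\<^sub>F n in sequentially. norm ((A n * inv_mat (cov_mat (d n) (P n)) * transpose_mat (A n)) $$ (r, r') - G\<^sub>X $$ (r, r'))
          \<le> frob_norm (A n * inv_mat (cov_mat (d n) (P n)) * transpose_mat (A n) - G\<^sub>X)"
        using eventually_ge_at_top[of 1]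
      proof eventually_elim
        case (elim n)
        let ?D = "A n * inv_mat (cov_mat (d n) (P n)) * transpose_mat (A n)"
        have "A n \<in> carrier_mat q (d n)" using assms(31) elim by blast
        then have "?D \<in> carrier_mat q q" by (intro carrier_matI) simp_all
        then have "?D - G\<^sub>X \<in> carrier_mat q q" by (intro minus_carrier_mat assms(34))
        from abs_entry_le_frob_norm[OF this that] show ?case
          using that \<open>?D \<in> carrier_mat q q\<close> assms(34) by simp
      qed
    qed
    then show ?thesis by (simp add: LIM_zero_iff)
  qed
  have bil_lim: "(\<lambda>n. bil (d n) (regression_sample.Sig (d n) (P n)) (W t n) (W t n)) \<longlonglongrightarrow> bil q (\<lambda>i j. G\<^sub>X $$ (i, j)) t t" for t
  proof -
    have "(\<lambda>n. \<Sum>r<q. \<Sum>r'<q. t r * (A n * inv_mat (cov_mat (d n) (P n)) * transpose_mat (A n)) $$ (r, r') * t r')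
        \<longlonglongrightarrow> bil q (\<lambda>i j. G\<^sub>X $$ (i, j)) t t"
      unfolding bil_def by (intro tendsto_intros G_entry) auto
    moreover have "\<forall>\<^sub>F n in sequentially. (\<Sum>r<q. \<Sum>r'<q. t r * (A n * inv_mat (cov_mat (d n) (P n)) * transpose_mat (A n)) $$ (r, r') * t r')
        = bil (d n) (regression_sample.Sig (d n) (P n)) (W t n) (W t n)"
      using eventually_ge_at_top[of 1]
    proof eventually_elim
      case (elim n)
      show ?case unfolding W_def bil_sum using rows(1)[OF elim] by (intro sum.cong refl) auto
    qed
    ultimately show ?thesis by (rule Lim_transform_eventually)
  qed
  \<comment> \<open>Semidefiniteness of \<open>G\<^sub>X\<close> is inherited from the variances of
    which its form is the limit; it supplies the root needed for the normal law to exist.\<close>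
  have psd: "0 \<le> bil q (\<lambda>i j. G\<^sub>X $$ (i, j)) t t" for t
  proof (rule tendsto_lowerbound[OF bil_lim])
    show "\<forall>\<^sub>F n in sequentially. 0 \<le> bil (d n) (regression_sample.Sig (d n) (P n)) (W t n) (W t n)"
      using eventually_ge_at_top[of 1] by eventually_elim (rule regression_sample.bil_Sig_nonneg[OF RS])
  qed simp
  have bil_scaled: "bil q (\<lambda>i j. (\<sigma>\<^sup>2 \<cdot>\<^sub>m G\<^sub>X) $$ (i, j)) t t = \<sigma>\<^sup>2 * bil q (\<lambda>i j. G\<^sub>X $$ (i, j)) t t" for t
    unfolding bil_def sum_distrib_left using assms(34) by (intro sum.cong refl) simp
  obtain N where N: "normal_law q (0\<^sub>v q) (\<sigma>\<^sup>2 \<cdot>\<^sub>m G\<^sub>X) N"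
  proof -
    have "\<sigma>\<^sup>2 \<cdot>\<^sub>m G\<^sub>X \<in> carrier_mat q q" using assms(34) by simp
    moreover have "transpose_mat (\<sigma>\<^sup>2 \<cdot>\<^sub>m G\<^sub>X) = \<sigma>\<^sup>2 \<cdot>\<^sub>m G\<^sub>X"
    proof (rule eq_matI)
      fix i j assume "i < dim_row (\<sigma>\<^sup>2 \<cdot>\<^sub>m G\<^sub>X)" "j < dim_col (\<sigma>\<^sup>2 \<cdot>\<^sub>m G\<^sub>X)"
      then have ij: "i < q" "j < q" using assms(34) by auto
      then have "G\<^sub>X $$ (j, i) = G\<^sub>X $$ (i, j)"
        using arg_cong[OF assms(35), of "\<lambda>A. A $$ (i, j)"] assms(34) by simp
      then show "transpose_mat (\<sigma>\<^sup>2 \<cdot>\<^sub>m G\<^sub>X) $$ (i, j) = (\<sigma>\<^sup>2 \<cdot>\<^sub>m G\<^sub>X) $$ (i, j)"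
        using ij assms(34) by simp
    qed (use assms(34) in auto)
    ultimately have "\<exists>N. normal_law q (0\<^sub>v q) (\<sigma>\<^sup>2 \<cdot>\<^sub>m G\<^sub>X) N"
      by (rule normal_law_exists) (simp add: bil_scaled psd)
    then show ?thesis using that by blast
  qed
  note N_props = normal_law_cos_integral[OF N]

  \<comment> \<open>Convergence of the trigonometric integrals\<close>
  have LS_meas: "LS n u \<in> borel_measurable (M n)" if "n \<ge> 1" for n u
    unfolding LS_def by (rule regression_sample.lin_stat_measurable[OF RS[OF that]]) auto
  have char_lim: "(\<lambda>n. char (distr (M n) borel (LS n (W t n))) 1) \<longlonglongrightarrow>
      complex_of_real (exp (- (\<sigma>\<^sup>2 * bil q (\<lambda>i j. G\<^sub>X $$ (i, j)) t t) / 2))" for t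
    unfolding LS_def
  proof (rule lin_stat_char_tendsto[OF RS s1_n _ _ bil_lim tau_le d_pow])
    show "nrm (d n) (W t n) \<le> (\<Sum>r<q. \<bar>t r\<bar> * (CA / c))" if "n \<ge> 1" for n
    proof -
      have "nrm (d n) (W t n) \<le> (\<Sum>r<q. \<bar>t r\<bar> * nrm (d n) (\<lambda>j. B n $$ (r, j)))"
        unfolding W_def by (rule nrm_sum_le)
      also have "\<dots> \<le> (\<Sum>r<q. \<bar>t r\<bar> * (CA / c))"
        using rows(2)[OF that] by (intro sum_mono mult_left_mono) auto
      finally show ?thesis .
    qed
    show "s1 n \<le> n" if "n \<ge> 1" for n using assms(16) that by force
  qed auto
  have cos_lim: "(\<lambda>n. \<integral>\<omega>. cos ((\<Sum>r<q. t r * V n \<omega> $ r) + b) \<partial>M n) \<longlonglongrightarrow>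
      exp (- (\<sigma>\<^sup>2 * bil q (\<lambda>i j. G\<^sub>X $$ (i, j)) t t) / 2) * cos b" for t b
  proof -
    have "(\<lambda>n. Re (char (distr (M n) borel (LS n (W t n))) 1 * iexp b)) \<longlonglongrightarrow>
        Re (complex_of_real (exp (- (\<sigma>\<^sup>2 * bil q (\<lambda>i j. G\<^sub>X $$ (i, j)) t t) / 2)) * iexp b)"
      by (intro tendsto_intros char_lim)
    also have "Re (complex_of_real (exp (- (\<sigma>\<^sup>2 * bil q (\<lambda>i j. G\<^sub>X $$ (i, j)) t t) / 2)) * iexp b) =
        exp (- (\<sigma>\<^sup>2 * bil q (\<lambda>i j. G\<^sub>X $$ (i, j)) t t) / 2) * cos b"
      by (simp add: Re_exp)
    finally have L: "(\<lambda>n. Re (char (distr (M n) borel (LS n (W t n))) 1 * iexp b)) \<longlonglongrightarrow>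
        exp (- (\<sigma>\<^sup>2 * bil q (\<lambda>i j. G\<^sub>X $$ (i, j)) t t) / 2) * cos b" .
    \<comment> \<open>Replacing the estimator by the linear statistic costs the deterministic error
      on the good event plus twice the probability of the bad one.\<close>
    have D: "(\<lambda>n. (\<integral>\<omega>. cos ((\<Sum>r<q. t r * V n \<omega> $ r) + b) \<partial>M n) - Re (char (distr (M n) borel (LS n (W t n))) 1 * iexp b)) \<longlonglongrightarrow> 0"
    proof (rule Lim_null_comparison)
      show "(\<lambda>n. (\<Sum>r<q. \<bar>t r\<bar>) * err n + 2 * measure (M n) (Bad n)) \<longlonglongrightarrow> 0"
        using tendsto_add[OF tendsto_mult[OF tendsto_const err0, of "\<Sum>r<q. \<bar>t r\<bar>"] tendsto_mult[OF tendsto_const bad0, of 2]] by simp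
      show "\<forall>\<^sub>F n in sequentially. norm ((\<integral>\<omega>. cos ((\<Sum>r<q. t r * V n \<omega> $ r) + b) \<partial>M n)
          - Re (char (distr (M n) borel (LS n (W t n))) 1 * iexp b)) \<le> (\<Sum>r<q. \<bar>t r\<bar>) * err n + 2 * measure (M n) (Bad n)"
        using regime eventually_ge_at_top[of 1]
      proof eventually_elim
        case (elim n)
        interpret regression_sample "M n" n "d n" "P n" Q "X n" "\<epsilon> n" \<sigma> by (rule RS[OF elim(2)])
        have "\<bar>expectation (\<lambda>\<omega>. cos ((\<Sum>r<q. t r * V n \<omega> $ r) + b)) - expectation (\<lambda>\<omega>. cos (LS n (W t n) \<omega> + b))\<bar>
            \<le> (\<Sum>r<q. \<bar>t r\<bar>) * err n + 2 * prob (Bad n)"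
        proof (rule expectation_cos_diff_le)
          show "LS n (W t n) \<in> borel_measurable (M n)" by (rule LS_meas[OF elim(2)])
          show "(\<lambda>\<omega>. \<Sum>r<q. t r * V n \<omega> $ r) \<in> borel_measurable (M n)"
            using V_meas[OF elim(2)] by (intro borel_measurable_sum borel_measurable_times borel_measurable_const) auto
          show "Bad n \<in> events" using elim by simp
          show "0 \<le> (\<Sum>r<q. \<bar>t r\<bar>) * err n" using err_nonneg by (intro mult_nonneg_nonneg sum_nonneg) auto
          fix \<omega> assume \<omega>: "\<omega> \<in> space (M n)" "\<omega> \<notin> Bad n"
          have "LS n (W t n) \<omega> = (\<Sum>r<q. t r * LS n (\<lambda>j. B n $$ (r, j)) \<omega>)"
            unfolding LS_def W_def by (rule lin_stat_sum)
          then have "\<bar>(\<Sum>r<q. t r * V n \<omega> $ r) - LS n (W t n) \<omega>\<bar> = \<bar>\<Sum>r<q. t r * (V n \<omega> $ r - LS n (\<lambda>j. B n $$ (r, j)) \<omega>)\<bar>"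
            by (simp add: right_diff_distrib sum_subtractf)
          also have "\<dots> \<le> (\<Sum>r<q. \<bar>t r\<bar> * err n)"
            using elim(1) \<omega> by (intro order_trans[OF sum_abs] sum_mono) (auto simp: abs_mult intro!: mult_left_mono)
          finally show "\<bar>(\<Sum>r<q. t r * V n \<omega> $ r) - LS n (W t n) \<omega>\<bar> \<le> (\<Sum>r<q. \<bar>t r\<bar>) * err n"
            by (simp add: sum_distrib_right)
        qed
        then show ?case by (simp only: expectation_cos_add[OF LS_meas[OF elim(2)]] real_norm_def)
      qed
    qed
    from tendsto_add[OF D L] show ?thesis by simp
  qed

  \<comment> \<open>Tightness\<close>
  have tight: "\<exists>K. \<forall>\<^sub>F n in sequentially. measure (M n) {\<omega> \<in> space (M n). \<exists>r<q. \<bar>V n \<omega> $ r\<bar> > K} \<le> e" if "e > 0" for e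
  proof -
    define w where "w r n = bil (d n) (regression_sample.Sig (d n) (P n)) (\<lambda>j. B n $$ (r, j)) (\<lambda>j. B n $$ (r, j))" for r n
    \<comment> \<open>The second moment of coordinate r of the linear statistic is n / m times
      \<sigma>^2 times \<open>w r n\<close>, and n / m \<le> 4 once s1 < n / 2. The +1 dominates the
      convergence error of \<open>w\<close> and keeps S positive for a vanishing limit; K is then
      chosen with S / K^2 = e / 2.\<close>
    define S where "S = 4 * \<sigma>\<^sup>2 * (\<Sum>r<q. \<bar>G\<^sub>X $$ (r, r)\<bar> + 1)"
    have "S > 0"
    proof -
      have "(\<Sum>r<q. \<bar>G\<^sub>X $$ (r, r)\<bar> + 1) > 0" using assms(30) by (intro sum_pos) (auto simp: lessThan_empty_iff)
      then show ?thesis using assms(4) by (simp add: S_def)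
    qed
    define K where "K = sqrt (2 * S / e)"
    have K: "K > 0" "K\<^sup>2 = 2 * S / e" using \<open>S > 0\<close> \<open>e > 0\<close> by (auto simp: K_def)
    have w_le: "\<forall>\<^sub>F n in sequentially. \<forall>r\<in>{..<q}. w r n < \<bar>G\<^sub>X $$ (r, r)\<bar> + 1"
    proof (intro eventually_ball_finite ballI)
      fix r assume r: "r \<in> {..<q}"
      have "\<forall>\<^sub>F n in sequentially. (A n * inv_mat (cov_mat (d n) (P n)) * transpose_mat (A n)) $$ (r, r) < \<bar>G\<^sub>X $$ (r, r)\<bar> + 1"
        using r by (intro order_tendstoD[OF G_entry]) auto
      then show "\<forall>\<^sub>F n in sequentially. w r n < \<bar>G\<^sub>X $$ (r, r)\<bar> + 1"
        using eventually_ge_at_top[of 1] by eventually_elim (use r in \<open>simp add: w_def rows(1)\<close>)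
    qed simp
    have half: "\<forall>\<^sub>F n in sequentially. real (s1 n) / real n < 1 / 2" by (rule order_tendstoD[OF s1_n]) simp
    have "\<forall>\<^sub>F n in sequentially. measure (M n) (Bad n) < e / 2" using \<open>e > 0\<close> by (intro order_tendstoD[OF bad0]) simp
    moreover have "\<forall>\<^sub>F n in sequentially. err n < 1" by (rule order_tendstoD[OF err0]) simp
    \<comment> \<open>K + 1 leaves room for the distance between estimator and linear statistic,
      which is eventually below 1 on the good event.\<close>
    ultimately have "\<forall>\<^sub>F n in sequentially. measure (M n) {\<omega> \<in> space (M n). \<exists>r<q. \<bar>V n \<omega> $ r\<bar> > K + 1} \<le> e"
      using regime eventually_ge_at_top[of 1] w_le half
    proof eventually_elim
      case (elim n)
      then have n: "n \<ge> 1" and n0: "real n > 0" by auto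
      interpret regression_sample "M n" n "d n" "P n" Q "X n" "\<epsilon> n" \<sigma> by (rule RS[OF n])
      let ?U = "\<lambda>r. LS n (\<lambda>j. B n $$ (r, j))"
      let ?O = "\<lambda>r. {\<omega> \<in> space (M n). \<bar>?U r \<omega>\<bar> > K}"
      have O_ev: "?O r \<in> events" for r using LS_meas[OF n, of "\<lambda>j. B n $$ (r, j)"] by measurable
      have O_le: "prob (?O r) \<le> 4 * \<sigma>\<^sup>2 * (\<bar>G\<^sub>X $$ (r, r)\<bar> + 1) / K\<^sup>2" if r: "r < q" for r
      proof (rule prob_gt_le_second_moment)
        have J: "{s1 n..<n} \<subseteq> {..<n}" by auto
        let ?m = "real (n - s1 n)"
        have m: "?m > 0" "real n \<le> 2 * ?m" using elim(6) n0 by (auto simp: pos_divide_less_eq)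
        show "integrable (M n) (\<lambda>\<omega>. (?U r \<omega>)\<^sup>2)" unfolding LS_def by (rule lin_stat_second_moment(1)[OF J])
        have "expectation (\<lambda>\<omega>. (?U r \<omega>)\<^sup>2) = ?m * ((sqrt (real n) / ?m)\<^sup>2 * \<sigma>\<^sup>2 * w r n)"
          unfolding LS_def lin_stat_second_moment(2)[OF J] w_def by simp
        also have "\<dots> = (real n / ?m) * (\<sigma>\<^sup>2 * w r n)" using m by (simp add: power_divide) (simp add: power2_eq_square)
        also have "\<dots> \<le> 4 * (\<sigma>\<^sup>2 * (\<bar>G\<^sub>X $$ (r, r)\<bar> + 1))"
        proof (rule mult_mono)
          show "real n / ?m \<le> 4" using m by (simp add: pos_divide_le_eq)
          have "w r n < \<bar>G\<^sub>X $$ (r, r)\<bar> + 1" by (rule bspec[OF elim(5)]) (use r in simp)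
          then have "w r n \<le> \<bar>G\<^sub>X $$ (r, r)\<bar> + 1" by (rule less_imp_le)
          then show "\<sigma>\<^sup>2 * w r n \<le> \<sigma>\<^sup>2 * (\<bar>G\<^sub>X $$ (r, r)\<bar> + 1)" by (rule mult_left_mono) simp
          show "0 \<le> \<sigma>\<^sup>2 * w r n" using bil_Sig_nonneg by (simp add: w_def)
        qed simp
        finally show "expectation (\<lambda>\<omega>. (?U r \<omega>)\<^sup>2) \<le> 4 * \<sigma>\<^sup>2 * (\<bar>G\<^sub>X $$ (r, r)\<bar> + 1)" by simp
        show "?U r \<in> borel_measurable (M n)" by (rule LS_meas[OF n])
      qed (rule K(1))
      have "{\<omega> \<in> space (M n). \<exists>r<q. \<bar>V n \<omega> $ r\<bar> > K + 1} \<subseteq> Bad n \<union> (\<Union>r<q. ?O r)"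
      proof
        fix \<omega> assume "\<omega> \<in> {\<omega> \<in> space (M n). \<exists>r<q. \<bar>V n \<omega> $ r\<bar> > K + 1}"
        then obtain r where r: "r < q" "\<bar>V n \<omega> $ r\<bar> > K + 1" and \<omega>: "\<omega> \<in> space (M n)" by blast
        show "\<omega> \<in> Bad n \<union> (\<Union>r<q. ?O r)"
        proof (cases "\<omega> \<in> Bad n")
          case False
          then have "\<bar>V n \<omega> $ r - ?U r \<omega>\<bar> \<le> err n" using elim(3) \<omega> r(1) by blast
          then have "\<bar>?U r \<omega>\<bar> > K" using r(2) elim(2) by linarith
          then show ?thesis using \<omega> r(1) by blast
        qed simp
      qed
      then have "prob {\<omega> \<in> space (M n). \<exists>r<q. \<bar>V n \<omega> $ r\<bar> > K + 1} \<le> prob (Bad n \<union> (\<Union>r<q. ?O r))"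
        using elim(3) O_ev by (intro finite_measure_mono) auto
      also have "\<dots> \<le> prob (Bad n) + prob (\<Union>r<q. ?O r)"
        using elim(3) O_ev by (intro measure_Un_le) auto
      also have "prob (\<Union>r<q. ?O r) \<le> (\<Sum>r<q. prob (?O r))"
        using O_ev by (intro finite_measure_subadditive_finite) auto
      also have "\<dots> \<le> (\<Sum>r<q. 4 * \<sigma>\<^sup>2 * (\<bar>G\<^sub>X $$ (r, r)\<bar> + 1) / K\<^sup>2)" using O_le by (intro sum_mono) auto
      also have "\<dots> = S / K\<^sup>2" by (simp only: S_def sum_distrib_left sum_divide_distrib)
      also have "\<dots> = e / 2" unfolding K(2) using \<open>S > 0\<close> \<open>e > 0\<close> by simp
      finally show ?case using elim(1) by simp
    qed
    then show ?thesis by blast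
  qed

  \<comment> \<open>Weak convergence of the laws\<close>
  have "weak_conv_vec q (\<lambda>n. vec_law (M n) q (V n)) N"
  proof (rule weak_conv_vecI)
    \<comment> \<open>At n = 0 the model imposes nothing, so the laws are controlled only
      eventually.\<close>
    show "\<forall>\<^sub>F n in sequentially. prob_space (vec_law (M n) q (V n)) \<and> sets (vec_law (M n) q (V n)) = sets (RV q)"
      using eventually_ge_at_top[of 1]
    proof eventually_elim
      case (elim n)
      interpret regression_sample "M n" n "d n" "P n" Q "X n" "\<epsilon> n" \<sigma> by (rule RS[OF elim])
      show ?case unfolding vec_law_def using prob_space_distr[OF V_coords[OF elim]] by simp
    qed
    show "prob_space N" "sets N = sets (RV q)" by (rule N_props)+
    show "\<exists>K. measure N {x \<in> space (RV q). \<exists>r<q. \<bar>x r\<bar> > K} \<le> e" if "e > 0" for e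
      by (rule prob_space_tight[OF N_props(1,2) that])
    show "(\<lambda>n. \<integral>x. cos ((\<Sum>r<q. t r * x r) + b) \<partial>vec_law (M n) q (V n)) \<longlonglongrightarrow> (\<integral>x. cos ((\<Sum>r<q. t r * x r) + b) \<partial>N)" for t b
    proof -
      have "\<forall>\<^sub>F n in sequentially. (\<integral>\<omega>. cos ((\<Sum>r<q. t r * V n \<omega> $ r) + b) \<partial>M n) =
          (\<integral>x. cos ((\<Sum>r<q. t r * x r) + b) \<partial>vec_law (M n) q (V n))"
        using eventually_ge_at_top[of 1]
      proof eventually_elim
        case (elim n)
        have "(\<lambda>x. cos ((\<Sum>r<q. t r * x r) + b)) \<in> borel_measurable (RV q)"
          using trig_fun_measurable[OF trig_cos[of q 1 t b]] by simp
        then show ?case unfolding vec_law_def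
          by (subst integral_distr[OF V_coords[OF elim]]) (simp_all add: coords_def)
      qed
      from Lim_transform_eventually[OF cos_lim this] show ?thesis by (simp add: N_props(3) bil_scaled)
    qed
    fix e :: real assume "e > 0"
    then obtain K where K: "\<forall>\<^sub>F n in sequentially. measure (M n) {\<omega> \<in> space (M n). \<exists>r<q. \<bar>V n \<omega> $ r\<bar> > K} \<le> e"
      using tight by blast
    have "\<forall>\<^sub>F n in sequentially. measure (vec_law (M n) q (V n)) {x \<in> space (RV q). \<exists>r<q. \<bar>x r\<bar> > K} \<le> e"
      using K eventually_ge_at_top[of 1]
    proof eventually_elim
      case (elim n)
      have "{x \<in> space (RV q). \<exists>r<q. \<bar>x r\<bar> > K} \<in> sets (RV q)" by measurable
      then have "measure (vec_law (M n) q (V n)) {x \<in> space (RV q). \<exists>r<q. \<bar>x r\<bar> > K} =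
          measure (M n) ((\<lambda>\<omega>. coords q (V n \<omega>)) -` {x \<in> space (RV q). \<exists>r<q. \<bar>x r\<bar> > K} \<inter> space (M n))"
        unfolding vec_law_def by (rule measure_distr[OF V_coords[OF elim(2)]])
      also have "(\<lambda>\<omega>. coords q (V n \<omega>)) -` {x \<in> space (RV q). \<exists>r<q. \<bar>x r\<bar> > K} \<inter> space (M n) =
          {\<omega> \<in> space (M n). \<exists>r<q. \<bar>V n \<omega> $ r\<bar> > K}"
        using measurable_space[OF V_coords[OF elim(2)]] by (auto simp: coords_def)
      finally show ?case using elim(1) by simp
    qed
    then show "\<exists>K. \<forall>\<^sub>F n in sequentially. measure (vec_law (M n) q (V n)) {x \<in> space (RV q). \<exists>r<q. \<bar>x r\<bar> > K} \<le> e"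
      by blast
  qed
  then show ?thesis using N unfolding V_def[abs_def] by blast
qed

end
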